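(* Let $\emptyset\neq\omega\subseteq G\Subset\Omega\subset\mathbb{R}^n$ be bounded domains and let $\alpha\in(0,1]$ be an exponent for which there is a constant $C_0$ with $\|w\|_{L_2(G)}\le C_0\|w\|_{L_2(\omega)}^\alpha\|w\|_{L_2(\Omega)}^{1-\alpha}$ for all harmonic $w\in L_2(\Omega)$. Let $(X^\delta)_{\delta\in I}$ be a family of finite dimensional subspaces of $L_2(\Omega)$ and $(Y^\delta)_{\delta\in I}$ a family of finite dimensional (or closed) subspaces of $H^2_0(\Omega)$ such that $$\varrho:=\inf_{\delta\in I}\ \inf_{\{z\in X^\delta\colon Bz\neq0\}}\ \sup_{0\neq v\in Y^\delta}\frac{|(Bz)(v)|}{\|Bz\|_{H^{-2}(\Omega)}\|\Delta v\|_{L_2(\Omega)}}>0 .$$ For $\delta\in I$, $\varepsilon\ge 0$ and $(\ell,q)\in H^{-2}(\Omega)\times L_2(\omega)$, let $$u_\varepsilon^\delta:=\operatorname*{argmin}_{z\in X^\delta}\Big\{\sup_{0\neq v\in Y^\delta}\frac{|(Bz-\ell)(v)|^2}{\|\Delta v\|_{L_2(\Omega)}^2}+\|Cz-q\|_{L_2(\omega)}^2+\varepsilon^2\|z\|_{L_2(\Omega)}^2\Big\},$$ and, for $u\in L_2(\Omega)$, let $$\mathcal{E}_{\rm data}:=\|Au-(\ell,q)\|_{H^{-2}(\Omega)\times L_2(\omega)},\qquad \mathcal{E}_{\rm appr}(\delta):=\min_{z\in X^\delta}\|u-z\|_{L_2(\Omega)}.$$ Fix constants $\varepsilon_0,c_1,c_2>0$.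 Then there is a constant $K$, independent of $\delta,\varepsilon,\ell,q,u$, such that for all $\delta\in I$, $(\ell,q)\in H^{-2}(\Omega)\times L_2(\omega)$, $u\in L_2(\Omega)$, and all $\varepsilon\in(0,\varepsilon_0]$ with $$c_1\big(\mathcal{E}_{\rm data}+\mathcal{E}_{\rm appr}(\delta)\big)\le \varepsilon\|u\|_{L_2(\Omega)}\le c_2\big(\mathcal{E}_{\rm data}+\mathcal{E}_{\rm appr}(\delta)\big),$$ it holds that $$\|u-u_\varepsilon^\delta\|_{L_2(G)}\le K\,\big(\mathcal{E}_{\rm data}+\mathcal{E}_{\rm appr}(\delta)\big)^{\alpha}\,\max\big(\mathcal{E}_{\rm data}+\mathcal{E}_{\rm appr}(\delta),\,\|u\|_{L_2(\Omega)}\big)^{1-\alpha}.$$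
   Context: A domain is a non-empty open connected set; $D\Subset E$ means that $\overline D$ is a compact subset of $E$. All spaces are real. $H^{-2}(\Omega)$ is the dual of $H^2_0(\Omega)$. The operator $A=(B,C)\in\mathcal{L}(L_2(\Omega),H^{-2}(\Omega)\times L_2(\omega))$ is defined by $(Bz)(v):=-\int_\Omega z\,\Delta v\,dx$ ($v\in H^2_0(\Omega)$) and $Cz:=z|_\omega$. The norm $\|\Delta\cdot\|_{L_2(\Omega)}$ is equivalent to $\|\cdot\|_{H^2(\Omega)}$ on $H^2_0(\Omega)$. The norm on $H^{-2}(\Omega)\times L_2(\omega)$ is $(\|\cdot\|_{H^{-2}(\Omega)}^2+\|\cdot\|_{L_2(\omega)}^2)^{1/2}$. It is a known result that an exponent $\alpha\in(0,1)$ as in the claim exists when $\omega\Subset G\Subset \Omega$; for $G=\omega$ one may take $\alpha=1$. Factors with exponent $0$ are read as $1$. *)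

theory Defs
  imports "HOL-Analysis.Analysis"
begin

text \<open>
  Elements of \<open>L\<^sub>2(\<Omega>)\<close> are represented by real functions on the whole space of which only the
  values on \<open>\<Omega>\<close> matter, up to null sets.  Everything below depends on such a function only through
  its class modulo equality almost everywhere on \<open>\<Omega>\<close>; the restriction \<open>C z = z|\<^sub>\<omega>\<close> is
  thus represented by \<open>z\<close> itself, regarded as an element of \<open>L\<^sub>2(\<omega>)\<close>.
\<close>

definition bounded_domain :: "'a::euclidean_space set \<Rightarrow> bool" where
  "bounded_domain S \<longleftrightarrow> S \<noteq> {} \<and> open S \<and> connected S \<and> bounded S"

definition compactly_contained :: "'a::euclidean_space set \<Rightarrow> 'a set \<Rightarrow> bool" where
  "compactly_contained D E \<longleftrightarrow> compact (closure D) \<and> closure D \<subseteq> E"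


section \<open>Classical derivatives\<close>

primrec partials :: "'a::euclidean_space list \<Rightarrow> ('a \<Rightarrow> real) \<Rightarrow> 'a \<Rightarrow> real" where
  "partials [] f = f"
| "partials (b # bs) f = (\<lambda>x. frechet_derivative (partials bs f) (at x) b)"

text \<open>\<open>k\<close>-fold continuous differentiability, meaningful for open \<open>S\<close>.\<close>

definition Ck_on :: "nat \<Rightarrow> 'a::euclidean_space set \<Rightarrow> ('a \<Rightarrow> real) \<Rightarrow> bool" where
  "Ck_on k S f \<longleftrightarrow> (\<forall>bs\<in>lists Basis.
      (length bs < k \<longrightarrow> (\<forall>x\<in>S. partials bs f differentiable (at x))) \<and>
      (length bs \<le> k \<longrightarrow> continuous_on S (partials bs f)))"

definition harmonic_on :: "'a::euclidean_space set \<Rightarrow> ('a \<Rightarrow> real) \<Rightarrow> bool" where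
  "harmonic_on S f \<longleftrightarrow> Ck_on 2 S f \<and> (\<forall>x\<in>S. (\<Sum>b\<in>Basis. partials [b, b] f x) = 0)"

text \<open>\<open>C\<^sub>c\<^sup>\<infinity>(\<Omega>)\<close>, extended by zero to the whole space.\<close>

definition test_functions :: "'a::euclidean_space set \<Rightarrow> ('a \<Rightarrow> real) set" where
  "test_functions \<Omega> = {\<phi>. (\<forall>k. Ck_on k UNIV \<phi>) \<and>
      compact (closure {x. \<phi> x \<noteq> 0}) \<and> closure {x. \<phi> x \<noteq> 0} \<subseteq> \<Omega>}"


section \<open>The space \<open>L\<^sub>2\<close>\<close>

definition L2 :: "'a::euclidean_space set \<Rightarrow> ('a \<Rightarrow> real) set" where
  "L2 \<Omega> = {f. f \<in> borel_measurable (lebesgue_on \<Omega>) \<and> integrable (lebesgue_on \<Omega>) (\<lambda>x. (f x)\<^sup>2)}"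

definition norm_L2 :: "'a::euclidean_space set \<Rightarrow> ('a \<Rightarrow> real) \<Rightarrow> real" where
  "norm_L2 \<Omega> f = sqrt (\<integral>x. (f x)\<^sup>2 \<partial>lebesgue_on \<Omega>)"

definition zero_on :: "'a::euclidean_space set \<Rightarrow> ('a \<Rightarrow> real) \<Rightarrow> bool" where
  "zero_on \<Omega> f \<longleftrightarrow> (AE x in lebesgue_on \<Omega>. f x = 0)"

definition linear_subspace :: "('a \<Rightarrow> real) set \<Rightarrow> bool" where
  "linear_subspace S \<longleftrightarrow> (\<lambda>x. 0) \<in> S \<and>
      (\<forall>f\<in>S. \<forall>g\<in>S. (\<lambda>x. f x + g x) \<in> S) \<and> (\<forall>c. \<forall>f\<in>S. (\<lambda>x. c * f x) \<in> S)"

text \<open>Finite dimension refers to classes modulo equality almost everywhere on \<open>\<Omega>\<close>.\<close>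

definition finite_dimensional :: "'a::euclidean_space set \<Rightarrow> ('a \<Rightarrow> real) set \<Rightarrow> bool" where
  "finite_dimensional \<Omega> S \<longleftrightarrow> (\<exists>B. finite B \<and> B \<subseteq> S \<and>
      (\<forall>f\<in>S. \<exists>c. AE x in lebesgue_on \<Omega>. f x = (\<Sum>b\<in>B. c b * b x)))"


section \<open>The spaces \<open>H\<^sup>2\<close>, \<open>H\<^sup>2\<^sub>0\<close> and the dual of \<open>H\<^sup>2\<^sub>0\<close>\<close>

definition has_weak_derivative ::
  "'a::euclidean_space set \<Rightarrow> 'a list \<Rightarrow> ('a \<Rightarrow> real) \<Rightarrow> ('a \<Rightarrow> real) \<Rightarrow> bool" where
  "has_weak_derivative \<Omega> bs u g \<longleftrightarrow> (\<forall>\<phi>\<in>test_functions \<Omega>.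
      (\<integral>x. u x * partials bs \<phi> x \<partial>lebesgue_on \<Omega>)
        = (-1) ^ length bs * (\<integral>x. g x * \<phi> x \<partial>lebesgue_on \<Omega>))"

text \<open>A representative of the weak derivative, which is unique up to null sets.\<close>

definition weak_derivative ::
  "'a::euclidean_space set \<Rightarrow> 'a list \<Rightarrow> ('a \<Rightarrow> real) \<Rightarrow> 'a \<Rightarrow> real" where
  "weak_derivative \<Omega> bs u = (SOME g. g \<in> L2 \<Omega> \<and> has_weak_derivative \<Omega> bs u g)"

definition weak_laplacian :: "'a::euclidean_space set \<Rightarrow> ('a \<Rightarrow> real) \<Rightarrow> 'a \<Rightarrow> real" where
  "weak_laplacian \<Omega> v = (\<lambda>x. \<Sum>b\<in>Basis. weak_derivative \<Omega> [b, b] v x)"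

definition H2 :: "'a::euclidean_space set \<Rightarrow> ('a \<Rightarrow> real) set" where
  "H2 \<Omega> = {u \<in> L2 \<Omega>. \<forall>bs\<in>lists Basis. length bs \<le> 2 \<longrightarrow>
      (\<exists>g\<in>L2 \<Omega>. has_weak_derivative \<Omega> bs u g)}"

text \<open>The sum runs over ordered tuples of directions, so that the second order part is the
  Frobenius norm of the Hessian.\<close>

definition norm_H2 :: "'a::euclidean_space set \<Rightarrow> ('a \<Rightarrow> real) \<Rightarrow> real" where
  "norm_H2 \<Omega> u =
     sqrt (\<Sum>bs\<in>{bs \<in> lists Basis. length bs \<le> 2}. (norm_L2 \<Omega> (weak_derivative \<Omega> bs u))\<^sup>2)"

definition H20 :: "'a::euclidean_space set \<Rightarrow> ('a \<Rightarrow> real) set" where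
  "H20 \<Omega> = {v \<in> H2 \<Omega>. \<exists>\<phi>. (\<forall>k. \<phi> k \<in> test_functions \<Omega>) \<and>
      (\<lambda>k. norm_H2 \<Omega> (\<lambda>x. v x - \<phi> k x)) \<longlonglongrightarrow> 0}"

definition closed_in_H20 :: "'a::euclidean_space set \<Rightarrow> ('a \<Rightarrow> real) set \<Rightarrow> bool" where
  "closed_in_H20 \<Omega> Y \<longleftrightarrow> (\<forall>y v. (\<forall>k. y k \<in> Y) \<and> v \<in> H20 \<Omega> \<and>
      (\<lambda>k. norm_H2 \<Omega> (\<lambda>x. y k x - v x)) \<longlonglongrightarrow> 0 \<longrightarrow> v \<in> Y)"

text \<open>\<open>H\<^sup>-\<^sup>2(\<Omega>)\<close>: the bounded linear functionals on \<open>H\<^sup>2\<^sub>0(\<Omega>)\<close>.  Boundedness forces them to respect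
  equality almost everywhere.\<close>

definition Hm2 :: "'a::euclidean_space set \<Rightarrow> (('a \<Rightarrow> real) \<Rightarrow> real) set" where
  "Hm2 \<Omega> = {l.
      (\<forall>v\<in>H20 \<Omega>. \<forall>w\<in>H20 \<Omega>. l (\<lambda>x. v x + w x) = l v + l w) \<and>
      (\<forall>c. \<forall>v\<in>H20 \<Omega>. l (\<lambda>x. c * v x) = c * l v) \<and>
      (\<exists>M. \<forall>v\<in>H20 \<Omega>. \<bar>l v\<bar> \<le> M * norm_H2 \<Omega> v)}"

text \<open>As for \<^const>\<open>onorm\<close>, the convention \<open>x / 0 = 0\<close> takes care of \<open>v = 0\<close>.\<close>

definition norm_Hm2 :: "'a::euclidean_space set \<Rightarrow> (('a \<Rightarrow> real) \<Rightarrow> real) \<Rightarrow> real" where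
  "norm_Hm2 \<Omega> l = (SUP v\<in>H20 \<Omega>. \<bar>l v\<bar> / norm_H2 \<Omega> v)"


section \<open>The regularized least squares problem\<close>

definition opB :: "'a::euclidean_space set \<Rightarrow> ('a \<Rightarrow> real) \<Rightarrow> ('a \<Rightarrow> real) \<Rightarrow> real" where
  "opB \<Omega> z = (\<lambda>v. - (\<integral>x. z x * weak_laplacian \<Omega> v x \<partial>lebesgue_on \<Omega>))"

text \<open>The supremum over the empty set is \<open>0\<close> and the infimum over the empty set is \<open>\<infinity>\<close>.\<close>

definition inf_sup_constant ::
  "'a::euclidean_space set \<Rightarrow> 'i set \<Rightarrow> ('i \<Rightarrow> ('a \<Rightarrow> real) set) \<Rightarrow> ('i \<Rightarrow> ('a \<Rightarrow> real) set) \<Rightarrow> ennreal" where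
  "inf_sup_constant \<Omega> I X Y =
     (INF \<delta>\<in>I. INF z\<in>{z \<in> X \<delta>. \<exists>v\<in>H20 \<Omega>. opB \<Omega> z v \<noteq> 0}.
        SUP v\<in>{v \<in> Y \<delta>. \<not> zero_on \<Omega> v}.
          ennreal (\<bar>opB \<Omega> z v\<bar> / (norm_Hm2 \<Omega> (opB \<Omega> z) * norm_L2 \<Omega> (weak_laplacian \<Omega> v))))"

definition objective :: "'a::euclidean_space set \<Rightarrow> 'a set \<Rightarrow> ('a \<Rightarrow> real) set \<Rightarrow> real \<Rightarrow>
    (('a \<Rightarrow> real) \<Rightarrow> real) \<Rightarrow> ('a \<Rightarrow> real) \<Rightarrow> ('a \<Rightarrow> real) \<Rightarrow> ennreal" where
  "objective \<Omega> \<omega> Yd \<epsilon> l q z =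
     (SUP v\<in>{v \<in> Yd. \<not> zero_on \<Omega> v}.
        ennreal (\<bar>opB \<Omega> z v - l v\<bar>\<^sup>2 / (norm_L2 \<Omega> (weak_laplacian \<Omega> v))\<^sup>2))
     + ennreal ((norm_L2 \<omega> (\<lambda>x. z x - q x))\<^sup>2)
     + ennreal (\<epsilon>\<^sup>2 * (norm_L2 \<Omega> z)\<^sup>2)"

definition regularized_solution :: "'a::euclidean_space set \<Rightarrow> 'a set \<Rightarrow> ('a \<Rightarrow> real) set \<Rightarrow>
    ('a \<Rightarrow> real) set \<Rightarrow> real \<Rightarrow> (('a \<Rightarrow> real) \<Rightarrow> real) \<Rightarrow> ('a \<Rightarrow> real) \<Rightarrow> 'a \<Rightarrow> real" where
  "regularized_solution \<Omega> \<omega> Xd Yd \<epsilon> l q = arg_min_on (objective \<Omega> \<omega> Yd \<epsilon> l q) Xd"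

definition E_data :: "'a::euclidean_space set \<Rightarrow> 'a set \<Rightarrow> (('a \<Rightarrow> real) \<Rightarrow> real) \<Rightarrow>
    ('a \<Rightarrow> real) \<Rightarrow> ('a \<Rightarrow> real) \<Rightarrow> real" where
  "E_data \<Omega> \<omega> l q u =
     sqrt ((norm_Hm2 \<Omega> (\<lambda>v. opB \<Omega> u v - l v))\<^sup>2 + (norm_L2 \<omega> (\<lambda>x. u x - q x))\<^sup>2)"

text \<open>The infimum is attained when \<open>Xd\<close> is finite dimensional.\<close>

definition E_appr :: "'a::euclidean_space set \<Rightarrow> ('a \<Rightarrow> real) set \<Rightarrow> ('a \<Rightarrow> real) \<Rightarrow> real" where
  "E_appr \<Omega> Xd u = (INF z\<in>Xd. norm_L2 \<Omega> (\<lambda>x. u x - z x))"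

text \<open>Factors with exponent \<open>0\<close> are read as \<open>1\<close>, whereas \<open>0 powr 0 = 0\<close> in the library.\<close>

definition rpow :: "real \<Rightarrow> real \<Rightarrow> real" where
  "rpow x a = (if a = 0 then 1 else x powr a)"

end

(* On H^2_0 the norms |v|_{H^2} and |Delta v| are equivalent (integration by parts and Poincare's
   inequality for test functions, then density).  Comparing the functional at the minimiser U with
   its value at z in X^delta close to u, and using the inf-sup condition for z - U, one finds for
   w = u - U that |B w|, |w| on omega and epsilon |U| are all bounded by a multiple of
   E = E_data + E_appr; the last bound and the choice of epsilon give |U| <= C |u|.  Let h be w minus
   its projection onto the closure of the Laplacians of test functions.  Then |w - h| <= C |B w|,
   and h is weakly harmonic, hence harmonic by Weyl's lemma, so that the stability estimate for
   harmonic functions applies to h. *)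
theory Submission
  imports Defs
begin

section \<open>Square integrable functions\<close>

text \<open>Three infima shape the proof. \<open>E_appr\<close> is an infimum, so a competitor in
  X^delta is only nearly optimal and carries a slack \<open>\<tau>\<close>, sent to 0 at the end.
  The discrete solution is an \<open>arg_min_on\<close>, a choice that means something only once a
  minimiser is known to exist; this is where positive epsilon (strict convexity) and finite
  dimension (completeness) enter. The inf-sup constant may be infinite, so it is replaced by its
  minimum with 1. The projection is obtained by hand: minimise |w - Delta phi| over test functions;
  the parallelogram identity and Riesz-Fischer give a limit g, and minimality makes g orthogonal to
  all Laplacians, that is, weakly harmonic. The obstacle in Weyl's lemma is the singular fundamental
  solution. It is bypassed by mollifiers that are themselves Laplacians of smooth radial potentials,
  so that a mollified weakly harmonic function does not depend on the mollification radius.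
  Functions stand for classes modulo null sets and weak derivatives are chosen representatives, so
  linearity, expansions and uniqueness hold only almost everywhere.\<close>

definition sq_integrable :: "'a measure \<Rightarrow> ('a \<Rightarrow> real) \<Rightarrow> bool" where
  "sq_integrable M f \<longleftrightarrow> f \<in> borel_measurable M \<and> integrable M (\<lambda>x. (f x)\<^sup>2)"

definition l2norm :: "'a measure \<Rightarrow> ('a \<Rightarrow> real) \<Rightarrow> real" where
  "l2norm M f = sqrt (\<integral>x. (f x)\<^sup>2 \<partial>M)"

lemma L2_eq: "f \<in> L2 S \<longleftrightarrow> sq_integrable (lebesgue_on S) f"
  by (simp add: L2_def sq_integrable_def)

lemma norm_L2_eq: "norm_L2 S f = l2norm (lebesgue_on S) f"
  by (simp add: norm_L2_def l2norm_def)

lemma sq_integrable_measurable: "sq_integrable M f \<Longrightarrow> f \<in> borel_measurable M"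
  by (simp add: sq_integrable_def)

lemma sq_integrable_square: "sq_integrable M f \<Longrightarrow> integrable M (\<lambda>x. (f x)\<^sup>2)"
  by (simp add: sq_integrable_def)

lemma sq_integrable_mult:
  assumes "sq_integrable M f" "sq_integrable M g"
  shows "integrable M (\<lambda>x. f x * g x)"
proof (rule Bochner_Integration.integrable_bound)
  show "integrable M (\<lambda>x. (f x)\<^sup>2 + (g x)\<^sup>2)"
    using assms by (simp add: sq_integrable_def)
  show "(\<lambda>x. f x * g x) \<in> borel_measurable M"
    using assms by (auto simp: sq_integrable_def)
  have "\<bar>f x * g x\<bar> \<le> (f x)\<^sup>2 + (g x)\<^sup>2" for x
  proof -
    have "2 * \<bar>f x * g x\<bar> \<le> (f x)\<^sup>2 + (g x)\<^sup>2"
      using sum_squares_bound[of "\<bar>f x\<bar>" "\<bar>g x\<bar>"] by (simp add: abs_mult mult.assoc)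
    then show ?thesis by linarith
  qed
  then show "AE x in M. norm (f x * g x) \<le> norm ((f x)\<^sup>2 + (g x)\<^sup>2)"
    by (intro AE_I2) simp
qed

lemma sq_integrable_zero [simp]: "sq_integrable M (\<lambda>x. 0)"
  by (simp add: sq_integrable_def)

lemma sq_integrable_add:
  assumes "sq_integrable M f" "sq_integrable M g"
  shows "sq_integrable M (\<lambda>x. f x + g x)"
  using assms sq_integrable_mult[OF assms]
  by (auto simp: sq_integrable_def power2_sum mult.assoc)

lemma sq_integrable_cmult:
  assumes "sq_integrable M f" shows "sq_integrable M (\<lambda>x. c * f x)"
  using assms by (auto simp: sq_integrable_def power_mult_distrib)

lemma sq_integrable_minus:
  assumes "sq_integrable M f" shows "sq_integrable M (\<lambda>x. - f x)"
  using assms by (auto simp: sq_integrable_def)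

lemma sq_integrable_diff:
  assumes "sq_integrable M f" "sq_integrable M g"
  shows "sq_integrable M (\<lambda>x. f x - g x)"
  using sq_integrable_add[OF assms(1) sq_integrable_minus[OF assms(2)]] by simp

lemma sq_integrable_sum:
  assumes "\<And>i. i \<in> A \<Longrightarrow> sq_integrable M (f i)"
  shows "sq_integrable M (\<lambda>x. \<Sum>i\<in>A. f i x)"
  using assms by (induction A rule: infinite_finite_induct) (auto intro: sq_integrable_add)

lemma sq_integrable_cong_AE:
  assumes "sq_integrable M f" "g \<in> borel_measurable M" "AE x in M. f x = g x"
  shows "sq_integrable M g"
proof -
  have [measurable]: "f \<in> borel_measurable M" "g \<in> borel_measurable M"
    using assms by (auto simp: sq_integrable_def)
  have "integrable M (\<lambda>x. (f x)\<^sup>2) \<longleftrightarrow> integrable M (\<lambda>x. (g x)\<^sup>2)"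
    using assms(3) by (intro integrable_cong_AE) auto
  then show ?thesis using assms by (simp add: sq_integrable_def)
qed

lemma sq_integrable_bounded:
  assumes "f \<in> borel_measurable M" "emeasure M (space M) < \<infinity>" "\<And>x. x \<in> space M \<Longrightarrow> \<bar>f x\<bar> \<le> C"
  shows "sq_integrable M f"
proof -
  interpret finite_measure M using assms(2) by (intro finite_measureI) auto
  have "integrable M (\<lambda>x. (f x)\<^sup>2)"
  proof (intro integrable_const_bound[where B="C\<^sup>2"] AE_I2)
    show "norm ((f x)\<^sup>2) \<le> C\<^sup>2" if "x \<in> space M" for x
      using power_mono[OF assms(3)[OF that], of 2] by simp
  qed (use assms in measurable)
  then show ?thesis using assms by (simp add: sq_integrable_def)
qed

lemma l2norm_ge_0 [simp]: "0 \<le> l2norm M f"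
  by (simp add: l2norm_def)

lemma l2norm_square: "(l2norm M f)\<^sup>2 = (\<integral>x. (f x)\<^sup>2 \<partial>M)"
  by (simp add: l2norm_def)

lemma l2norm_zero [simp]: "l2norm M (\<lambda>x. 0) = 0"
  by (simp add: l2norm_def)

lemma l2norm_cong_AE:
  assumes "f \<in> borel_measurable M" "g \<in> borel_measurable M" "AE x in M. f x = g x"
  shows "l2norm M f = l2norm M g"
  unfolding l2norm_def using assms by (intro arg_cong[where f=sqrt] integral_cong_AE) auto

lemma l2norm_cmult: "l2norm M (\<lambda>x. c * f x) = \<bar>c\<bar> * l2norm M f"
  by (simp add: l2norm_def power_mult_distrib real_sqrt_mult)

lemma l2norm_minus: "l2norm M (\<lambda>x. - f x) = l2norm M f"
  by (simp add: l2norm_def)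

lemma l2norm_diff_commute: "l2norm M (\<lambda>x. f x - g x) = l2norm M (\<lambda>x. g x - f x)"
  by (simp add: l2norm_def power2_commute)

text \<open>The free factor \<open>c\<close> lets one expansion serve four purposes: Cauchy-Schwarz,
  the triangle inequality, the parallelogram identity and the variation of a minimiser.\<close>

lemma l2norm_square_add:
  assumes "sq_integrable M f" "sq_integrable M g"
  shows "(l2norm M (\<lambda>x. f x + c * g x))\<^sup>2
           = (l2norm M f)\<^sup>2 + 2 * c * (\<integral>x. f x * g x \<partial>M) + c\<^sup>2 * (l2norm M g)\<^sup>2"
proof -
  have "(\<integral>x. (f x + c * g x)\<^sup>2 \<partial>M)
      = (\<integral>x. (f x)\<^sup>2 + (2 * c) * (f x * g x) + c\<^sup>2 * (g x)\<^sup>2 \<partial>M)"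
    by (intro Bochner_Integration.integral_cong) (auto simp: power2_sum algebra_simps power2_eq_square)
  also have "\<dots> = (\<integral>x. (f x)\<^sup>2 \<partial>M) + 2 * c * (\<integral>x. f x * g x \<partial>M) + c\<^sup>2 * (\<integral>x. (g x)\<^sup>2 \<partial>M)"
    using sq_integrable_square[OF assms(1)] sq_integrable_square[OF assms(2)] sq_integrable_mult[OF assms]
    by simp
  finally show ?thesis by (simp add: l2norm_square)
qed

lemma Cauchy_Schwarz_l2:
  assumes "sq_integrable M f" "sq_integrable M g"
  shows "\<bar>\<integral>x. f x * g x \<partial>M\<bar> \<le> l2norm M f * l2norm M g"
proof -
  let ?a = "(l2norm M f)\<^sup>2" and ?c = "(l2norm M g)\<^sup>2" and ?b = "\<integral>x. f x * g x \<partial>M"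
  have q: "0 \<le> ?a + 2 * t * ?b + t\<^sup>2 * ?c" for t
    using l2norm_square_add[OF assms, of t] by (metis zero_le_power2)
  have "?b\<^sup>2 \<le> ?a * ?c"
  proof (cases "?c = 0")
    case True
    have "?b = 0"
    proof (rule ccontr)
      assume b: "?b \<noteq> 0"
      \<comment> \<open>With \<open>?c = 0\<close> the quadratic in t is affine; this t is the point
        where it takes the value -1.\<close>
      have "0 \<le> ?a + 2 * (- (?a + 1) / (2 * ?b)) * ?b + 0"
        using q[of "- (?a + 1) / (2 * ?b)"] True by simp
      also have "\<dots> = -1" using b by (simp add: field_simps)
      finally show False by simp
    qed
    then show ?thesis by simp
  next
    case False
    then have c: "?c > 0" by (simp add: less_le)
    \<comment> \<open>Evaluation at the minimum of the quadratic, t = - ?b / ?c.\<close>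
    have "0 \<le> ?a + 2 * (- ?b / ?c) * ?b + (- ?b / ?c)\<^sup>2 * ?c" by (rule q)
    also have "\<dots> = ?a - ?b\<^sup>2 / ?c" using c by (simp add: field_simps power2_eq_square)
    finally show ?thesis using c by (simp add: field_simps)
  qed
  then have "?b\<^sup>2 \<le> (l2norm M f * l2norm M g)\<^sup>2" by (simp add: power_mult_distrib)
  then show ?thesis by (metis abs_le_square_iff abs_of_nonneg l2norm_ge_0 mult_nonneg_nonneg)
qed

lemma l2norm_triangle:
  assumes "sq_integrable M f" "sq_integrable M g"
  shows "l2norm M (\<lambda>x. f x + g x) \<le> l2norm M f + l2norm M g"
proof (rule power2_le_imp_le)
  show "(l2norm M (\<lambda>x. f x + g x))\<^sup>2 \<le> (l2norm M f + l2norm M g)\<^sup>2"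
    using l2norm_square_add[OF assms, of 1] Cauchy_Schwarz_l2[OF assms]
    by (simp add: power2_sum)
qed simp

lemma l2norm_triangle_diff:
  assumes "sq_integrable M f" "sq_integrable M g"
  shows "l2norm M (\<lambda>x. f x - g x) \<le> l2norm M f + l2norm M g"
  using l2norm_triangle[OF assms(1) sq_integrable_minus[OF assms(2)]] by (simp add: l2norm_minus)

lemma l2norm_triangle_via:
  assumes "sq_integrable M f" "sq_integrable M g" "sq_integrable M h"
  shows "l2norm M (\<lambda>x. f x - h x) \<le> l2norm M (\<lambda>x. f x - g x) + l2norm M (\<lambda>x. g x - h x)"
  using l2norm_triangle[OF sq_integrable_diff[OF assms(1,2)] sq_integrable_diff[OF assms(2,3)]] by simp

lemma l2norm_le_diff:
  assumes "sq_integrable M f" "sq_integrable M g"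
  shows "l2norm M f \<le> l2norm M g + l2norm M (\<lambda>x. f x - g x)"
  using l2norm_triangle[OF assms(2) sq_integrable_diff[OF assms]] by simp

text \<open>Stated for midpoints because minimising sequences are compared at midpoints: the
  subtracted distance is what forces them to be Cauchy.\<close>

lemma l2norm_parallelogram:
  assumes "sq_integrable M f" "sq_integrable M g"
  shows "(l2norm M (\<lambda>x. (f x + g x) / 2))\<^sup>2
           = ((l2norm M f)\<^sup>2 + (l2norm M g)\<^sup>2) / 2 - (l2norm M (\<lambda>x. f x - g x))\<^sup>2 / 4"
proof -
  have "(l2norm M (\<lambda>x. (f x + g x) / 2))\<^sup>2 = (l2norm M (\<lambda>x. f x + g x))\<^sup>2 / 4"
  proof -
    have h: "l2norm M (\<lambda>x. (f x + g x) / 2) = l2norm M (\<lambda>x. f x + g x) / 2"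
      using l2norm_cmult[of M "1/2" "\<lambda>x. f x + g x"] by simp
    show ?thesis unfolding h by (simp add: power_divide)
  qed
  then show ?thesis
    using l2norm_square_add[OF assms, of 1] l2norm_square_add[OF assms, of "-1"]
    by (simp add: field_simps)
qed

lemma l2norm_eq_0_iff:
  assumes "sq_integrable M f"
  shows "l2norm M f = 0 \<longleftrightarrow> (AE x in M. f x = 0)"
  using integral_nonneg_eq_0_iff_AE[OF sq_integrable_square[OF assms]] by (simp add: l2norm_def)

lemma l2norm_sum_le:
  assumes "\<And>i. i \<in> A \<Longrightarrow> sq_integrable M (f i)"
  shows "l2norm M (\<lambda>x. \<Sum>i\<in>A. f i x) \<le> (\<Sum>i\<in>A. l2norm M (f i))"
  using assms
proof (induction A rule: infinite_finite_induct)
  case (insert a A)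
  have "l2norm M (\<lambda>x. f a x + (\<Sum>i\<in>A. f i x)) \<le> l2norm M (f a) + l2norm M (\<lambda>x. \<Sum>i\<in>A. f i x)"
    using insert by (intro l2norm_triangle sq_integrable_sum) auto
  with insert show ?case by fastforce
qed auto

lemma integral_abs_le_l2norm:
  assumes "sq_integrable M f" "emeasure M (space M) < \<infinity>"
  shows "integrable M f" "(\<integral>x. \<bar>f x\<bar> \<partial>M) \<le> l2norm M f * l2norm M (\<lambda>x. 1)"
proof -
  have 1: "sq_integrable M (\<lambda>x. 1)"
    by (rule sq_integrable_bounded[where C=1]) (use assms in auto)
  have a: "sq_integrable M (\<lambda>x. \<bar>f x\<bar>)" using assms by (auto simp: sq_integrable_def)
  show "integrable M f" using sq_integrable_mult[OF assms(1) 1] by simp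
  show "(\<integral>x. \<bar>f x\<bar> \<partial>M) \<le> l2norm M f * l2norm M (\<lambda>x. 1)"
    using Cauchy_Schwarz_l2[OF a 1] by (simp add: l2norm_def)
qed

text \<open>On a finite measure space the geometric rate makes the telescoping differences summable
  in L1, so the sequence itself converges almost everywhere and no subsequence is extracted. Fatou's
  lemma then hands the rate on to the limit.\<close>

lemma Riesz_Fischer_fast_Cauchy:
  fixes f :: "nat \<Rightarrow> 'a \<Rightarrow> real"
  assumes f: "\<And>k. sq_integrable M (f k)" and fin: "emeasure M (space M) < \<infinity>"
    and fast: "\<And>k m. k \<le> m \<Longrightarrow> l2norm M (\<lambda>x. f k x - f m x) \<le> (1/2)^k"
  shows "\<exists>g. sq_integrable M g \<and> (\<forall>k. l2norm M (\<lambda>x. f k x - g x) \<le> (1/2)^k)"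
proof -
  have [measurable]: "f k \<in> borel_measurable M" for k using f by (simp add: sq_integrable_def)
  define d where "d k x = f (Suc k) x - f k x" for k x
  have [measurable]: "d k \<in> borel_measurable M" for k unfolding d_def by measurable
  have sd: "sq_integrable M (d k)" for k unfolding d_def by (intro sq_integrable_diff f)
  define C where "C = l2norm M (\<lambda>x. 1)"
  have C: "C \<ge> 0" unfolding C_def by simp
  have d1: "(\<integral>\<^sup>+x. ennreal \<bar>d k x\<bar> \<partial>M) \<le> ennreal (C * (1/2)^k)" for k
  proof -
    have "(\<integral>\<^sup>+x. ennreal \<bar>d k x\<bar> \<partial>M) = ennreal (\<integral>x. \<bar>d k x\<bar> \<partial>M)"
      using integral_abs_le_l2norm(1)[OF sd fin] by (intro nn_integral_eq_integral) auto
    also have "(\<integral>x. \<bar>d k x\<bar> \<partial>M) \<le> l2norm M (d k) * C"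
      using integral_abs_le_l2norm(2)[OF sd fin] by (simp add: C_def)
    also have "l2norm M (d k) * C \<le> (1/2)^k * C"
      using fast[of k "Suc k"] C by (intro mult_right_mono) (auto simp: d_def[abs_def] l2norm_diff_commute)
    finally show ?thesis by (simp add: mult.commute ennreal_leI)
  qed
  have "(\<integral>\<^sup>+x. (\<Sum>k. ennreal \<bar>d k x\<bar>) \<partial>M) = (\<Sum>k. \<integral>\<^sup>+x. ennreal \<bar>d k x\<bar> \<partial>M)"
    by (intro nn_integral_suminf) measurable
  also have "\<dots> \<le> (\<Sum>k. ennreal (C * (1/2)^k))" by (intro suminf_le d1) auto
  also have "\<dots> = ennreal (\<Sum>k. C * (1/2)^k)"
  proof (rule suminf_ennreal2)
    show "summable (\<lambda>k. C * (1/2)^k)" by (intro summable_mult summable_geometric) simp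
    show "0 \<le> C * (1/2)^k" for k using C by simp
  qed
  finally have "(\<integral>\<^sup>+x. (\<Sum>k. ennreal \<bar>d k x\<bar>) \<partial>M) < \<infinity>"
    by (rule le_less_trans) simp
  \<comment> \<open>The sum of the absolute differences has a finite integral, hence is finite
    almost everywhere.\<close>
  then have "AE x in M. (\<Sum>k. ennreal \<bar>d k x\<bar>) \<noteq> \<infinity>"
    by (intro nn_integral_PInf_AE) (auto simp: less_top)
  then have conv: "AE x in M. convergent (\<lambda>k. f k x)"
  proof eventually_elim
    case (elim x)
    have "summable (\<lambda>k. \<bar>d k x\<bar>)" using elim by (intro summable_suminf_not_top) auto
    then have "summable (\<lambda>k. d k x)" by (rule summable_rabs_cancel)
    then have "convergent (\<lambda>n. \<Sum>k<n. d k x)" by (simp add: summable_iff_convergent)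
    moreover have "(\<Sum>k<n. d k x) = f n x - f 0 x" for n
      unfolding d_def by (rule sum_lessThan_telescope)
    ultimately have "convergent (\<lambda>n. f n x - f 0 x)" by simp
    then show ?case by (simp add: convergent_diff_const_right_iff)
  qed
  define g where "g x = lim (\<lambda>k. f k x)" for x
  have gm [measurable]: "g \<in> borel_measurable M" unfolding g_def by (rule borel_measurable_lim_metric) measurable
  have lim: "AE x in M. (\<lambda>k. f k x) \<longlonglongrightarrow> g x"
    using conv by eventually_elim (simp add: g_def convergent_LIMSEQ_iff)
  \<comment> \<open>Fatou's lemma for m tending to infinity, with k fixed.\<close>
  have le: "(\<integral>\<^sup>+x. ennreal ((f k x - g x)\<^sup>2) \<partial>M) \<le> ennreal (((1/2)^k)\<^sup>2)" for k
  proof -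
    have "(\<integral>\<^sup>+x. ennreal ((f k x - g x)\<^sup>2) \<partial>M)
        = (\<integral>\<^sup>+x. liminf (\<lambda>m. ennreal ((f k x - f m x)\<^sup>2)) \<partial>M)"
    proof (intro nn_integral_cong_AE)
      show "AE x in M. ennreal ((f k x - g x)\<^sup>2) = liminf (\<lambda>m. ennreal ((f k x - f m x)\<^sup>2))"
        using lim
      proof eventually_elim
        case (elim x)
        then have "(\<lambda>m. ennreal ((f k x - f m x)\<^sup>2)) \<longlonglongrightarrow> ennreal ((f k x - g x)\<^sup>2)"
          by (intro tendsto_ennrealI tendsto_intros)
        from lim_imp_Liminf[OF _ this] show ?case by simp
      qed
    qed
    also have "\<dots> \<le> liminf (\<lambda>m. \<integral>\<^sup>+x. ennreal ((f k x - f m x)\<^sup>2) \<partial>M)"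
      by (intro nn_integral_liminf) measurable
    also have "\<dots> \<le> limsup (\<lambda>m. \<integral>\<^sup>+x. ennreal ((f k x - f m x)\<^sup>2) \<partial>M)"
      by (intro Liminf_le_Limsup) simp
    also have "\<dots> \<le> ennreal (((1/2)^k)\<^sup>2)"
    proof (rule Limsup_bounded)
      show "\<forall>\<^sub>F m in sequentially. (\<integral>\<^sup>+x. ennreal ((f k x - f m x)\<^sup>2) \<partial>M) \<le> ennreal (((1/2)^k)\<^sup>2)"
        using eventually_ge_at_top[of k]
      proof eventually_elim
        case (elim m)
        have "(\<integral>\<^sup>+x. ennreal ((f k x - f m x)\<^sup>2) \<partial>M) = ennreal (\<integral>x. (f k x - f m x)\<^sup>2 \<partial>M)"
          using sq_integrable_square[OF sq_integrable_diff[OF f f]] by (intro nn_integral_eq_integral) auto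
        also have "\<dots> = ennreal ((l2norm M (\<lambda>x. f k x - f m x))\<^sup>2)" by (simp add: l2norm_square)
        also have "\<dots> \<le> ennreal (((1/2)^k)\<^sup>2)"
          using fast[OF elim] by (intro ennreal_leI power_mono) auto
        finally show ?case .
      qed
    qed
    finally show ?thesis .
  qed
  have i: "integrable M (\<lambda>x. (f k x - g x)\<^sup>2)" for k
  proof (rule integrableI_nonneg)
    show "(\<integral>\<^sup>+x. ennreal ((f k x - g x)\<^sup>2) \<partial>M) < \<infinity>"
      using le[of k] by (rule le_less_trans) simp
  qed auto
  have sg: "sq_integrable M (\<lambda>x. f k x - g x)" for k using i by (simp add: sq_integrable_def)
  have "l2norm M (\<lambda>x. f k x - g x) \<le> (1/2)^k" for k
  proof -
    have "ennreal (\<integral>x. (f k x - g x)\<^sup>2 \<partial>M) \<le> ennreal (((1/2)^k)\<^sup>2)"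
      using le[of k] nn_integral_eq_integral[OF i[of k]] by simp
    then have "(\<integral>x. (f k x - g x)\<^sup>2 \<partial>M) \<le> ((1/2)^k)\<^sup>2" by (rule ennreal_le_iff[THEN iffD1, rotated]) (rule zero_le_power2)
    then have "(l2norm M (\<lambda>x. f k x - g x))\<^sup>2 \<le> ((1/2)^k)\<^sup>2" by (simp only: l2norm_square)
    then show ?thesis by (rule power2_le_imp_le) simp
  qed
  moreover have "sq_integrable M g" using sq_integrable_diff[OF f[of 0] sg[of 0]] by simp
  ultimately show ?thesis by blast
qed


section \<open>Inner products and completeness of finite dimensional subspaces\<close>

definition l2inner :: "'a measure \<Rightarrow> ('a \<Rightarrow> real) \<Rightarrow> ('a \<Rightarrow> real) \<Rightarrow> real" where
  "l2inner M f g = (\<integral>x. f x * g x \<partial>M)"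

lemma l2inner_self: "l2inner M f f = (l2norm M f)\<^sup>2"
  unfolding l2norm_square by (simp add: l2inner_def power2_eq_square)

lemma l2inner_commute: "l2inner M f g = l2inner M g f"
  by (simp add: l2inner_def mult.commute)

lemma l2inner_add:
  assumes "sq_integrable M f" "sq_integrable M g" "sq_integrable M h"
  shows "l2inner M (\<lambda>x. f x + g x) h = l2inner M f h + l2inner M g h"
  using sq_integrable_mult[OF assms(1,3)] sq_integrable_mult[OF assms(2,3)]
  by (simp add: l2inner_def distrib_right)

lemma l2inner_diff:
  assumes "sq_integrable M f" "sq_integrable M g" "sq_integrable M h"
  shows "l2inner M (\<lambda>x. f x - g x) h = l2inner M f h - l2inner M g h"
  using sq_integrable_mult[OF assms(1,3)] sq_integrable_mult[OF assms(2,3)]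
  by (simp add: l2inner_def left_diff_distrib)

lemma l2inner_cmult: "l2inner M (\<lambda>x. c * f x) h = c * l2inner M f h"
  by (simp add: l2inner_def mult.assoc)

lemma l2inner_sum:
  assumes "\<And>i. i \<in> A \<Longrightarrow> sq_integrable M (f i)" "sq_integrable M h"
  shows "l2inner M (\<lambda>x. \<Sum>i\<in>A. f i x) h = (\<Sum>i\<in>A. l2inner M (f i) h)"
  using assms sq_integrable_mult[OF _ assms(2)] by (simp add: l2inner_def sum_distrib_right)

lemma l2inner_cong_AE:
  assumes "sq_integrable M f" "sq_integrable M g" "sq_integrable M h" "AE x in M. f x = g x"
  shows "l2inner M f h = l2inner M g h"
  unfolding l2inner_def using assms by (intro integral_cong_AE) (auto simp: sq_integrable_def)

lemma l2inner_le: "sq_integrable M f \<Longrightarrow> sq_integrable M g \<Longrightarrow> \<bar>l2inner M f g\<bar> \<le> l2norm M f * l2norm M g"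
  unfolding l2inner_def by (rule Cauchy_Schwarz_l2)

lemma linear_subspace_add:
  "linear_subspace X \<Longrightarrow> f \<in> X \<Longrightarrow> g \<in> X \<Longrightarrow> (\<lambda>x. f x + g x) \<in> X"
  by (simp add: linear_subspace_def)

lemma linear_subspace_cmult:
  "linear_subspace X \<Longrightarrow> f \<in> X \<Longrightarrow> (\<lambda>x. c * f x) \<in> X"
  by (simp add: linear_subspace_def)

lemma linear_subspace_sum:
  assumes "linear_subspace X" "finite A" "\<And>a. a \<in> A \<Longrightarrow> f a \<in> X"
  shows "(\<lambda>x. \<Sum>a\<in>A. c a * f a x) \<in> X"
  using assms(2,3)
proof (induction A)
  case empty then show ?case using assms(1) by (simp add: linear_subspace_def)
next
  case (insert a A)
  then have "(\<lambda>x. c a * f a x) \<in> X" "(\<lambda>x. \<Sum>a\<in>A. c a * f a x) \<in> X"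
    using assms(1) by (auto simp: linear_subspace_def)
  with insert(1,2) assms(1) show ?case by (simp add: linear_subspace_def)
qed

lemma linear_subspace_diff:
  assumes "linear_subspace X" "f \<in> X" "g \<in> X"
  shows "(\<lambda>x. f x - g x) \<in> X"
proof -
  have "(\<lambda>x. f x + -1 * g x) \<in> X"
    using assms by (intro linear_subspace_add linear_subspace_cmult)
  then show ?thesis by simp
qed

text \<open>Orthonormal coordinates are inner products and hence continuous in the L2 norm, unlike
  the coefficients with respect to an arbitrary spanning set. The vectors of \<open>B\<close> may be
  dependent modulo null sets; a residual of norm 0 adds nothing to \<open>E\<close>.\<close>

lemma Gram_Schmidt_expansion:
  assumes lin: "linear_subspace X" and sq: "\<And>f. f \<in> X \<Longrightarrow> sq_integrable M f"
    and "finite B" "B \<subseteq> X"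
  shows "\<exists>E. finite E \<and> E \<subseteq> X \<and>
           (\<forall>e\<in>E. \<forall>e'\<in>E. l2inner M e e' = (if e = e' then 1 else 0)) \<and>
           (\<forall>b\<in>B. AE x in M. b x = (\<Sum>e\<in>E. l2inner M b e * e x))"
  using assms(3,4)
proof (induction B)
  case empty
  then show ?case by (intro exI[of _ "{}"]) auto
next
  case (insert b B)
  have bX: "b \<in> X" "B \<subseteq> X" using insert by auto
  from insert.IH[OF bX(2)] obtain E where E: "finite E" "E \<subseteq> X"
    and on': "\<forall>e\<in>E. \<forall>e'\<in>E. l2inner M e e' = (if e = e' then 1 else 0)"
    and ex': "\<forall>b\<in>B. AE x in M. b x = (\<Sum>e\<in>E. l2inner M b e * e x)"
    by (elim exE conjE) (rule that)
  note on = on'[rule_format] and ex = ex'[rule_format]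
  define s where "s x = (\<Sum>e\<in>E. l2inner M b e * e x)" for x
  have sX: "s \<in> X" unfolding s_def using E by (intro linear_subspace_sum[OF lin]) auto
  define r where "r x = b x - s x" for x
  have rX: "r \<in> X" unfolding r_def using bX sX by (intro linear_subspace_diff[OF lin]) auto
  have inner_expand: "l2inner M (\<lambda>x. \<Sum>e\<in>E. c e * e x) h = (\<Sum>e\<in>E. c e * l2inner M e h)"
    if "h \<in> X" for c h
    using E that by (subst l2inner_sum) (auto intro!: sq sq_integrable_cmult simp: l2inner_cmult)
  have r_orth: "l2inner M r e = 0" if "e \<in> E" for e
  proof -
    have "l2inner M s e = (\<Sum>e'\<in>E. l2inner M b e' * l2inner M e' e)"
      unfolding s_def using that E by (intro inner_expand) auto
    also have "\<dots> = (\<Sum>e'\<in>E. if e' = e then l2inner M b e else 0)"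
      using that by (intro sum.cong) (auto simp: on)
    also have "\<dots> = l2inner M b e" using that E by simp
    finally show ?thesis
      unfolding r_def using that E bX sX by (subst l2inner_diff) (auto intro: sq)
  qed
  show ?case
  proof (cases "l2norm M r = 0")
    case True
    then have "AE x in M. r x = 0" using l2norm_eq_0_iff[OF sq[OF rX]] by simp
    then have "AE x in M. b x = (\<Sum>e\<in>E. l2inner M b e * e x)"
      by eventually_elim (simp add: r_def s_def)
    with E on ex show ?thesis by (intro exI[of _ E]) auto
  next
    \<comment> \<open>The normalised residual becomes the new basis vector.\<close>
    case False
    define e0 where "e0 x = 1 / l2norm M r * r x" for x
    have e0X: "e0 \<in> X" unfolding e0_def using rX lin by (intro linear_subspace_cmult)
    have e0_inner: "l2inner M e0 h = 1 / l2norm M r * l2inner M r h" for h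
      unfolding e0_def by (rule l2inner_cmult)
    have e0_1: "l2inner M e0 e0 = 1"
      using False
      by (simp add: e0_inner l2inner_commute[of M r e0]) (simp add: e0_inner l2inner_self power2_eq_square)
    have e0_0: "l2inner M e0 e = 0" "l2inner M e e0 = 0" if "e \<in> E" for e
      using r_orth[OF that] by (simp_all add: e0_inner l2inner_commute[of M e e0])
    have notin: "e0 \<notin> E" using e0_1 e0_0(1)[of e0] by auto
    have s_e0: "l2inner M (\<lambda>x. \<Sum>e\<in>E. c e * e x) e0 = 0" for c
      using inner_expand[OF e0X, of c] e0_0(2) by simp
    \<comment> \<open>The vectors treated earlier lie in the span of \<open>E\<close>, so their
      coefficient along \<open>e0\<close> is 0 and their expansions persist.\<close>
    have "AE x in M. b' x = (\<Sum>e\<in>insert e0 E. l2inner M b' e * e x)" if "b' \<in> B" for b'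
    proof -
      have "l2inner M b' e0 = l2inner M (\<lambda>x. \<Sum>e\<in>E. l2inner M b' e * e x) e0"
        using that bX E e0X ex[OF that]
        by (intro l2inner_cong_AE) (auto intro!: sq sq_integrable_sum sq_integrable_cmult)
      then have "l2inner M b' e0 = 0" using s_e0 by simp
      with ex[OF that] E notin show ?thesis by simp
    qed
    moreover have "AE x in M. b x = (\<Sum>e\<in>insert e0 E. l2inner M b e * e x)"
    proof -
      have "l2inner M r e0 = l2inner M b e0 - l2inner M s e0"
        unfolding r_def using bX sX e0X by (intro l2inner_diff sq) auto
      moreover have "l2inner M s e0 = 0" unfolding s_def by (rule s_e0)
      moreover have "l2inner M r e0 = l2norm M r"
        using False by (simp add: l2inner_commute[of M r e0] e0_inner l2inner_self power2_eq_square)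
      ultimately have "l2inner M b e0 = l2norm M r" by simp
      then have "b x = (\<Sum>e\<in>insert e0 E. l2inner M b e * e x)" for x
        using E notin False by (simp add: e0_def r_def s_def)
      then show ?thesis by simp
    qed
    ultimately show ?thesis
      using E e0X on e0_0 e0_1 notin by (intro exI[of _ "insert e0 E"]) auto
  qed
qed

text \<open>The coordinates of a Cauchy sequence in an orthonormal basis are Cauchy by
  Cauchy-Schwarz; their limits are the coordinates of \<open>z\<close>.\<close>

lemma finite_dim_complete:
  assumes lin: "linear_subspace X" and sq: "\<And>f. f \<in> X \<Longrightarrow> sq_integrable M f"
    and B: "finite B" "B \<subseteq> X" "\<And>f. f \<in> X \<Longrightarrow> \<exists>c. AE x in M. f x = (\<Sum>b\<in>B. c b * b x)"
    and f: "\<And>k. f k \<in> X"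
    and cauchy: "\<And>e. e > 0 \<Longrightarrow> \<exists>N. \<forall>k\<ge>N. \<forall>m\<ge>N. l2norm M (\<lambda>x. f k x - f m x) < e"
  shows "\<exists>z\<in>X. (\<lambda>k. l2norm M (\<lambda>x. f k x - z x)) \<longlonglongrightarrow> 0"
proof -
  have "\<exists>E. finite E \<and> E \<subseteq> X \<and>
           (\<forall>e\<in>E. \<forall>e'\<in>E. l2inner M e e' = (if e = e' then 1 else 0)) \<and>
           (\<forall>b\<in>B. AE x in M. b x = (\<Sum>e\<in>E. l2inner M b e * e x))"
    by (rule Gram_Schmidt_expansion) (fact lin, erule sq, fact B(1), fact B(2))
  then obtain E where E: "finite E" "E \<subseteq> X"
    and ex': "\<forall>b\<in>B. AE x in M. b x = (\<Sum>e\<in>E. l2inner M b e * e x)"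
    by (elim exE conjE) (rule that)
  note ex = ex'[rule_format]
  have exX: "AE x in M. h x = (\<Sum>e\<in>E. l2inner M h e * e x)" if hX: "h \<in> X" for h
  proof -
    obtain c where c: "AE x in M. h x = (\<Sum>b\<in>B. c b * b x)" using B(3)[OF hX] by blast
    have ih: "l2inner M h e = (\<Sum>b\<in>B. c b * l2inner M b e)" if "e \<in> E" for e
    proof -
      have sb: "sq_integrable M (\<lambda>x. c b * b x)" if "b \<in> B" for b
        using that B by (intro sq_integrable_cmult sq) auto
      have "l2inner M h e = l2inner M (\<lambda>x. \<Sum>b\<in>B. c b * b x) e"
        using \<open>h \<in> X\<close> that E c by (intro l2inner_cong_AE sq sq_integrable_sum sb) auto
      also have "\<dots> = (\<Sum>b\<in>B. l2inner M (\<lambda>x. c b * b x) e)"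
        using that E by (intro l2inner_sum sb sq) auto
      finally show ?thesis by (simp add: l2inner_cmult)
    qed
    have "AE x in M. \<forall>b\<in>B. b x = (\<Sum>e\<in>E. l2inner M b e * e x)"
      using ex B(1) by (intro AE_finite_allI) auto
    with c show ?thesis
    proof eventually_elim
      case (elim x)
      have "(\<Sum>b\<in>B. c b * b x) = (\<Sum>b\<in>B. \<Sum>e\<in>E. c b * l2inner M b e * e x)"
        using elim(2) by (intro sum.cong refl) (metis (no_types, lifting) mult.assoc sum.cong sum_distrib_left)
      also have "\<dots> = (\<Sum>e\<in>E. \<Sum>b\<in>B. c b * l2inner M b e * e x)" by (rule sum.swap)
      also have "\<dots> = (\<Sum>e\<in>E. l2inner M h e * e x)"
        by (intro sum.cong refl) (simp add: ih sum_distrib_right)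
      finally show ?case using elim(1) by simp
    qed
  qed
  have "convergent (\<lambda>k. l2inner M (f k) e)" if "e \<in> E" for e
  proof (rule Cauchy_convergent, rule CauchyI)
    fix d :: real assume d: "d > 0"
    have eX: "e \<in> X" using that E by auto
    \<comment> \<open>Adding 1 to the norm of \<open>e\<close> keeps the divisor positive.\<close>
    obtain N where N: "\<And>k m. k \<ge> N \<Longrightarrow> m \<ge> N \<Longrightarrow> l2norm M (\<lambda>x. f k x - f m x) < d / (l2norm M e + 1)"
      using cauchy[of "d / (l2norm M e + 1)"] d by (auto simp: add_nonneg_pos)
    have "norm (l2inner M (f k) e - l2inner M (f m) e) < d" if "k \<ge> N" "m \<ge> N" for k m
    proof -
      have "norm (l2inner M (f k) e - l2inner M (f m) e) = \<bar>l2inner M (\<lambda>x. f k x - f m x) e\<bar>"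
        using l2inner_diff[OF sq[OF f] sq[OF f] sq[OF eX]] by simp
      also have "\<dots> \<le> l2norm M (\<lambda>x. f k x - f m x) * l2norm M e"
        by (intro l2inner_le sq_integrable_diff sq f eX)
      also have "\<dots> \<le> l2norm M (\<lambda>x. f k x - f m x) * (l2norm M e + 1)"
        by (intro mult_left_mono) auto
      also have "\<dots> < d"
        using N[OF that] l2norm_ge_0[of M e] by (simp add: pos_less_divide_eq add_nonneg_pos)
      finally show ?thesis .
    qed
    then show "\<exists>N. \<forall>m\<ge>N. \<forall>n\<ge>N. norm (l2inner M (f m) e - l2inner M (f n) e) < d" by blast
  qed
  then obtain c where c: "\<And>e. e \<in> E \<Longrightarrow> (\<lambda>k. l2inner M (f k) e) \<longlonglongrightarrow> c e"
    unfolding convergent_def by metis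
  define z where "z x = (\<Sum>e\<in>E. c e * e x)" for x
  have zX: "z \<in> X" unfolding z_def using E by (intro linear_subspace_sum[OF lin]) auto
  have le: "l2norm M (\<lambda>x. f k x - z x) \<le> (\<Sum>e\<in>E. \<bar>l2inner M (f k) e - c e\<bar> * l2norm M e)" for k
  proof -
    have sc: "sq_integrable M (\<lambda>x. a * e x)" if "e \<in> E" for e a
      using that E by (intro sq_integrable_cmult sq) auto
    have "AE x in M. f k x - z x = (\<Sum>e\<in>E. (l2inner M (f k) e - c e) * e x)"
      using exX[OF f[of k]]
      by eventually_elim (simp add: z_def sum_subtractf left_diff_distrib)
    then have "l2norm M (\<lambda>x. f k x - z x) = l2norm M (\<lambda>x. \<Sum>e\<in>E. (l2inner M (f k) e - c e) * e x)"
      by (intro l2norm_cong_AE sq_integrable_measurable sq_integrable_diff sq f zX sq_integrable_sum sc) auto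
    also have "\<dots> \<le> (\<Sum>e\<in>E. l2norm M (\<lambda>x. (l2inner M (f k) e - c e) * e x))"
      by (intro l2norm_sum_le sc)
    finally show ?thesis by (simp add: l2norm_cmult)
  qed
  have "(\<lambda>k. \<Sum>e\<in>E. \<bar>l2inner M (f k) e - c e\<bar> * l2norm M e) \<longlonglongrightarrow> (\<Sum>e\<in>E. 0)"
    by (intro tendsto_sum tendsto_mult_left_zero tendsto_rabs_zero) (use c LIM_zero in blast)
  then have "(\<lambda>k. l2norm M (\<lambda>x. f k x - z x)) \<longlonglongrightarrow> 0"
    unfolding sum.neutral_const by (rule Lim_null_comparison[rotated]) (simp add: le)
  with zX show ?thesis by blast
qed

section \<open>Smooth functions of one and several variables\<close>

text \<open>A class closed under differentiation, so that smoothness of every order follows from one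
  derivative. \<open>flat\<close> carries a polynomial factor because differentiating exp (-1/t)
  produces one; \<open>powr\<close> allows fractional powers times a function vanishing near 0, as
  in the Newton potential written in the squared radius.\<close>

inductive_set smooth1 :: "(real \<Rightarrow> real) set" where
  const: "(\<lambda>t. c) \<in> smooth1"
| antideriv: "p' \<in> smooth1 \<Longrightarrow> (\<And>t. (p has_real_derivative p' t) (at t)) \<Longrightarrow> p \<in> smooth1"
| add: "p \<in> smooth1 \<Longrightarrow> q \<in> smooth1 \<Longrightarrow> (\<lambda>t. p t + q t) \<in> smooth1"
| mult: "p \<in> smooth1 \<Longrightarrow> q \<in> smooth1 \<Longrightarrow> (\<lambda>t. p t * q t) \<in> smooth1"
| flat: "(\<lambda>t. if t > 0 then poly q (1 / t) * exp (- (1 / t)) else 0) \<in> smooth1"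
| affine: "p \<in> smooth1 \<Longrightarrow> (\<lambda>t. p (a * t + b)) \<in> smooth1"
| powr: "p \<in> smooth1 \<Longrightarrow> c > 0 \<Longrightarrow> (\<And>t. t < c \<Longrightarrow> p t = 0) \<Longrightarrow> (\<lambda>t. t powr a * p t) \<in> smooth1"

lemma poly_div_exp_tendsto_0: "((\<lambda>y::real. poly q y / exp y) \<longlongrightarrow> 0) at_top"
proof -
  have "((\<lambda>y::real. \<Sum>i\<le>degree q. coeff q i * (y ^ i / exp y)) \<longlongrightarrow> (\<Sum>i\<le>degree q. 0)) at_top"
    by (intro tendsto_sum tendsto_mult_right_zero tendsto_power_div_exp_0)
  then show ?thesis by (simp add: poly_altdef sum_divide_distrib)
qed

text \<open>With y = 1/t one has dy/dt = - y^2, so q(y) exp(-y) has derivative y^2 (q - q')(y)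
  exp(-y); the polynomial \<open>[:0, 0, 1:]\<close> is y^2. At 0 the exponential beats every
  polynomial in y.\<close>

lemma flat_has_derivative:
  fixes q :: "real poly"
  defines "F \<equiv> \<lambda>q t::real. if t > 0 then poly q (1 / t) * exp (- (1 / t)) else 0"
  shows "(F q has_real_derivative F ([:0, 0, 1:] * (q - pderiv q)) t) (at t)"
proof -
  consider "t > 0" | "t < 0" | "t = 0" by linarith
  then show ?thesis
  proof cases
    case 1
    have "((\<lambda>t. poly q (1 / t) * exp (- (1 / t))) has_real_derivative
        F ([:0, 0, 1:] * (q - pderiv q)) t) (at t)"
      unfolding F_def using 1
      by (auto intro!: derivative_eq_intros poly_DERIV[THEN DERIV_chain2] simp: field_simps power2_eq_square)
    then show ?thesis
      by (rule has_field_derivative_transform_within_open[where S="{0<..}"]) (use 1 in \<open>auto simp: F_def\<close>)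
  next
    case 2
    have "((\<lambda>t. 0) has_real_derivative F ([:0, 0, 1:] * (q - pderiv q)) t) (at t)"
      using 2 by (simp add: F_def)
    then show ?thesis
      by (rule has_field_derivative_transform_within_open[where S="{..<0}"]) (use 2 in \<open>auto simp: F_def\<close>)
  next
    case 3
    have "((\<lambda>h. F q h / h) \<longlongrightarrow> 0) (at 0)"
    proof (rule filterlim_split_at)
      have "((\<lambda>h::real. 0::real) \<longlongrightarrow> 0) (at_left 0)" by simp
      then show "((\<lambda>h. F q h / h) \<longlongrightarrow> 0) (at_left 0)"
        by (rule Lim_transform_eventually) (auto simp: F_def eventually_at_left_field intro!: exI[of _ "-1"])
      \<comment> \<open>Substituting y = 1/h turns division by \<open>h\<close> into the extra
        polynomial factor y, which is \<open>[:0, 1:]\<close>.\<close>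
      have "((\<lambda>h. poly ([:0, 1:] * q) (inverse h) / exp (inverse h)) \<longlongrightarrow> 0) (at_right 0)"
        by (rule filterlim_compose[OF poly_div_exp_tendsto_0 filterlim_inverse_at_top_right])
      then show "((\<lambda>h. F q h / h) \<longlongrightarrow> 0) (at_right 0)"
        by (rule Lim_transform_eventually)
          (auto simp: F_def eventually_at_right_field exp_minus field_simps intro!: exI[of _ 1])
    qed
    then show ?thesis unfolding 3 by (simp add: DERIV_def F_def cong: if_cong)
  qed
qed

lemma deriv_zero_if_locally_zero:
  assumes "(p has_real_derivative d) (at t)" "t < c" "\<And>t. t < c \<Longrightarrow> p t = (0::real)"
  shows "d = 0"
proof -
  have "((\<lambda>t. 0) has_real_derivative d) (at t)"
    by (rule has_field_derivative_transform_within_open[OF assms(1), where S="{..<c}"]) (use assms in auto)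
  then show ?thesis by (rule DERIV_unique) simp
qed

text \<open>Each generator has a derivative built from generators again; iterating this gives all
  orders.\<close>

lemma smooth1_has_derivative:
  assumes "p \<in> smooth1"
  shows "\<exists>p'\<in>smooth1. \<forall>t. (p has_real_derivative p' t) (at t)"
  using assms
proof induction
  case (const c)
  show ?case by (intro bexI[of _ "\<lambda>t. 0"]) (auto intro: smooth1.const)
next
  case (antideriv p' p)
  then show ?case by blast
next
  case (add p q)
  then obtain p' q' where "p' \<in> smooth1" "q' \<in> smooth1"
    "\<forall>t. (p has_real_derivative p' t) (at t)" "\<forall>t. (q has_real_derivative q' t) (at t)" by blast
  then show ?case
    by (intro bexI[of _ "\<lambda>t. p' t + q' t"]) (auto intro: smooth1.intros DERIV_add)
next
  case (mult p q)
  then obtain p' q' where "p' \<in> smooth1" "q' \<in> smooth1"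
    "\<forall>t. (p has_real_derivative p' t) (at t)" "\<forall>t. (q has_real_derivative q' t) (at t)" by blast
  with mult show ?case
    by (intro bexI[of _ "\<lambda>t. p' t * q t + q' t * p t"]) (auto intro: smooth1.intros DERIV_mult)
next
  case (flat q)
  show ?case
    by (rule bexI[OF _ smooth1.flat[of "[:0, 0, 1:] * (q - pderiv q)"]]) (intro allI flat_has_derivative)
next
  case (affine p a b)
  then obtain p' where p': "p' \<in> smooth1" "\<And>t. (p has_real_derivative p' t) (at t)" by blast
  have "((\<lambda>t. p (a * t + b)) has_real_derivative a * p' (a * t + b)) (at t)" for t
    by (rule DERIV_cong[OF DERIV_chain2[OF p'(2)]]) (auto intro!: derivative_eq_intros)
  then show ?case
    by (intro bexI[OF _ smooth1.mult[OF smooth1.const[of a] smooth1.affine[OF p'(1), of a b]]] allI)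
next
  case (powr p c a)
  then obtain p' where p': "p' \<in> smooth1" "\<And>t. (p has_real_derivative p' t) (at t)" by blast
  have z: "p' t = 0" if "t < c" for t
    using deriv_zero_if_locally_zero[OF p'(2) that] powr by blast
  \<comment> \<open>The product rule stays in the class: the first summand is a \<open>powr\<close>
    generator with exponent \<open>a - 1\<close>, and \<open>p'\<close> inherits the vanishing to
    the left of \<open>c\<close>.\<close>
  define d where "d t = a * (t powr (a - 1) * p t) + t powr a * p' t" for t
  have "d \<in> smooth1"
    unfolding d_def using powr p' z by (intro smooth1.add smooth1.mult[OF smooth1.const] smooth1.powr) auto
  moreover have "((\<lambda>t. t powr a * p t) has_real_derivative d t) (at t)" for t
  proof (cases "t > 0")
    case True
    then show ?thesis
      unfolding d_def by (auto intro!: derivative_eq_intros p'(2))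
  next
    \<comment> \<open>To the left of \<open>c\<close> the product is 0, whatever \<open>powr\<close>
      returns for nonpositive arguments.\<close>
    case False
    with \<open>c > 0\<close> have tc: "t < c" by simp
    have "((\<lambda>t. 0) has_real_derivative d t) (at t)"
      using powr.hyps z tc by (simp add: d_def)
    then show ?thesis
      by (rule has_field_derivative_transform_within_open[where S="{..<c}"]) (use tc powr.hyps in auto)
  qed
  ultimately show ?case by blast
qed

lemma smooth1_id: "(\<lambda>t. t) \<in> smooth1"
  by (rule smooth1.antideriv[OF smooth1.const[of 1]]) auto

lemma smooth1_isCont: "p \<in> smooth1 \<Longrightarrow> isCont p t"
  using smooth1_has_derivative DERIV_isCont by blast

lemma smooth1_diff: "p \<in> smooth1 \<Longrightarrow> q \<in> smooth1 \<Longrightarrow> (\<lambda>t. p t - q t) \<in> smooth1"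
  using smooth1.add[OF _ smooth1.mult[OF smooth1.const[of "-1"]], of p q] by simp

lemma smooth1_antiderivative_exists:
  assumes "p \<in> smooth1"
  shows "\<exists>P\<in>smooth1. P a = 0 \<and> (\<forall>t. (P has_real_derivative p t) (at t))"
proof -
  obtain P where P: "\<And>t. (P has_real_derivative p t) (at t)"
    using einterval_antiderivative[of "-\<infinity>" \<infinity> p] smooth1_isCont[OF assms]
    by (auto simp: has_real_derivative_iff_has_vector_derivative)
  have "((\<lambda>t. P t - P a) has_real_derivative p t) (at t)" for t
    using P[of t] by (auto intro!: derivative_eq_intros)
  then show ?thesis
    using assms by (intro bexI[of _ "\<lambda>t. P t - P a"]) (auto intro: smooth1.antideriv)
qed

lemma zero_deriv_constant_on:
  fixes P :: "real \<Rightarrow> real"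
  assumes "\<And>t. (P has_real_derivative p t) (at t)" "convex S" "\<And>t. t \<in> S \<Longrightarrow> p t = 0" "s \<in> S" "t \<in> S"
  shows "P s = P t"
proof -
  have "\<exists>c. \<forall>x\<in>S. P x = c"
    using assms by (intro has_field_derivative_zero_constant[OF \<open>convex S\<close>])
      (metis has_field_derivative_at_within)
  then show ?thesis using assms by auto
qed

section \<open>Flat functions and smooth steps\<close>

definition flat_exp :: "real \<Rightarrow> real" where
  "flat_exp t = (if t > 0 then exp (- (1 / t)) else 0)"

lemma flat_exp_smooth1: "flat_exp \<in> smooth1"
  using smooth1.flat[of 1] by (simp add: flat_exp_def[abs_def] cong: if_cong)

lemma flat_exp_bounds: "0 \<le> flat_exp t" "flat_exp t \<le> 1"
  by (auto simp: flat_exp_def)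

lemma flat_exp_scaled_tendsto:
  "(\<lambda>k. flat_exp (real (Suc k) * t)) \<longlonglongrightarrow> (if t > 0 then 1 else 0)"
proof (cases "t > 0")
  case True
  have "(\<lambda>k. exp (- (inverse (real (Suc k)) * (1 / t)))) \<longlonglongrightarrow> exp (- (0 * (1 / t)))"
    by (intro tendsto_intros LIMSEQ_inverse_real_of_nat)
  moreover have "flat_exp (real (Suc k) * t) = exp (- (inverse (real (Suc k)) * (1 / t)))" for k
    using True by (simp add: flat_exp_def field_simps del: of_nat_Suc)
  ultimately show ?thesis using True by simp
next
  case False
  then have "flat_exp (real (Suc k) * t) = 0" for k
    by (simp add: flat_exp_def zero_less_mult_iff del: of_nat_Suc)
  then show ?thesis using False by simp
qed

text \<open>A bump supported in [1, 2] is integrated. The final value \<open>T 2\<close> is not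
  normalised, because only differences of two rescaled steps are formed later and it cancels
  there.\<close>

lemma smooth_step_exists:
  obtains T e where "T \<in> smooth1" "e \<in> smooth1" "\<And>t. (T has_real_derivative e t) (at t)"
    "\<And>t. t \<le> 1 \<Longrightarrow> T t = 0" "\<And>t. t \<ge> 2 \<Longrightarrow> T t = T 2" "\<And>t. 0 \<le> e t"
    "\<And>t. t \<le> 1 \<or> t \<ge> 2 \<Longrightarrow> e t = 0" "\<And>t. 1 < t \<Longrightarrow> t < 2 \<Longrightarrow> e t > 0"
proof -
  \<comment> \<open>The arguments are spelled as a * t + b to match the rule
    \<open>smooth1.affine\<close>.\<close>
  define e where "e t = flat_exp (1 * t + (-1)) * flat_exp (-1 * t + 2)" for t
  have e: "e \<in> smooth1" unfolding e_def
    by (intro smooth1.mult smooth1.affine flat_exp_smooth1)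
  obtain T where T: "T \<in> smooth1" "T 1 = 0" "\<And>t. (T has_real_derivative e t) (at t)"
    using smooth1_antiderivative_exists[OF e, of 1] by blast
  have z: "e t = 0" if "t \<le> 1 \<or> t \<ge> 2" for t
    using that by (auto simp: e_def flat_exp_def)
  have "T t = 0" if "t \<le> 1" for t
    using zero_deriv_constant_on[OF T(3), of "{..1}" t 1] that z T(2) by auto
  moreover have "T t = T 2" if "t \<ge> 2" for t
    using zero_deriv_constant_on[OF T(3), of "{2..}" t 2] that z by auto
  moreover have "0 \<le> e t" for t by (simp add: e_def flat_exp_bounds)
  moreover have "e t > 0" if "1 < t" "t < 2" for t using that by (simp add: e_def flat_exp_def)
  ultimately show ?thesis using that[OF T(1) e T(3)] z by blast
qed

text \<open>Two kinds of building blocks suffice: ridge functions for cut-offs on boxes, and radial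
  functions for mollifiers and potentials. Radial profiles take the squared distance, which is
  smooth also at the centre.\<close>

inductive_set smooth :: "('a::euclidean_space \<Rightarrow> real) set" where
  const: "(\<lambda>x. c) \<in> smooth"
| add: "f \<in> smooth \<Longrightarrow> g \<in> smooth \<Longrightarrow> (\<lambda>x. f x + g x) \<in> smooth"
| mult: "f \<in> smooth \<Longrightarrow> g \<in> smooth \<Longrightarrow> (\<lambda>x. f x * g x) \<in> smooth"
| ridge: "p \<in> smooth1 \<Longrightarrow> (\<lambda>x. p (x \<bullet> b)) \<in> smooth"
| radial: "p \<in> smooth1 \<Longrightarrow> (\<lambda>x. p ((x - a) \<bullet> (x - a))) \<in> smooth"

lemma radial_has_derivative:
  assumes "\<And>t. (p has_real_derivative p' t) (at t)"
  shows "((\<lambda>x. p ((x - a) \<bullet> (x - a))) has_derivative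
            (\<lambda>h. p' ((x - a) \<bullet> (x - a)) * (2 * ((x - a) \<bullet> h)))) (at x)"
proof -
  have "((\<lambda>x. (x - a) \<bullet> (x - a)) has_derivative (\<lambda>h. 2 * ((x - a) \<bullet> h))) (at x)"
    by (auto intro!: derivative_eq_intros simp: inner_commute)
  from has_derivative_compose[OF this assms[unfolded has_field_derivative_def]]
  show ?thesis by simp
qed

lemma ridge_has_derivative:
  assumes "\<And>t. (p has_real_derivative p' t) (at t)"
  shows "((\<lambda>x. p (x \<bullet> b)) has_derivative (\<lambda>h. p' (x \<bullet> b) * (h \<bullet> b))) (at x)"
proof -
  have "((\<lambda>x. x \<bullet> b) has_derivative (\<lambda>h. h \<bullet> b)) (at x)"
    by (auto intro!: derivative_eq_intros)
  from has_derivative_compose[OF this assms[unfolded has_field_derivative_def]]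
  show ?thesis by simp
qed

lemma smooth_coord: "(\<lambda>x. x \<bullet> b) \<in> smooth"
  by (rule smooth.ridge[OF smooth1_id])

lemma smooth_has_derivative:
  assumes "f \<in> smooth"
  shows "\<exists>D. (\<forall>b. D b \<in> smooth) \<and> (\<forall>x. (f has_derivative (\<lambda>b. D b x)) (at x))"
  using assms
proof induction
  case (const c)
  show ?case by (intro exI[of _ "\<lambda>b x. 0"]) (auto intro: smooth.const)
next
  case (add f g)
  then obtain D E where "\<And>b. D b \<in> smooth" "\<And>x. (f has_derivative (\<lambda>b. D b x)) (at x)"
     "\<And>b. E b \<in> smooth" "\<And>x. (g has_derivative (\<lambda>b. E b x)) (at x)" by blast
  then show ?case
    by (intro exI[of _ "\<lambda>b x. D b x + E b x"]) (auto intro: smooth.add has_derivative_add)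
next
  case (mult f g)
  then obtain D E where "\<And>b. D b \<in> smooth" "\<And>x. (f has_derivative (\<lambda>b. D b x)) (at x)"
     "\<And>b. E b \<in> smooth" "\<And>x. (g has_derivative (\<lambda>b. E b x)) (at x)" by blast
  with mult show ?case
    by (intro exI[of _ "\<lambda>b x. f x * E b x + D b x * g x"])
      (auto intro!: smooth.add smooth.mult has_derivative_mult)
next
  case (ridge p b)
  then obtain p' where p': "p' \<in> smooth1" "\<And>t. (p has_real_derivative p' t) (at t)"
    using smooth1_has_derivative by blast
  then show ?case
    by (intro exI[of _ "\<lambda>h x. p' (x \<bullet> b) * (h \<bullet> b)"])
      (auto intro!: smooth.mult[OF smooth.ridge smooth.const] ridge_has_derivative)
next
  case (radial p a)
  then obtain p' where p': "p' \<in> smooth1" "\<And>t. (p has_real_derivative p' t) (at t)"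
    using smooth1_has_derivative by blast
  have lin: "(\<lambda>x. 2 * ((x - a) \<bullet> h)) \<in> smooth" for h
    using smooth.mult[OF smooth.const[of 2] smooth.add[OF smooth_coord[of h] smooth.const[of "- (a \<bullet> h)"]]]
    by (simp add: inner_diff_left)
  with p' show ?case
    by (intro exI[of _ "\<lambda>h x. p' ((x - a) \<bullet> (x - a)) * (2 * ((x - a) \<bullet> h))"])
      (auto intro!: smooth.mult[OF smooth.radial lin] radial_has_derivative)
qed

lemma smooth_differentiable: "f \<in> smooth \<Longrightarrow> f differentiable (at x)"
  using smooth_has_derivative unfolding differentiable_def by blast

lemma smooth_frechet_derivative:
  assumes "f \<in> smooth" shows "(\<lambda>x. frechet_derivative f (at x) b) \<in> smooth"
proof -
  obtain D where D: "\<And>b. D b \<in> smooth" "\<And>x. (f has_derivative (\<lambda>b. D b x)) (at x)"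
    using smooth_has_derivative[OF assms] by blast
  have "frechet_derivative f (at x) = (\<lambda>b. D b x)" for x
    using frechet_derivative_at[OF D(2)] by simp
  then show ?thesis using D(1)[of b] by simp
qed

lemma smooth_partials: "f \<in> smooth \<Longrightarrow> partials bs f \<in> smooth"
  by (induction bs) (auto intro: smooth_frechet_derivative)

lemma smooth_continuous_on: "f \<in> smooth \<Longrightarrow> continuous_on S f"
  by (meson continuous_at_imp_continuous_on differentiable_imp_continuous_within smooth_differentiable)

lemma smooth_Ck_on: "f \<in> smooth \<Longrightarrow> Ck_on k S f"
  by (simp add: Ck_on_def smooth_partials smooth_differentiable smooth_continuous_on)

lemma smooth_prod:
  assumes "finite A" "\<And>i. i \<in> A \<Longrightarrow> f i \<in> smooth"
  shows "(\<lambda>x. \<Prod>i\<in>A. f i x) \<in> smooth"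
  using assms by (induction A) (auto intro: smooth.intros)

lemma smooth_test_functionI:
  assumes "f \<in> smooth" "\<And>x. f x \<noteq> 0 \<Longrightarrow> x \<in> K" "compact K" "K \<subseteq> \<Omega>"
  shows "f \<in> test_functions \<Omega>"
proof -
  have "closure {x. f x \<noteq> 0} \<subseteq> K"
    using assms by (intro closure_minimal) (auto simp: compact_imp_closed)
  moreover from this have "compact (closure {x. f x \<noteq> 0})"
    using assms(3) by (metis closed_closure compact_Int_closed inf.absorb_iff2)
  ultimately show ?thesis
    using assms(4) smooth_Ck_on[OF assms(1)] by (auto simp: test_functions_def)
qed

text \<open>A product over the coordinates of steep flat exponentials, two for each side of the box.
  Each factor vanishes beyond its face, so the support stays in the closed box while the factors
  increase to 1 inside.\<close>

lemma box_indicator_approx: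
  fixes a c :: "'a::euclidean_space"
  assumes "cbox a c \<subseteq> \<Omega>"
  obtains \<phi> where "\<And>k::nat. \<phi> k \<in> test_functions \<Omega>" "\<And>k x. \<bar>\<phi> k x\<bar> \<le> 1"
    "\<And>x. (\<lambda>k. \<phi> k x) \<longlonglongrightarrow> indicator (box a c) x"
proof -
  define m where "m k = real (Suc k)" for k
  \<comment> \<open>Written with an explicit affine argument of x \<bullet> b to match
    \<open>smooth1.affine\<close>; \<open>\<psi>_alt\<close> is the readable form.\<close>
  define \<psi> where "\<psi> k b x = flat_exp (m k * (x \<bullet> b) + (- (m k * (a \<bullet> b))))
      * flat_exp ((- m k) * (x \<bullet> b) + m k * (c \<bullet> b))" for k and b x :: 'a
  have \<psi>_alt: "\<psi> k b x = flat_exp (m k * (x \<bullet> b - a \<bullet> b)) * flat_exp (m k * (c \<bullet> b - x \<bullet> b))" for k b x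
    by (simp add: \<psi>_def algebra_simps)
  define \<phi> where "\<phi> k x = (\<Prod>b\<in>Basis. \<psi> k b x)" for k and x :: 'a
  have sm: "\<phi> k \<in> smooth" for k
    unfolding \<phi>_def \<psi>_def
    by (intro smooth_prod smooth.mult smooth.ridge[where p="\<lambda>t. flat_exp (_ * t + _)"]
          smooth1.affine flat_exp_smooth1) auto
  have "x \<in> cbox a c" if "\<phi> k x \<noteq> 0" for k x
  proof -
    have "\<psi> k b x \<noteq> 0" if "b \<in> Basis" for b
      using \<open>\<phi> k x \<noteq> 0\<close> that unfolding \<phi>_def by (meson finite_Basis prod_zero)
    then have "0 < x \<bullet> b - a \<bullet> b \<and> 0 < c \<bullet> b - x \<bullet> b" if "b \<in> Basis" for b
      using that by (fastforce simp: \<psi>_alt flat_exp_def zero_less_mult_iff m_def split: if_splits)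
    then show ?thesis unfolding mem_box by force
  qed
  then have "\<phi> k \<in> test_functions \<Omega>" for k
    by (rule smooth_test_functionI[OF sm _ compact_cbox assms])
  moreover have "\<bar>\<phi> k x\<bar> \<le> 1" for k x
  proof -
    have "0 \<le> \<psi> k b x \<and> \<psi> k b x \<le> 1" for b
      by (simp add: \<psi>_alt flat_exp_bounds mult_le_one)
    then show ?thesis unfolding \<phi>_def by (simp add: abs_prod prod_le_1)
  qed
  moreover have "(\<lambda>k. \<phi> k x) \<longlonglongrightarrow> indicator (box a c) x" for x
  proof -
    have "(\<lambda>k. \<phi> k x) \<longlonglongrightarrow> (\<Prod>b\<in>Basis. (if x \<bullet> b - a \<bullet> b > 0 then 1 else 0) * (if c \<bullet> b - x \<bullet> b > 0 then 1 else 0))"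
      unfolding \<phi>_def \<psi>_alt m_def by (intro tendsto_prod tendsto_mult flat_exp_scaled_tendsto)
    also have "(\<Prod>b\<in>Basis. (if x \<bullet> b - a \<bullet> b > 0 then 1 else 0) * (if c \<bullet> b - x \<bullet> b > 0 then 1 else 0))
        = (indicator (box a c) x :: real)"
    proof (cases "x \<in> box a c")
      case True
      then show ?thesis by (simp add: mem_box)
    next
      case False
      then obtain b where "b \<in> Basis" "\<not> (a \<bullet> b < x \<bullet> b \<and> x \<bullet> b < c \<bullet> b)" by (auto simp: mem_box)
      then show ?thesis using False by (auto simp: prod_zero_iff intro!: bexI[of _ b])
    qed
    finally show ?thesis .
  qed
  ultimately show ?thesis by (rule that)
qed

section \<open>Test functions\<close>

lemma partials_append: "partials (bs @ cs) f = partials bs (partials cs f)"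
  by (induction bs) auto

lemma frechet_derivative_cong_open:
  assumes "open S" "x \<in> S" "\<And>y. y \<in> S \<Longrightarrow> f y = g y"
  shows "frechet_derivative f (at x) = frechet_derivative g (at x)"
proof -
  have "(f has_derivative D) (at x) \<longleftrightarrow> (g has_derivative D) (at x)" for D
    using assms by (metis has_derivative_transform_within_open)
  then show ?thesis by (simp add: frechet_derivative_def)
qed

lemma partials_cong_open:
  assumes "open S" "\<And>y. y \<in> S \<Longrightarrow> f y = g y" "x \<in> S"
  shows "partials bs f x = partials bs g x"
  using assms(3)
proof (induction bs arbitrary: x)
  case (Cons b bs)
  have "frechet_derivative (partials bs f) (at x) = frechet_derivative (partials bs g) (at x)"
    using Cons assms(1) by (intro frechet_derivative_cong_open[of S]) auto
  then show ?case by simp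
qed (use assms in auto)

lemma partials_zero [simp]: "partials bs (\<lambda>x. 0) = (\<lambda>x. 0)"
  by (induction bs) auto

lemma partials_zero_on_open:
  assumes "open S" "\<And>y. y \<in> S \<Longrightarrow> f y = 0" "x \<in> S"
  shows "partials bs f x = 0"
  using partials_cong_open[OF assms(1), of f "\<lambda>x. 0" x bs] assms by simp

lemma test_function_partials_differentiable:
  assumes "\<phi> \<in> test_functions \<Omega>" "bs \<in> lists Basis"
  shows "partials bs \<phi> differentiable (at x)"
proof -
  have "Ck_on (Suc (length bs)) UNIV \<phi>" using assms by (simp add: test_functions_def)
  then show ?thesis using assms(2) unfolding Ck_on_def by blast
qed

lemma test_function_partials:
  assumes "\<phi> \<in> test_functions \<Omega>" "bs \<in> lists Basis"
  shows "partials bs \<phi> \<in> test_functions \<Omega>"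
proof -
  let ?K = "closure {x. \<phi> x \<noteq> 0}"
  have K: "compact ?K" "?K \<subseteq> \<Omega>" using assms by (auto simp: test_functions_def)
  have "partials bs \<phi> x = 0" if "x \<notin> ?K" for x
  proof (rule partials_zero_on_open[of "- ?K"])
    show "\<phi> y = 0" if "y \<in> - ?K" for y using that closure_subset[of "{x. \<phi> x \<noteq> 0}"] by auto
  qed (use that in auto)
  then have s: "closure {x. partials bs \<phi> x \<noteq> 0} \<subseteq> ?K"
    by (intro closure_minimal) auto
  have "Ck_on k UNIV (partials bs \<phi>)" for k
    unfolding Ck_on_def
  proof (intro ballI conjI impI)
    fix cs :: "'a list" assume cs: "cs \<in> lists Basis"
    have d: "partials cs (partials bs \<phi>) differentiable (at x)" for x
      using test_function_partials_differentiable[OF assms(1), of "cs @ bs" x] cs assms(2)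
      by (simp add: partials_append)
    then show "partials cs (partials bs \<phi>) differentiable (at x)" for x .
    show "continuous_on UNIV (partials cs (partials bs \<phi>))"
      by (intro continuous_at_imp_continuous_on ballI differentiable_imp_continuous_within d)
  qed
  moreover have "compact (closure {x. partials bs \<phi> x \<noteq> 0})"
    using K(1) s by (metis closed_closure compact_Int_closed inf.absorb_iff2)
  ultimately show ?thesis using s K by (auto simp: test_functions_def)
qed

lemma test_function_differentiable:
  "\<phi> \<in> test_functions \<Omega> \<Longrightarrow> \<phi> differentiable (at x)"
  using test_function_partials_differentiable[of \<phi> \<Omega> "[]"] by simp

lemma test_function_continuous_on: "\<phi> \<in> test_functions \<Omega> \<Longrightarrow> continuous_on S \<phi>"
  by (meson continuous_at_imp_continuous_on differentiable_imp_continuous_within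
      test_function_differentiable)

lemma test_function_eq_0: "\<phi> \<in> test_functions \<Omega> \<Longrightarrow> x \<notin> \<Omega> \<Longrightarrow> \<phi> x = 0"
  using closure_subset[of "{x. \<phi> x \<noteq> 0}"] by (auto simp: test_functions_def)

lemma test_function_borel_measurable [measurable_dest]:
  "\<phi> \<in> test_functions \<Omega> \<Longrightarrow> \<phi> \<in> borel_measurable borel"
  by (intro borel_measurable_continuous_onI test_function_continuous_on)

lemma test_function_bounded:
  assumes "\<phi> \<in> test_functions \<Omega>" obtains M where "M > 0" "\<And>x. \<bar>\<phi> x\<bar> \<le> M"
proof -
  have "compact (\<phi> ` closure {x. \<phi> x \<noteq> 0})"
    using assms by (intro compact_continuous_image test_function_continuous_on) (auto simp: test_functions_def)
  then obtain M where M: "M > 0" "\<And>y. y \<in> \<phi> ` closure {x. \<phi> x \<noteq> 0} \<Longrightarrow> \<bar>y\<bar> \<le> M"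
    using compact_imp_bounded bounded_pos by (metis real_norm_def)
  have "\<bar>\<phi> x\<bar> \<le> M" for x
    using M closure_subset[of "{x. \<phi> x \<noteq> 0}"] by (cases "\<phi> x = 0") auto
  with M show ?thesis using that by blast
qed

lemma has_real_derivative_along_line:
  assumes "f differentiable (at (y + s *\<^sub>R b))"
  shows "((\<lambda>s. f (y + s *\<^sub>R b)) has_real_derivative frechet_derivative f (at (y + s *\<^sub>R b)) b) (at s)"
proof -
  let ?D = "frechet_derivative f (at (y + s *\<^sub>R b))"
  have D: "(f has_derivative ?D) (at (y + s *\<^sub>R b))"
    using assms frechet_derivative_works by blast
  have "((\<lambda>s. y + s *\<^sub>R b) has_derivative (\<lambda>h. h *\<^sub>R b)) (at s)"
    by (auto intro!: derivative_eq_intros)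
  from has_derivative_compose[OF this D]
  have "((\<lambda>s. f (y + s *\<^sub>R b)) has_derivative (\<lambda>h. ?D (h *\<^sub>R b))) (at s)" .
  then show ?thesis
    unfolding has_field_derivative_def
    using linear_cmul[OF has_derivative_linear[OF D], of _ b]
    by (simp add: mult.commute[of "frechet_derivative f (at (y + s *\<^sub>R b)) b"] mult_commute_abs)
qed

text \<open>The mean value theorem is applied twice: in direction \<open>b\<close> to the difference
  of two translates, then in direction \<open>c\<close> to the partial derivative along
  \<open>b\<close>.\<close>

lemma double_difference_mean_value:
  fixes \<phi> :: "'a::euclidean_space \<Rightarrow> real"
  assumes "\<phi> \<in> test_functions \<Omega>" "b \<in> Basis" "c \<in> Basis" "h > 0"
  shows "\<exists>\<xi> \<eta>. 0 < \<xi> \<and> \<xi> < h \<and> 0 < \<eta> \<and> \<eta> < h \<and>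
    (\<phi> (x + h *\<^sub>R b + h *\<^sub>R c) - \<phi> (x + h *\<^sub>R b)) - (\<phi> (x + h *\<^sub>R c) - \<phi> x)
      = h * h * partials [c, b] \<phi> (x + \<xi> *\<^sub>R b + \<eta> *\<^sub>R c)"
proof -
  let ?p = "partials [b] \<phi>"
  have d: "((\<lambda>s. \<phi> (x + h *\<^sub>R c + s *\<^sub>R b) - \<phi> (x + s *\<^sub>R b)) has_real_derivative
      ?p (x + h *\<^sub>R c + s *\<^sub>R b) - ?p (x + s *\<^sub>R b)) (at s)" for s
    using has_real_derivative_along_line[OF test_function_differentiable[OF assms(1)]]
    by (intro DERIV_diff) auto
  obtain \<xi> where \<xi>: "0 < \<xi>" "\<xi> < h"
    "(\<phi> (x + h *\<^sub>R c + h *\<^sub>R b) - \<phi> (x + h *\<^sub>R b)) - (\<phi> (x + h *\<^sub>R c + 0 *\<^sub>R b) - \<phi> (x + 0 *\<^sub>R b))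
      = (h - 0) * (?p (x + h *\<^sub>R c + \<xi> *\<^sub>R b) - ?p (x + \<xi> *\<^sub>R b))"
    using MVT2[OF assms(4) d] by blast
  have "((\<lambda>s. ?p (x + \<xi> *\<^sub>R b + s *\<^sub>R c)) has_real_derivative
      partials [c, b] \<phi> (x + \<xi> *\<^sub>R b + s *\<^sub>R c)) (at s)" for s
    using has_real_derivative_along_line[OF test_function_partials_differentiable[OF assms(1), of "[b]"], where y="x + \<xi> *\<^sub>R b" and s=s and b=c]
      assms(2) by simp
  from MVT2[OF assms(4) this] obtain \<eta> where \<eta>: "0 < \<eta>" "\<eta> < h"
    "?p (x + \<xi> *\<^sub>R b + h *\<^sub>R c) - ?p (x + \<xi> *\<^sub>R b + 0 *\<^sub>R c)
      = (h - 0) * partials [c, b] \<phi> (x + \<xi> *\<^sub>R b + \<eta> *\<^sub>R c)" by blast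
  have e: "x + h *\<^sub>R c + \<xi> *\<^sub>R b = x + \<xi> *\<^sub>R b + h *\<^sub>R c"
    "x + h *\<^sub>R c + h *\<^sub>R b = x + h *\<^sub>R b + h *\<^sub>R c"
    by (simp_all add: algebra_simps)
  have "(\<phi> (x + h *\<^sub>R b + h *\<^sub>R c) - \<phi> (x + h *\<^sub>R b)) - (\<phi> (x + h *\<^sub>R c) - \<phi> x)
      = h * h * partials [c, b] \<phi> (x + \<xi> *\<^sub>R b + \<eta> *\<^sub>R c)"
    using \<xi>(3) \<eta>(3) unfolding e by (simp del: partials.simps)
  with \<xi>(1,2) \<eta>(1,2) show ?thesis by blast
qed

text \<open>The double difference is symmetric in the two directions. Reading it as either mixed
  derivative at a nearby point and letting h tend to 0 gives the claim by continuity.\<close>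

lemma mixed_partials_commute:
  fixes \<phi> :: "'a::euclidean_space \<Rightarrow> real"
  assumes "\<phi> \<in> test_functions \<Omega>" "b \<in> Basis" "c \<in> Basis"
  shows "partials [b, c] \<phi> = partials [c, b] \<phi>"
proof
  fix x
  have lim: "(\<lambda>n. partials [c, b] \<phi> (p n)) \<longlonglongrightarrow> partials [c, b] \<phi> x"
    if p: "\<And>n. \<exists>\<xi> \<eta>. 0 < \<xi> \<and> \<xi> < h n \<and> 0 < \<eta> \<and> \<eta> < h n \<and> p n = x + \<xi> *\<^sub>R b + \<eta> *\<^sub>R c"
      and h: "h \<longlonglongrightarrow> 0" and "b \<in> Basis" "c \<in> Basis" for p and h :: "nat \<Rightarrow> real" and b c
  proof -
    have "dist (p n) x \<le> 2 * h n" for n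
    proof -
      obtain \<xi> \<eta> where *: "0 < \<xi>" "\<xi> < h n" "0 < \<eta>" "\<eta> < h n" "p n = x + \<xi> *\<^sub>R b + \<eta> *\<^sub>R c"
        using p[of n] by blast
      have "dist (p n) x = norm (\<xi> *\<^sub>R b + \<eta> *\<^sub>R c)" by (simp add: * dist_norm)
      also have "\<dots> \<le> norm (\<xi> *\<^sub>R b) + norm (\<eta> *\<^sub>R c)" by (rule norm_triangle_ineq)
      also have "\<dots> \<le> 2 * h n" using * that by simp
      finally show ?thesis .
    qed
    moreover have "(\<lambda>n. 2 * h n) \<longlonglongrightarrow> 0" using tendsto_mult_right_zero[OF h] by simp
    ultimately have "p \<longlonglongrightarrow> x"
      by (intro metric_tendsto_imp_tendsto[where f="\<lambda>n. 2 * h n" and a=0 and g=p and b=x])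
        (auto intro!: always_eventually order_trans[OF _ abs_ge_self])
    moreover have "isCont (partials [c, b] \<phi>) x"
      using test_function_partials_differentiable[OF assms(1), of "[c, b]" x] that
      by (intro differentiable_imp_continuous_within) auto
    ultimately show ?thesis by (rule isCont_tendsto_compose[rotated])
  qed
  define h where "h n = inverse (real (Suc n))" for n
  have h: "h \<longlonglongrightarrow> 0" unfolding h_def by (rule LIMSEQ_inverse_real_of_nat)
  have h0: "h n > 0" for n by (simp add: h_def)
  let ?DD = "\<lambda>b c n. (\<phi> (x + h n *\<^sub>R b + h n *\<^sub>R c) - \<phi> (x + h n *\<^sub>R b)) - (\<phi> (x + h n *\<^sub>R c) - \<phi> x)"
  have "\<exists>p. (\<forall>n. (\<exists>\<xi> \<eta>. 0 < \<xi> \<and> \<xi> < h n \<and> 0 < \<eta> \<and> \<eta> < h n \<and> p n = x + \<xi> *\<^sub>R b + \<eta> *\<^sub>R c) \<and>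
      ?DD b c n = h n * h n * partials [c, b] \<phi> (p n))" if "b \<in> Basis" "c \<in> Basis" for b c
    using double_difference_mean_value[OF assms(1) that h0, where x=x] by (intro choice) blast
  then obtain p q where
    p: "\<And>n. \<exists>\<xi> \<eta>. 0 < \<xi> \<and> \<xi> < h n \<and> 0 < \<eta> \<and> \<eta> < h n \<and> p n = x + \<xi> *\<^sub>R b + \<eta> *\<^sub>R c"
      "\<And>n. ?DD b c n = h n * h n * partials [c, b] \<phi> (p n)"
    and q: "\<And>n. \<exists>\<xi> \<eta>. 0 < \<xi> \<and> \<xi> < h n \<and> 0 < \<eta> \<and> \<eta> < h n \<and> q n = x + \<xi> *\<^sub>R c + \<eta> *\<^sub>R b"
      "\<And>n. ?DD c b n = h n * h n * partials [b, c] \<phi> (q n)"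
    using assms(2,3) by metis
  \<comment> \<open>The only place where symmetry enters.\<close>
  have "?DD b c n = ?DD c b n" for n by (simp add: algebra_simps)
  then have eq: "h n * h n * partials [c, b] \<phi> (p n) = h n * h n * partials [b, c] \<phi> (q n)" for n
    by (simp only: p(2)[symmetric] q(2)[symmetric])
  have "partials [c, b] \<phi> (p n) = partials [b, c] \<phi> (q n)" for n
    using eq[of n] h0[of n] by (simp del: partials.simps)
  then have pq: "(\<lambda>n. partials [c, b] \<phi> (p n)) = (\<lambda>n. partials [b, c] \<phi> (q n))" by (rule ext)
  show "partials [b, c] \<phi> x = partials [c, b] \<phi> x"
    by (rule LIMSEQ_unique[OF lim[OF q(1) h assms(3,2)]]) (unfold pq[symmetric], rule lim[OF p(1) h assms(2,3)])
qed

text \<open>Difference quotients integrate to 0 by translation invariance of Lebesgue measure, and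
  they converge dominatedly to \<open>D\<close>. All integrations by parts rest on this.\<close>

lemma integral_directional_derivative_eq_0:
  fixes F D :: "'a::euclidean_space \<Rightarrow> real"
  assumes D: "\<And>x s. ((\<lambda>s. F (x + s *\<^sub>R b)) has_real_derivative D (x + s *\<^sub>R b)) (at s)"
    and F: "continuous_on UNIV F" and Dm: "D \<in> borel_measurable borel"
    and bd: "\<And>x. \<bar>D x\<bar> \<le> M" "\<And>x. \<bar>F x\<bar> \<le> M" and b: "norm b \<le> 1"
    and supp: "\<And>x. F x \<noteq> 0 \<Longrightarrow> norm x \<le> R"
  shows "(\<integral>x. D x \<partial>lborel) = 0"
proof -
  define h where "h n = inverse (real (Suc n))" for n
  have h: "h \<longlonglongrightarrow> 0" unfolding h_def by (rule LIMSEQ_inverse_real_of_nat)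
  have h0: "0 < h n" "h n \<le> 1" for n unfolding h_def by (auto simp: inverse_le_1_iff)
  have [measurable]: "F \<in> borel_measurable borel" using F by (rule borel_measurable_continuous_onI)
  note Dm [measurable]
  define q where "q n x = (F (x + h n *\<^sub>R b) - F x) / h n" for n x
  have [measurable]: "q n \<in> borel_measurable borel" for n unfolding q_def by measurable
  have iF: "integrable lborel F"
  proof (rule integrableI_bounded_set[where A="cball 0 R" and B=M])
    show "emeasure lborel (cball (0::'a) R) < \<infinity>" by (rule emeasure_lborel_cball_finite)
    show "AE x in lborel. x \<in> cball 0 R \<longrightarrow> norm (F x) \<le> M" using bd by simp
    show "AE x in lborel. x \<notin> cball 0 R \<longrightarrow> F x = 0" using supp by auto
  qed auto
  have tr: "integrable lborel (\<lambda>x. F (x + c)) \<and> (\<integral>x. F (x + c) \<partial>lborel) = (\<integral>x. F x \<partial>lborel)" for c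
  proof -
    have "(\<integral>x. F x \<partial>lborel) = (\<integral>x. F x \<partial>distr lborel borel ((+) c))"
      by (simp add: lborel_distr_plus)
    also have "\<dots> = (\<integral>x. F (c + x) \<partial>lborel)" by (subst integral_distr) auto
    finally have 1: "(\<integral>x. F (x + c) \<partial>lborel) = (\<integral>x. F x \<partial>lborel)" by (simp add: add.commute)
    have "integrable (distr lborel borel ((+) c)) F" using iF by (simp add: lborel_distr_plus)
    then have "integrable lborel (\<lambda>x. F (c + x))" by (subst (asm) integrable_distr_eq) auto
    with 1 show ?thesis by (simp add: add.commute)
  qed
  have "(\<integral>x. q n x \<partial>lborel) = 0" for n
    unfolding q_def using tr[of "h n *\<^sub>R b"] iF by simp
  moreover have "(\<lambda>n. \<integral>x. q n x \<partial>lborel) \<longlonglongrightarrow> (\<integral>x. D x \<partial>lborel)"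
  proof (rule integral_dominated_convergence[where w="\<lambda>x. indicator (cball 0 (R + 1)) x *\<^sub>R M"])
    show "integrable lborel (\<lambda>x::'a. indicator (cball 0 (R + 1)) x *\<^sub>R M)"
      by (intro integrable_scaleR_left integrable_real_indicator emeasure_lborel_cball_finite) simp
    show "AE x in lborel. (\<lambda>n. q n x) \<longlonglongrightarrow> D x"
    proof (intro AE_I2)
      fix x
      have "((\<lambda>h. (F (x + h *\<^sub>R b) - F x) / h) \<longlongrightarrow> D x) (at 0)"
        using D[of x 0] by (simp add: DERIV_def)
      moreover have "filterlim h (at 0) sequentially"
        using h h0 by (intro filterlim_atI) (auto intro!: always_eventually simp: less_le)
      ultimately show "(\<lambda>n. q n x) \<longlonglongrightarrow> D x"
        unfolding q_def by (rule filterlim_compose)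
    qed
    \<comment> \<open>The mean value theorem bounds the quotient by \<open>M\<close>. Since
      \<open>h n\<close> and the norm of \<open>b\<close> are at most 1, the quotient lives within
      distance 1 of the support of \<open>F\<close>.\<close>
    show "AE x in lborel. norm (q n x) \<le> indicator (cball 0 (R + 1)) x *\<^sub>R M" for n
    proof (intro AE_I2)
      fix x
      show "norm (q n x) \<le> indicator (cball 0 (R + 1)) x *\<^sub>R M"
      proof (cases "norm x \<le> R + 1")
        case True
        obtain z where "F (x + h n *\<^sub>R b) - F (x + 0 *\<^sub>R b) = (h n - 0) * D (x + z *\<^sub>R b)"
          using MVT2[OF h0(1) D] by blast
        then have "q n x = D (x + z *\<^sub>R b)" using h0(1)[of n] by (simp add: q_def)
        then show ?thesis using True bd(1) by simp
      next
        case False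
        have "norm x \<le> norm (x + h n *\<^sub>R b) + norm (h n *\<^sub>R b)"
          using norm_triangle_ineq4[of "x + h n *\<^sub>R b" "h n *\<^sub>R b"] by simp
        moreover have "norm (h n *\<^sub>R b) \<le> 1" using h0[of n] b by (simp add: mult_le_one)
        ultimately have "F (x + h n *\<^sub>R b) = 0" "F x = 0" using False supp by force+
        then show ?thesis using False by (simp add: q_def)
      qed
    qed
  qed auto
  ultimately show ?thesis by (simp add: LIMSEQ_const_iff)
qed

section \<open>Integration by parts and a priori estimates for test functions\<close>

definition laplacian :: "('a::euclidean_space \<Rightarrow> real) \<Rightarrow> 'a \<Rightarrow> real" where
  "laplacian f x = (\<Sum>b\<in>Basis. partials [b, b] f x)"

text \<open>A locale, so that the results can be instantiated also for the open boxes on which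
  Weyl's lemma compares a function with its mollifications.\<close>

locale bounded_open =
  fixes \<Omega> :: "'a::euclidean_space set"
  assumes open_domain: "open \<Omega>" and bounded_domain: "bounded \<Omega>"
begin

abbreviation "N \<equiv> l2norm (lebesgue_on \<Omega>)"
abbreviation "T \<equiv> test_functions \<Omega>"

lemma domain_sets [measurable]: "\<Omega> \<in> sets borel" "\<Omega> \<in> sets lebesgue"
  using open_domain by auto

lemma emeasure_domain: "emeasure (lebesgue_on \<Omega>) (space (lebesgue_on \<Omega>)) < \<infinity>"
  using emeasure_bounded_finite[OF bounded_domain]
  by (simp add: emeasure_restrict_space emeasure_completion)

lemma borel_imp_lebesgue_on: "f \<in> borel_measurable borel \<Longrightarrow> f \<in> borel_measurable (lebesgue_on \<Omega>)"
  by (intro measurable_restrict_space1 measurable_completion) simp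

text \<open>The bridge from the completed measure on the domain to \<open>lborel\<close> on the
  whole space, where translations and Fubini's theorem are applied.\<close>

lemma integral_lborel_eq:
  fixes f :: "'a \<Rightarrow> real"
  assumes "f \<in> borel_measurable borel" "\<And>x. x \<notin> \<Omega> \<Longrightarrow> f x = 0"
  shows "(\<integral>x. f x \<partial>lebesgue_on \<Omega>) = (\<integral>x. f x \<partial>lborel)"
proof -
  have "(\<integral>x. f x \<partial>lebesgue_on \<Omega>) = (\<integral>x. (if x \<in> \<Omega> then f x else 0) \<partial>lebesgue)"
    by (rule Lebesgue_Measure.integral_restrict_UNIV[symmetric]) simp
  also have "(\<lambda>x. if x \<in> \<Omega> then f x else 0) = f" using assms(2) by auto
  also have "integral\<^sup>L lebesgue f = integral\<^sup>L lborel f"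
    using assms(1) by (intro integral_completion) simp
  finally show ?thesis .
qed

lemma test_function_sq_integrable:
  assumes "\<phi> \<in> T" shows "sq_integrable (lebesgue_on \<Omega>) \<phi>"
proof -
  obtain M where "\<And>x. \<bar>\<phi> x\<bar> \<le> M" using test_function_bounded[OF assms] by blast
  then show ?thesis
    using assms by (intro sq_integrable_bounded emeasure_domain borel_imp_lebesgue_on
        test_function_borel_measurable)
qed

lemma domain_bound: obtains R where "R > 0" "\<And>x. x \<in> \<Omega> \<Longrightarrow> norm x \<le> R"
  using bounded_domain bounded_pos by blast

text \<open>The product of the two functions has compact support in the domain, so its directional
  derivative integrates to 0.\<close>

lemma integration_by_parts:
  assumes "\<phi> \<in> T" "\<psi> \<in> T" "b \<in> Basis"
  shows "(\<integral>x. \<phi> x * partials [b] \<psi> x \<partial>lebesgue_on \<Omega>) = - (\<integral>x. partials [b] \<phi> x * \<psi> x \<partial>lebesgue_on \<Omega>)"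
proof -
  let ?a = "partials [b] \<phi>" and ?c = "partials [b] \<psi>"
  have ac: "?a \<in> T" "?c \<in> T" using assms by (auto intro: test_function_partials simp del: partials.simps)
  obtain M1 M2 M3 M4 where M: "\<And>x. \<bar>\<phi> x\<bar> \<le> M1" "\<And>x. \<bar>\<psi> x\<bar> \<le> M2" "\<And>x. \<bar>?a x\<bar> \<le> M3" "\<And>x. \<bar>?c x\<bar> \<le> M4"
    "M1 > 0" "M2 > 0" "M3 > 0" "M4 > 0"
    using test_function_bounded assms ac by metis
  obtain R where R: "\<And>x. x \<in> \<Omega> \<Longrightarrow> norm x \<le> R" using domain_bound by blast
  define D where "D x = \<phi> x * ?c x + ?a x * \<psi> x" for x
  have Dm: "D \<in> borel_measurable borel"
    unfolding D_def using assms ac by (intro borel_measurable_add borel_measurable_times test_function_borel_measurable)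
  have "(\<integral>x. D x \<partial>lborel) = 0"
  proof (rule integral_directional_derivative_eq_0[where F="\<lambda>x. \<phi> x * \<psi> x" and R=R
        and M="M1 * M4 + M3 * M2 + M1 * M2" and b=b])
    show "((\<lambda>s. \<phi> (x + s *\<^sub>R b) * \<psi> (x + s *\<^sub>R b)) has_real_derivative D (x + s *\<^sub>R b)) (at s)" for x s
    proof -
      have "((\<lambda>s. \<phi> (x + s *\<^sub>R b)) has_real_derivative ?a (x + s *\<^sub>R b)) (at s)"
        "((\<lambda>s. \<psi> (x + s *\<^sub>R b)) has_real_derivative ?c (x + s *\<^sub>R b)) (at s)"
        using has_real_derivative_along_line[OF test_function_differentiable] assms(1,2) by auto
      then show ?thesis
        by (auto intro!: derivative_eq_intros simp: D_def simp del: partials.simps)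
    qed
    show "continuous_on UNIV (\<lambda>x. \<phi> x * \<psi> x)"
      using assms by (intro continuous_intros test_function_continuous_on)
    have "\<bar>\<phi> x\<bar> * \<bar>?c x\<bar> \<le> M1 * M4" "\<bar>?a x\<bar> * \<bar>\<psi> x\<bar> \<le> M3 * M2" "\<bar>\<phi> x\<bar> * \<bar>\<psi> x\<bar> \<le> M1 * M2" for x
      using M by (auto intro!: mult_mono simp del: partials.simps intro: less_imp_le)
    moreover have "M1 * M4 \<ge> 0" "M3 * M2 \<ge> 0" "M1 * M2 \<ge> 0" using M(5-8) by auto
    ultimately show "\<bar>D x\<bar> \<le> M1 * M4 + M3 * M2 + M1 * M2" "\<bar>\<phi> x * \<psi> x\<bar> \<le> M1 * M4 + M3 * M2 + M1 * M2" for x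
      unfolding D_def
      using abs_triangle_ineq[of "\<phi> x * ?c x" "?a x * \<psi> x"] unfolding abs_mult by (meson add_mono order_trans add_increasing add_increasing2)+
    show "norm b \<le> 1" using assms by simp
    show "norm x \<le> R" if "\<phi> x * \<psi> x \<noteq> 0" for x
      using that test_function_eq_0[OF assms(1), of x] R by auto
  qed (rule Dm)
  moreover have "D x = 0" if "x \<notin> \<Omega>" for x
    using test_function_eq_0[OF assms(1) that] test_function_eq_0[OF assms(2) that] by (simp add: D_def)
  ultimately have "(\<integral>x. D x \<partial>lebesgue_on \<Omega>) = 0"
    using integral_lborel_eq[OF Dm] by simp
  moreover have "(\<integral>x. D x \<partial>lebesgue_on \<Omega>)
      = (\<integral>x. \<phi> x * ?c x \<partial>lebesgue_on \<Omega>) + (\<integral>x. ?a x * \<psi> x \<partial>lebesgue_on \<Omega>)"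
    unfolding D_def using assms ac
    by (intro Bochner_Integration.integral_add sq_integrable_mult test_function_sq_integrable)
  ultimately show ?thesis by linarith
qed

text \<open>Integrate the derivative along b of (x \<bullet> b) \<phi>^2, which is \<phi>^2 + 2 (x
  \<bullet> b) \<phi> d\<phi>/db. The integral is 0, |x \<bullet> b| is at most \<open>R\<close> on
  the domain, and one factor \<open>N \<phi>\<close> cancels after Cauchy-Schwarz.\<close>

lemma Poincare_direction:
  assumes "\<phi> \<in> T" "b \<in> Basis" "\<And>x. x \<in> \<Omega> \<Longrightarrow> norm x \<le> R" "R > 0"
  shows "N \<phi> \<le> 2 * R * N (partials [b] \<phi>)"
proof -
  let ?a = "partials [b] \<phi>"
  have a: "?a \<in> T" using assms by (auto intro: test_function_partials simp del: partials.simps)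
  obtain M1 M2 where M: "\<And>x. \<bar>\<phi> x\<bar> \<le> M1" "\<And>x. \<bar>?a x\<bar> \<le> M2" "M1 > 0" "M2 > 0"
    using test_function_bounded assms a by metis
  define g where "g x = 2 * (x \<bullet> b) * ?a x" for x
  define D where "D x = (\<phi> x)\<^sup>2 + \<phi> x * g x" for x
  have Dm: "D \<in> borel_measurable borel" and gm: "g \<in> borel_measurable borel"
    unfolding D_def g_def using test_function_borel_measurable[OF a] test_function_borel_measurable[OF assms(1)]
    by auto
  have xb: "\<bar>x \<bullet> b\<bar> \<le> R" if "x \<in> \<Omega>" for x
    using Basis_le_norm[OF assms(2), of x] assms(3)[OF that] by linarith
  have g_le: "\<bar>g x\<bar> \<le> 2 * R * \<bar>?a x\<bar>" for x
  proof (cases "x \<in> \<Omega>")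
    case True
    have "\<bar>x \<bullet> b\<bar> * \<bar>?a x\<bar> \<le> R * \<bar>?a x\<bar>" using xb[OF True] by (intro mult_right_mono) auto
    then show ?thesis by (simp add: g_def abs_mult del: partials.simps)
  next
    case False
    then have "?a x = 0" using test_function_eq_0[OF a] by simp
    then show ?thesis by (simp add: g_def del: partials.simps)
  qed
  have sg: "sq_integrable (lebesgue_on \<Omega>) g"
  proof (rule sq_integrable_bounded[OF borel_imp_lebesgue_on[OF gm] emeasure_domain])
    fix x
    have "2 * R * \<bar>?a x\<bar> \<le> 2 * R * M2" using M assms(4) by (intro mult_left_mono) auto
    with g_le[of x] show "\<bar>g x\<bar> \<le> 2 * R * M2" by linarith
  qed
  have "(\<integral>x. D x \<partial>lborel) = 0"
  proof (rule integral_directional_derivative_eq_0[where F="\<lambda>x. (\<phi> x)\<^sup>2 * (x \<bullet> b)" and R=R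
        and M="M1\<^sup>2 + M1 * (2 * R * M2) + M1\<^sup>2 * R" and b=b])
    show "((\<lambda>s. (\<phi> (x + s *\<^sub>R b))\<^sup>2 * ((x + s *\<^sub>R b) \<bullet> b)) has_real_derivative D (x + s *\<^sub>R b)) (at s)" for x s
    proof -
      have "((\<lambda>s. (x + s *\<^sub>R b) \<bullet> b) has_real_derivative 1) (at s)"
        using assms(2) by (auto intro!: derivative_eq_intros simp: inner_add_left)
      moreover have "((\<lambda>s. \<phi> (x + s *\<^sub>R b)) has_real_derivative ?a (x + s *\<^sub>R b)) (at s)"
        using has_real_derivative_along_line[OF test_function_differentiable[OF assms(1)]] by simp
      ultimately show ?thesis
        by (auto intro!: derivative_eq_intros simp: D_def g_def simp del: partials.simps)
    qed
    show "continuous_on UNIV (\<lambda>x. (\<phi> x)\<^sup>2 * (x \<bullet> b))"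
      using assms by (intro continuous_intros test_function_continuous_on)
    have f2: "(\<phi> x)\<^sup>2 \<le> M1\<^sup>2" for x using power_mono[OF M(1), of x 2] by simp
    have fg: "\<bar>\<phi> x * g x\<bar> \<le> M1 * (2 * R * M2)" for x
    proof -
      have "2 * R * \<bar>?a x\<bar> \<le> 2 * R * M2" using M assms(4) by (intro mult_left_mono) auto
      then have "\<bar>g x\<bar> \<le> 2 * R * M2" using g_le[of x] by linarith
      then show ?thesis unfolding abs_mult using M by (intro mult_mono) auto
    qed
    have fx: "\<bar>(\<phi> x)\<^sup>2 * (x \<bullet> b)\<bar> \<le> M1\<^sup>2 * R" for x
    proof (cases "x \<in> \<Omega>")
      case True
      then show ?thesis unfolding abs_mult using f2[of x] xb by (intro mult_mono) auto
    next
      case False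
      then show ?thesis using assms(4) test_function_eq_0[OF assms(1)] by simp
    qed
    have p: "0 \<le> M1 * (2 * R * M2)" "0 \<le> M1\<^sup>2 * R" "0 \<le> M1\<^sup>2" using M assms(4) by auto
    show "\<bar>D x\<bar> \<le> M1\<^sup>2 + M1 * (2 * R * M2) + M1\<^sup>2 * R" for x
      unfolding D_def using f2[of x] fg[of x] p zero_le_power2[of "\<phi> x"] by linarith
    show "\<bar>(\<phi> x)\<^sup>2 * (x \<bullet> b)\<bar> \<le> M1\<^sup>2 + M1 * (2 * R * M2) + M1\<^sup>2 * R" for x
      using fx[of x] p by linarith
    show "norm b \<le> 1" using assms by simp
    show "norm x \<le> R" if "(\<phi> x)\<^sup>2 * (x \<bullet> b) \<noteq> 0" for x
      using that test_function_eq_0[OF assms(1), of x] assms(3) by auto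
  qed (rule Dm)
  moreover have "D x = 0" if "x \<notin> \<Omega>" for x
    using test_function_eq_0[OF assms(1) that] by (simp add: D_def)
  ultimately have "(\<integral>x. D x \<partial>lebesgue_on \<Omega>) = 0"
    using integral_lborel_eq[OF Dm] by simp
  moreover have "(\<integral>x. D x \<partial>lebesgue_on \<Omega>) = (N \<phi>)\<^sup>2 + (\<integral>x. \<phi> x * g x \<partial>lebesgue_on \<Omega>)"
    unfolding D_def l2norm_square using test_function_sq_integrable[OF assms(1)]
    by (intro Bochner_Integration.integral_add sq_integrable_mult sg sq_integrable_square)
  moreover have "\<bar>\<integral>x. \<phi> x * g x \<partial>lebesgue_on \<Omega>\<bar> \<le> N \<phi> * N g"
    by (intro Cauchy_Schwarz_l2 sg test_function_sq_integrable assms)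
  moreover have "N g \<le> 2 * R * N ?a"
  proof (rule power2_le_imp_le)
    have "(N g)\<^sup>2 \<le> (\<integral>x. (2 * R * ?a x)\<^sup>2 \<partial>lebesgue_on \<Omega>)"
      unfolding l2norm_square
      using sq_integrable_square[OF sg] sq_integrable_square[OF sq_integrable_cmult[OF test_function_sq_integrable[OF a]]]
    proof (rule integral_mono)
      fix x
      have "\<bar>g x\<bar>\<^sup>2 \<le> (2 * R * \<bar>?a x\<bar>)\<^sup>2" using g_le by (intro power_mono) auto
      then show "(g x)\<^sup>2 \<le> (2 * R * ?a x)\<^sup>2" by (simp add: power_mult_distrib del: partials.simps)
    qed
    also have "\<dots> = (2 * R * N ?a)\<^sup>2"
      unfolding l2norm_square[symmetric] l2norm_cmult using assms(4) by (simp del: partials.simps)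
    finally show "(N g)\<^sup>2 \<le> (2 * R * N ?a)\<^sup>2" .
    show "0 \<le> 2 * R * N ?a" using assms(4) by (simp del: partials.simps)
  qed
  then have "N \<phi> * N g \<le> N \<phi> * (2 * R * N ?a)" by (intro mult_left_mono) auto
  ultimately have le: "N \<phi> * N \<phi> \<le> N \<phi> * (2 * R * N ?a)" unfolding power2_eq_square by linarith
  show ?thesis
  proof (cases "N \<phi> = 0")
    case True
    then show ?thesis using assms(4) by (simp del: partials.simps)
  next
    case False
    then show ?thesis using le by (simp add: less_le del: partials.simps)
  qed
qed


text \<open>Integrating by parts, the squared norm of the gradient is minus the inner product of
  \<phi> with its Laplacian.\<close>

lemma sum_norm_gradient_sq:
  assumes "\<phi> \<in> T"
  shows "(\<Sum>b\<in>Basis. (N (partials [b] \<phi>))\<^sup>2) \<le> N \<phi> * N (laplacian \<phi>)"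
proof -
  have "(N (partials [b] \<phi>))\<^sup>2 = - (\<integral>x. partials [b, b] \<phi> x * \<phi> x \<partial>lebesgue_on \<Omega>)" if "b \<in> Basis" for b
  proof -
    have "(\<integral>x. partials [b] \<phi> x * partials [b] \<phi> x \<partial>lebesgue_on \<Omega>)
        = - (\<integral>x. partials [b] (partials [b] \<phi>) x * \<phi> x \<partial>lebesgue_on \<Omega>)"
      using that assms by (intro integration_by_parts test_function_partials) auto
    then show ?thesis unfolding l2norm_square by (simp add: power2_eq_square)
  qed
  then have "(\<Sum>b\<in>Basis. (N (partials [b] \<phi>))\<^sup>2)
      = (\<Sum>b\<in>Basis. - l2inner (lebesgue_on \<Omega>) (partials [b, b] \<phi>) \<phi>)"
    unfolding l2inner_def by (intro sum.cong) auto
  also have "\<dots> = - l2inner (lebesgue_on \<Omega>) (laplacian \<phi>) \<phi>"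
    unfolding laplacian_def[abs_def] sum_negf
    using assms by (subst l2inner_sum) (auto intro!: test_function_sq_integrable test_function_partials simp del: partials.simps)
  also have "\<dots> \<le> \<bar>l2inner (lebesgue_on \<Omega>) (laplacian \<phi>) \<phi>\<bar>" by simp
  also have "\<dots> \<le> N (laplacian \<phi>) * N \<phi>"
    unfolding laplacian_def[abs_def] using assms
    by (intro l2inner_le sq_integrable_sum test_function_sq_integrable test_function_partials) auto
  finally show ?thesis by (simp add: mult.commute)
qed

lemma laplacian_sq_integrable: "\<phi> \<in> T \<Longrightarrow> sq_integrable (lebesgue_on \<Omega>) (laplacian \<phi>)"
  unfolding laplacian_def[abs_def]
  by (intro sq_integrable_sum test_function_sq_integrable test_function_partials) auto

text \<open>Two integrations by parts turn the squared norm of a mixed derivative into the inner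
  product of two pure ones. Summed over all directions, the Hessian has exactly the L2 norm of the
  Laplacian.\<close>

lemma norm_second_partial_le:
  assumes "\<phi> \<in> T" "b \<in> Basis" "c \<in> Basis"
  shows "N (partials [b, c] \<phi>) \<le> N (laplacian \<phi>)"
proof -
  let ?I = "l2inner (lebesgue_on \<Omega>)"
  note [simp del] = partials.simps
  have tf: "partials bs \<phi> \<in> T" if "bs \<in> lists Basis" for bs
    using assms(1) that by (rule test_function_partials)
  have sq: "sq_integrable (lebesgue_on \<Omega>) (partials bs \<phi>)" if "bs \<in> lists Basis" for bs
    using that by (intro test_function_sq_integrable tf)
  have app: "partials [b] (partials bs \<phi>) = partials (b # bs) \<phi>" for b bs
    using partials_append[of "[b]" bs \<phi>] by simp
  have ibp: "?I (partials bs \<phi>) (partials (b # cs) \<phi>) = - ?I (partials (b # bs) \<phi>) (partials cs \<phi>)"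
    if "b \<in> Basis" "bs \<in> lists Basis" "cs \<in> lists Basis" for b bs cs
    using integration_by_parts[OF tf[OF that(2)] tf[OF that(3)] that(1)] by (simp add: l2inner_def app)
  have eq: "(N (partials [b, c] \<phi>))\<^sup>2 = ?I (partials [b, b] \<phi>) (partials [c, c] \<phi>)"
    if "b \<in> Basis" "c \<in> Basis" for b c
  proof -
    \<comment> \<open>The derivative along c has to pass both derivatives along b; each exchange is
      a symmetry of second derivatives, applied once to \<phi> and once to its derivative along
      b.\<close>
    have "partials [b, b, c] \<phi> = partials [b] (partials [b, c] \<phi>)" by (simp add: app)
    also have "\<dots> = partials [b] (partials [c, b] \<phi>)"
      using mixed_partials_commute[OF assms(1) that] by simp
    also have "\<dots> = partials [b, c] (partials [b] \<phi>)"
      using partials_append[of "[b, c]" "[b]" \<phi>] by (simp add: app)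
    also have "\<dots> = partials [c, b] (partials [b] \<phi>)"
      using that by (intro mixed_partials_commute[OF tf]) auto
    also have "\<dots> = partials [c, b, b] \<phi>"
      using partials_append[of "[c, b]" "[b]" \<phi>] by simp
    finally have third: "partials [b, b, c] \<phi> = partials [c, b, b] \<phi>" .
    have "(N (partials [b, c] \<phi>))\<^sup>2 = - ?I (partials [b, b, c] \<phi>) (partials [c] \<phi>)"
      unfolding l2inner_self[symmetric] using that by (intro ibp) auto
    also have "\<dots> = ?I (partials [b, b] \<phi>) (partials [c, c] \<phi>)"
      unfolding third using ibp[of c "[b, b]" "[c]"] that by simp
    finally show ?thesis .
  qed
  have "(N (laplacian \<phi>))\<^sup>2 = ?I (laplacian \<phi>) (laplacian \<phi>)" by (simp add: l2inner_self)
  also have "\<dots> = (\<Sum>b\<in>Basis. ?I (partials [b, b] \<phi>) (laplacian \<phi>))"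
    by (rule trans[OF arg_cong[where f="\<lambda>f. ?I f (laplacian \<phi>)"] l2inner_sum])
      (auto intro!: sq laplacian_sq_integrable assms simp: laplacian_def)
  also have "\<dots> = (\<Sum>b\<in>Basis. \<Sum>c\<in>Basis. (N (partials [b, c] \<phi>))\<^sup>2)"
  proof (intro sum.cong refl)
    fix b :: 'a assume b: "b \<in> Basis"
    have "?I (partials [b, b] \<phi>) (laplacian \<phi>) = ?I (laplacian \<phi>) (partials [b, b] \<phi>)"
      by (rule l2inner_commute)
    also have "\<dots> = (\<Sum>c\<in>Basis. ?I (partials [c, c] \<phi>) (partials [b, b] \<phi>))"
      unfolding laplacian_def[abs_def] using b
      by (subst l2inner_sum) (auto intro!: sq sq_integrable_sum)
    also have "\<dots> = (\<Sum>c\<in>Basis. (N (partials [b, c] \<phi>))\<^sup>2)"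
      using b by (intro sum.cong refl) (simp add: eq l2inner_commute)
    finally show "?I (partials [b, b] \<phi>) (laplacian \<phi>) = (\<Sum>c\<in>Basis. (N (partials [b, c] \<phi>))\<^sup>2)" .
  qed
  finally have tot: "(N (laplacian \<phi>))\<^sup>2 = (\<Sum>b\<in>Basis. \<Sum>c\<in>Basis. (N (partials [b, c] \<phi>))\<^sup>2)" .
  have "(N (partials [b, c] \<phi>))\<^sup>2 \<le> (\<Sum>c\<in>Basis. (N (partials [b, c] \<phi>))\<^sup>2)"
    using assms(3) by (intro member_le_sum) auto
  also have "\<dots> \<le> (\<Sum>b\<in>Basis. \<Sum>c\<in>Basis. (N (partials [b, c] \<phi>))\<^sup>2)"
    using assms(2) by (intro member_le_sum[where f="\<lambda>b. \<Sum>c\<in>Basis. (N (partials [b, c] \<phi>))\<^sup>2"] sum_nonneg) auto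
  finally show ?thesis unfolding tot[symmetric] by (rule power2_le_imp_le) simp
qed

text \<open>The gradient estimate has the factor \<open>N \<phi>\<close>, which the Poincare
  inequality turns into the norm of a single partial derivative. That factor cancels and leaves the
  Laplacian.\<close>

lemma partials_norm_le_laplacian:
  obtains C where "C > 0"
    "\<And>\<phi> bs. \<phi> \<in> T \<Longrightarrow> bs \<in> lists Basis \<Longrightarrow> length bs \<le> 2 \<Longrightarrow> N (partials bs \<phi>) \<le> C * N (laplacian \<phi>)"
proof -
  obtain R where R: "R > 0" "\<And>x. x \<in> \<Omega> \<Longrightarrow> norm x \<le> R" using domain_bound by blast
  have grad: "N (partials [b] \<phi>) \<le> 2 * R * N (laplacian \<phi>)" if "\<phi> \<in> T" "b \<in> Basis" for \<phi> b
  proof -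
    let ?S = "(\<Sum>b\<in>Basis. (N (partials [b] \<phi>))\<^sup>2)" and ?g = "N (partials [b] \<phi>)"
    have S: "?g\<^sup>2 \<le> ?S" using that(2) by (intro member_le_sum) auto
    have "?g\<^sup>2 \<le> N \<phi> * N (laplacian \<phi>)" using S sum_norm_gradient_sq[OF that(1)] by linarith
    also have "\<dots> \<le> (2 * R * ?g) * N (laplacian \<phi>)"
      using Poincare_direction[OF that R(2,1)] by (intro mult_right_mono) auto
    finally have le: "?g * ?g \<le> ?g * (2 * R * N (laplacian \<phi>))" by (simp add: power2_eq_square mult_ac)
    show ?thesis
    proof (cases "?g = 0")
      case True
      then show ?thesis using R(1) by (simp del: partials.simps)
    next
      case False
      then show ?thesis using le by (simp add: less_le del: partials.simps)
    qed
  qed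
  have val: "N \<phi> \<le> 4 * R\<^sup>2 * N (laplacian \<phi>)" if "\<phi> \<in> T" for \<phi>
  proof -
    obtain b :: 'a where b: "b \<in> Basis" using nonempty_Basis by blast
    have "N \<phi> \<le> 2 * R * N (partials [b] \<phi>)" by (rule Poincare_direction[OF that b R(2,1)])
    also have "\<dots> \<le> 2 * R * (2 * R * N (laplacian \<phi>))"
      using grad[OF that b] R(1) by (intro mult_left_mono) auto
    finally show ?thesis by (simp add: power2_eq_square mult_ac)
  qed
  \<comment> \<open>The three entries serve derivatives of order 2, 1 and 0 respectively.\<close>
  define C where "C = max 1 (max (2 * R) (4 * R\<^sup>2))"
  have "N (partials bs \<phi>) \<le> C * N (laplacian \<phi>)"
    if "\<phi> \<in> T" "bs \<in> lists Basis" "length bs \<le> 2" for \<phi> bs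
  proof -
    have up: "y \<le> C * N (laplacian \<phi>)" if "y \<le> r * N (laplacian \<phi>)" "r \<le> C" for y r
      using that mult_right_mono[OF that(2), of "N (laplacian \<phi>)"] by simp
    consider "bs = []" | b where "bs = [b]" | b c where "bs = [b, c]"
      using \<open>length bs \<le> 2\<close> by (cases bs; cases "tl bs") (auto split: list.splits)
    then show ?thesis
    proof cases
      case 1
      then show ?thesis using up[OF val[OF that(1)]] by (simp add: C_def)
    next
      case (2 b)
      then show ?thesis using up[OF grad[OF that(1), of b]] that by (simp add: C_def del: partials.simps)
    next
      case (3 b c)
      then show ?thesis using up[of "N (partials [b, c] \<phi>)" 1] norm_second_partial_le[OF that(1), of b c] that
        by (simp add: C_def del: partials.simps)
    qed
  qed
  moreover have "C > 0" by (simp add: C_def)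
  ultimately show ?thesis using that by blast
qed

end

section \<open>The fundamental lemma and weak derivatives\<close>

text \<open>Open boxes form an intersection-stable generator of the Borel sets, so the vanishing of
  the integrals extends to all Borel sets by a Dynkin argument.\<close>

lemma AE_zero_if_box_integrals_zero:
  fixes F :: "'a::euclidean_space \<Rightarrow> real"
  assumes F: "integrable lborel F" and box: "\<And>a b. (LINT x:box a b|lborel. F x) = 0"
  shows "AE x in lborel. F x = 0"
proof (rule sigma_finite_measure.density_zero[OF sigma_finite_lborel F])
  fix A :: "'a set" assume "A \<in> sets lborel"
  have si: "set_integrable lborel A F" if "A \<in> sets borel" for A
    unfolding set_integrable_def using F that by (intro integrable_mult_indicator) auto
  \<comment> \<open>Complements require the integral over the whole space, obtained by exhausting it
    with boxes.\<close>
  have tot: "(LINT x|lborel. F x) = 0"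
  proof -
    have U: "(LINT x:(\<Union>n::nat. box (- (real n *\<^sub>R One)) (real n *\<^sub>R One :: 'a))|lborel. F x) = (LINT x|lborel. F x)"
      unfolding UN_box_eq_UNIV by (simp add: set_lebesgue_integral_def)
    have "(\<lambda>n. LINT x:box (- (real n *\<^sub>R One)) (real n *\<^sub>R One :: 'a)|lborel. F x)
        \<longlonglongrightarrow> (LINT x:(\<Union>n::nat. box (- (real n *\<^sub>R One)) (real n *\<^sub>R One :: 'a))|lborel. F x)"
    proof (rule set_integral_cont_up)
      show "incseq (\<lambda>n::nat. box (- (real n *\<^sub>R One)) (real n *\<^sub>R One :: 'a))"
        by (intro incseq_SucI subset_box_imp) (auto simp: mem_box inner_add_left)
      show "set_integrable lborel (\<Union>n::nat. box (- (real n *\<^sub>R One)) (real n *\<^sub>R One :: 'a)) F"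
        by (intro si) auto
    qed auto
    then show ?thesis unfolding box U by (simp add: LIMSEQ_const_iff)
  qed
  have "Int_stable (range (\<lambda>(a, b). box a b :: 'a set))"
    by (auto simp: Int_stable_def box_Int_box)
  moreover have "range (\<lambda>(a, b). box a b :: 'a set) \<subseteq> Pow UNIV" by auto
  moreover have "A \<in> sigma_sets UNIV (range (\<lambda>(a, b). box a b))"
    using \<open>A \<in> sets lborel\<close> by (simp add: borel_eq_box)
  ultimately show "(LINT x:A|lborel. F x) = 0"
  proof (induction rule: sigma_sets_induct_disjoint)
    case (basic A)
    then show ?case using box by auto
  next
    case empty
    show ?case by (simp add: set_lebesgue_integral_def)
  next
    case (compl A)
    then have [measurable]: "A \<in> sets borel" by (simp add: borel_eq_box)
    have "(LINT x:UNIV - A|lborel. F x) = (LINT x|lborel. F x - indicator A x *\<^sub>R F x)"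
      unfolding set_lebesgue_integral_def
      by (intro Bochner_Integration.integral_cong) (auto simp: indicator_def)
    also have "\<dots> = (LINT x|lborel. F x) - (LINT x:A|lborel. F x)"
      unfolding set_lebesgue_integral_def using si[of A] F
      by (intro Bochner_Integration.integral_diff) (auto simp: set_integrable_def)
    finally show ?case using compl tot by simp
  next
    case (union A)
    then have "range A \<subseteq> sets borel" by (simp add: borel_eq_box)
    then have "(LINT x:(\<Union>i. A i)|lborel. F x) = (\<Sum>i. LINT x:A i|lborel. F x)"
      using union(1) by (intro lebesgue_integral_countable_add si) (auto simp: disjoint_family_on_def)
    then show ?case using union by simp
  qed
qed

context bounded_open
begin

text \<open>Elements of L2 are only Lebesgue measurable on the domain. A Borel version that is 0
  outside can be convolved, translated and used with Fubini's theorem on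
  \<open>lborel\<close>.\<close>

lemma borel_representative:
  fixes f :: "'a \<Rightarrow> real"
  assumes "f \<in> borel_measurable (lebesgue_on \<Omega>)"
  obtains f' where "f' \<in> borel_measurable borel" "\<And>x. x \<notin> \<Omega> \<Longrightarrow> f' x = 0"
    "AE x in lebesgue_on \<Omega>. f x = f' x" "integrable (lebesgue_on \<Omega>) f \<Longrightarrow> integrable lborel f'"
proof -
  let ?f0 = "\<lambda>x. if x \<in> \<Omega> then f x else 0"
  have f0: "?f0 \<in> borel_measurable lebesgue"
    using assms by (simp add: borel_measurable_if)
  from completion_ex_borel_measurable_real[OF f0] obtain f1 where
    f1 [measurable]: "f1 \<in> borel_measurable lborel" "AE x in lborel. ?f0 x = f1 x" by blast
  define f' where "f' x = indicator \<Omega> x * f1 x" for x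
  have fm: "f' \<in> borel_measurable lborel" unfolding f'_def by measurable
  have ae: "AE x in lebesgue. ?f0 x = f' x"
    using AE_completion[OF f1(2)] by eventually_elim (auto simp: f'_def indicator_def)
  show ?thesis
  proof (rule that)
    show "f' \<in> borel_measurable borel" using fm by simp
    show "f' x = 0" if "x \<notin> \<Omega>" for x using that by (simp add: f'_def)
    show "AE x in lebesgue_on \<Omega>. f x = f' x"
      using ae by (subst AE_restrict_space_iff) auto
    show "integrable lborel f'" if "integrable (lebesgue_on \<Omega>) f"
    proof -
      have "integrable lebesgue ?f0"
        using that by (simp add: Lebesgue_Measure.integrable_restrict_UNIV)
      then have "integrable lebesgue f'"
        using ae fm f0 by (subst (asm) integrable_cong_AE[OF _ _ ae]) (auto intro: measurable_completion)
      then show ?thesis using fm by (simp add: integrable_completion)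
    qed
  qed
qed

text \<open>An open set is a countable union of closed boxes, and the faces of a box are null, so
  open boxes whose closure lies in the domain decide the matter.\<close>

lemma AE_lebesgue_on_iff_boxes:
  assumes "\<And>a b. cbox a b \<subseteq> \<Omega> \<Longrightarrow> AE x in lborel. x \<in> box a b \<longrightarrow> P x"
  shows "AE x in lebesgue_on \<Omega>. P x"
proof -
  obtain D where D: "countable D" "\<And>X. X \<in> D \<Longrightarrow> X \<subseteq> \<Omega>" "\<And>X. X \<in> D \<Longrightarrow> \<exists>a b. X = cbox a b" "\<Union>D = \<Omega>"
    using open_countable_Union_open_cbox[OF open_domain] by (metis PowD subsetD)
  have "AE x in lebesgue. \<forall>X\<in>D. x \<in> X \<longrightarrow> P x"
  proof (rule AE_ball_countable[THEN iffD2, OF D(1)], rule ballI)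
    fix X assume X: "X \<in> D"
    then obtain a b where ab: "X = cbox a b" using D(3) by blast
    have "AE x in lebesgue. x \<in> box a b \<longrightarrow> P x"
      using assms D(2)[OF X] ab by (intro AE_completion) auto
    moreover have "AE x in lebesgue. x \<notin> cbox a b - box a b"
      using negligible_frontier_interval[of a b] by (intro AE_not_in) (simp add: negligible_iff_null_sets)
    ultimately show "AE x in lebesgue. x \<in> X \<longrightarrow> P x"
      unfolding ab by eventually_elim auto
  qed
  then have "AE x in lebesgue. x \<in> \<Omega> \<longrightarrow> P x"
    using D(4) by (auto elim!: eventually_mono)
  then show ?thesis by (subst AE_restrict_space_iff) auto
qed

lemma test_function_mult_integrable:
  assumes "integrable (lebesgue_on \<Omega>) f" "\<phi> \<in> T"
  shows "integrable (lebesgue_on \<Omega>) (\<lambda>x. f x * \<phi> x)"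
proof -
  obtain M where M: "\<And>x. \<bar>\<phi> x\<bar> \<le> M" using test_function_bounded[OF assms(2)] by blast
  have "\<phi> \<in> borel_measurable (lebesgue_on \<Omega>)"
    using assms(2) by (intro borel_imp_lebesgue_on test_function_borel_measurable)
  then show ?thesis
    using assms(1) M
    by (intro Bochner_Integration.integrable_bound[OF integrable_mult_right[OF assms(1), of M]])
      (auto intro!: AE_I2 mult_right_mono order_trans[OF _ abs_ge_self, of _ M] simp: abs_mult mult.commute)
qed

text \<open>The indicator of a box is a bounded pointwise limit of test functions.\<close>

lemma fundamental_lemma:
  assumes f: "integrable (lebesgue_on \<Omega>) f"
    and 0: "\<And>\<phi>. \<phi> \<in> T \<Longrightarrow> (\<integral>x. f x * \<phi> x \<partial>lebesgue_on \<Omega>) = 0"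
  shows "AE x in lebesgue_on \<Omega>. f x = 0"
proof -
  obtain f' where f': "f' \<in> borel_measurable borel" "\<And>x. x \<notin> \<Omega> \<Longrightarrow> f' x = 0"
    "AE x in lebesgue_on \<Omega>. f x = f' x" "integrable lborel f'"
    using borel_representative[OF borel_measurable_integrable[OF f]] f by metis
  note f'(1)[measurable]
  have f'0: "(\<integral>x. f' x * \<phi> x \<partial>lborel) = 0" if "\<phi> \<in> T" for \<phi>
  proof -
    have [measurable]: "\<phi> \<in> borel_measurable borel" by (rule test_function_borel_measurable[OF that])
    have "(\<integral>x. f' x * \<phi> x \<partial>lborel) = (\<integral>x. f' x * \<phi> x \<partial>lebesgue_on \<Omega>)"
      using f'(2) by (intro integral_lborel_eq[symmetric]) auto
    also have "\<dots> = (\<integral>x. f x * \<phi> x \<partial>lebesgue_on \<Omega>)"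
      using f'(3) by (intro integral_cong_AE borel_measurable_times borel_measurable_integrable[OF f]
          borel_imp_lebesgue_on[OF f'(1)] borel_imp_lebesgue_on[of \<phi>]) auto
    finally show ?thesis using 0[OF that] by simp
  qed
  have box0: "(LINT x:box a c|lborel. f' x) = 0" if ac: "cbox a c \<subseteq> \<Omega>" for a c
  proof -
    obtain \<phi> where \<phi>: "\<And>k::nat. \<phi> k \<in> T" "\<And>k x. \<bar>\<phi> k x\<bar> \<le> 1"
      "\<And>x. (\<lambda>k. \<phi> k x) \<longlonglongrightarrow> indicator (box a c) x" using box_indicator_approx[OF ac] by blast
    note [measurable] = test_function_borel_measurable[OF \<phi>(1)]
    have "(\<lambda>k. \<integral>x. f' x * \<phi> k x \<partial>lborel) \<longlonglongrightarrow> (\<integral>x. f' x * indicator (box a c) x \<partial>lborel)"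
    proof (rule integral_dominated_convergence[where w="\<lambda>x. \<bar>f' x\<bar>"])
      show "AE x in lborel. norm (f' x * \<phi> k x) \<le> \<bar>f' x\<bar>" for k
        using mult_left_mono[OF \<phi>(2), of "\<bar>f' _\<bar>"] by (intro AE_I2) (simp add: abs_mult)
      show "AE x in lborel. (\<lambda>k. f' x * \<phi> k x) \<longlonglongrightarrow> f' x * indicator (box a c) x"
        by (intro AE_I2 tendsto_intros \<phi>(3))
    qed (use f'(4) in auto)
    then show ?thesis
      unfolding f'0[OF \<phi>(1)] by (simp add: LIMSEQ_const_iff set_lebesgue_integral_def mult.commute)
  qed
  have "AE x in lebesgue_on \<Omega>. f' x = 0"
  proof (rule AE_lebesgue_on_iff_boxes)
    fix a c assume ac: "cbox a c \<subseteq> \<Omega>"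
    \<comment> \<open>Cut off to the box, the function can be tested with arbitrary boxes: each
      intersection is again a box whose closed version lies in the domain.\<close>
    let ?F = "\<lambda>x. indicator (box a c) x *\<^sub>R f' x"
    have "AE x in lborel. ?F x = 0"
    proof (rule AE_zero_if_box_integrals_zero)
      show "integrable lborel ?F" using f'(4) by (intro integrable_mult_indicator) auto
      fix u v
      define p where "p = (\<Sum>i\<in>Basis. max (a \<bullet> i) (u \<bullet> i) *\<^sub>R i)"
      define q where "q = (\<Sum>i\<in>Basis. min (c \<bullet> i) (v \<bullet> i) *\<^sub>R i)"
      have pq: "box a c \<inter> box u v = box p q" "cbox a c \<inter> cbox u v = cbox p q"
        unfolding box_Int_box Int_interval p_def q_def by simp_all
      have "(LINT x:box u v|lborel. ?F x) = (LINT x:box a c \<inter> box u v|lborel. f' x)"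
        unfolding set_lebesgue_integral_def by (intro Bochner_Integration.integral_cong) (auto simp: indicator_def)
      also have "\<dots> = 0" unfolding pq(1) using ac pq(2) by (intro box0) blast
      finally show "(LINT x:box u v|lborel. ?F x) = 0" .
    qed
    then show "AE x in lborel. x \<in> box a c \<longrightarrow> f' x = 0" by eventually_elim auto
  qed
  with f'(3) show ?thesis by eventually_elim simp
qed

section \<open>Weak derivatives and their representatives\<close>

lemma sq_integrable_integrable: "sq_integrable (lebesgue_on \<Omega>) f \<Longrightarrow> integrable (lebesgue_on \<Omega>) f"
  using integral_abs_le_l2norm(1) emeasure_domain by blast

lemma weak_derivative_AE_unique:
  assumes "sq_integrable (lebesgue_on \<Omega>) g" "sq_integrable (lebesgue_on \<Omega>) h"
    "has_weak_derivative \<Omega> bs u g" "has_weak_derivative \<Omega> bs u h"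
  shows "AE x in lebesgue_on \<Omega>. g x = h x"
proof -
  have i: "integrable (lebesgue_on \<Omega>) g" "integrable (lebesgue_on \<Omega>) h"
    using assms sq_integrable_integrable by auto
  have "AE x in lebesgue_on \<Omega>. g x - h x = 0"
  proof (rule fundamental_lemma)
    fix \<phi> assume "\<phi> \<in> T"
    have "(-1) ^ length bs * (\<integral>x. g x * \<phi> x \<partial>lebesgue_on \<Omega>)
        = (-1) ^ length bs * (\<integral>x. h x * \<phi> x \<partial>lebesgue_on \<Omega>)"
      using bspec[OF assms(3)[unfolded has_weak_derivative_def] \<open>\<phi> \<in> T\<close>]
        bspec[OF assms(4)[unfolded has_weak_derivative_def] \<open>\<phi> \<in> T\<close>] by (rule trans[OF sym])
    then show "(\<integral>x. (g x - h x) * \<phi> x \<partial>lebesgue_on \<Omega>) = 0"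
      using test_function_mult_integrable[OF i(1) \<open>\<phi> \<in> T\<close>] test_function_mult_integrable[OF i(2) \<open>\<phi> \<in> T\<close>]
      by (simp add: left_diff_distrib)
  qed (use i in auto)
  then show ?thesis by eventually_elim simp
qed

lemma weak_derivative_works:
  assumes "v \<in> H2 \<Omega>" "bs \<in> lists Basis" "length bs \<le> 2"
  shows "sq_integrable (lebesgue_on \<Omega>) (weak_derivative \<Omega> bs v)"
    "has_weak_derivative \<Omega> bs v (weak_derivative \<Omega> bs v)"
proof -
  have "\<exists>g. g \<in> L2 \<Omega> \<and> has_weak_derivative \<Omega> bs v g" using assms by (auto simp: H2_def)
  from someI_ex[OF this] show "sq_integrable (lebesgue_on \<Omega>) (weak_derivative \<Omega> bs v)"
    "has_weak_derivative \<Omega> bs v (weak_derivative \<Omega> bs v)"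
    by (auto simp: weak_derivative_def L2_eq)
qed

text \<open>This makes the choice behind \<open>weak_derivative\<close> harmless: any weak
  derivative found explicitly may replace it up to a null set.\<close>

lemma weak_derivative_AE_eq:
  assumes "sq_integrable (lebesgue_on \<Omega>) g" "has_weak_derivative \<Omega> bs v g"
  shows "sq_integrable (lebesgue_on \<Omega>) (weak_derivative \<Omega> bs v)"
    "AE x in lebesgue_on \<Omega>. weak_derivative \<Omega> bs v x = g x"
proof -
  have "\<exists>g. g \<in> L2 \<Omega> \<and> has_weak_derivative \<Omega> bs v g" using assms by (auto simp: L2_eq)
  from someI_ex[OF this] have *: "sq_integrable (lebesgue_on \<Omega>) (weak_derivative \<Omega> bs v)"
    "has_weak_derivative \<Omega> bs v (weak_derivative \<Omega> bs v)"
    by (auto simp: weak_derivative_def L2_eq)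
  show "sq_integrable (lebesgue_on \<Omega>) (weak_derivative \<Omega> bs v)" by fact
  show "AE x in lebesgue_on \<Omega>. weak_derivative \<Omega> bs v x = g x"
    by (rule weak_derivative_AE_unique[OF *(1) assms(1) *(2) assms(2)])
qed

lemma has_weak_derivative_diff:
  assumes sq: "sq_integrable (lebesgue_on \<Omega>) v" "sq_integrable (lebesgue_on \<Omega>) w"
    "sq_integrable (lebesgue_on \<Omega>) g" "sq_integrable (lebesgue_on \<Omega>) h"
    and bs: "bs \<in> lists Basis"
    and wd: "has_weak_derivative \<Omega> bs v g" "has_weak_derivative \<Omega> bs w h"
  shows "has_weak_derivative \<Omega> bs (\<lambda>x. v x - w x) (\<lambda>x. g x - h x)"
  unfolding has_weak_derivative_def
proof
  fix \<phi> assume \<phi>: "\<phi> \<in> T"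
  have i: "integrable (lebesgue_on \<Omega>) (\<lambda>x. f x * \<psi> x)" if "sq_integrable (lebesgue_on \<Omega>) f" "\<psi> \<in> T" for f \<psi>
    using that by (intro test_function_mult_integrable sq_integrable_integrable)
  have p: "partials bs \<phi> \<in> T" using \<phi> bs by (rule test_function_partials)
  show "(\<integral>x. (v x - w x) * partials bs \<phi> x \<partial>lebesgue_on \<Omega>)
      = (-1) ^ length bs * (\<integral>x. (g x - h x) * \<phi> x \<partial>lebesgue_on \<Omega>)"
    using wd \<phi> i[OF sq(1) p] i[OF sq(2) p] i[OF sq(3) \<phi>] i[OF sq(4) \<phi>]
    by (simp add: has_weak_derivative_def left_diff_distrib right_diff_distrib)
qed

text \<open>Shifting derivatives one at a time reverses their order, so the second order case needs
  the symmetry of mixed partials.\<close>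

lemma test_function_weak_derivative:
  assumes "\<phi> \<in> T" "bs \<in> lists Basis" "length bs \<le> 2"
  shows "has_weak_derivative \<Omega> bs \<phi> (partials bs \<phi>)"
  unfolding has_weak_derivative_def
proof
  note [simp del] = partials.simps(2)
  fix \<psi> assume \<psi>: "\<psi> \<in> T"
  have app: "partials [b] (partials bs \<phi>) = partials (b # bs) \<phi>" for b bs and \<phi> :: "'a \<Rightarrow> real"
    using partials_append[of "[b]" bs \<phi>] by simp
  consider "bs = []" | b where "bs = [b]" | b c where "bs = [b, c]"
    using \<open>length bs \<le> 2\<close> by (cases bs; cases "tl bs") (auto split: list.splits)
  then show "(\<integral>x. \<phi> x * partials bs \<psi> x \<partial>lebesgue_on \<Omega>)
      = (-1) ^ length bs * (\<integral>x. partials bs \<phi> x * \<psi> x \<partial>lebesgue_on \<Omega>)"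
  proof cases
    case 1
    then show ?thesis by simp
  next
    case (2 b)
    then show ?thesis using integration_by_parts[OF assms(1) \<psi>, of b] assms(2) by simp
  next
    case (3 b c)
    then have bc: "b \<in> Basis" "c \<in> Basis" using assms(2) by auto
    have "(\<integral>x. \<phi> x * partials [b, c] \<psi> x \<partial>lebesgue_on \<Omega>) = - (\<integral>x. partials [b] \<phi> x * partials [c] \<psi> x \<partial>lebesgue_on \<Omega>)"
      using integration_by_parts[OF assms(1) test_function_partials[OF \<psi>, of "[c]"], of b] bc by (simp add: app)
    also have "\<dots> = (\<integral>x. partials [c, b] \<phi> x * \<psi> x \<partial>lebesgue_on \<Omega>)"
      using integration_by_parts[OF test_function_partials[OF assms(1), of "[b]"] \<psi>, of c] bc by (simp add: app)
    also have "partials [c, b] \<phi> = partials [b, c] \<phi>"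
      by (rule mixed_partials_commute[OF assms(1) bc(2,1)])
    finally show ?thesis using 3 by simp
  qed
qed

lemma test_function_weak_derivative_AE:
  assumes "\<phi> \<in> T" "bs \<in> lists Basis" "length bs \<le> 2"
  shows "AE x in lebesgue_on \<Omega>. weak_derivative \<Omega> bs \<phi> x = partials bs \<phi> x"
  using assms
  by (intro weak_derivative_AE_eq(2) test_function_weak_derivative test_function_sq_integrable test_function_partials)

section \<open>The norm of H^2 and the space H^2_0\<close>

lemma finite_multiindices: "finite {bs \<in> lists (Basis::'a set). length bs \<le> 2}"
  using finite_lists_length_le[OF finite_Basis, of 2] by (simp add: lists_eq_set Collect_conj_eq[symmetric] conj_commute)

lemma weak_derivative_norm_le_norm_H2:
  assumes "bs \<in> lists Basis" "length bs \<le> 2"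
  shows "N (weak_derivative \<Omega> bs v) \<le> norm_H2 \<Omega> v"
proof -
  have "(N (weak_derivative \<Omega> bs v))\<^sup>2 \<le> (norm_H2 \<Omega> v)\<^sup>2"
    unfolding norm_H2_def norm_L2_eq using assms finite_multiindices
    by (simp add: sum_nonneg) (intro member_le_sum[where f="\<lambda>bs. (N (weak_derivative \<Omega> bs v))\<^sup>2"], auto)
  then show ?thesis
    by (rule power2_le_imp_le) (simp add: norm_H2_def sum_nonneg)
qed

lemma norm_H2_nonneg: "0 \<le> norm_H2 \<Omega> v"
  by (simp add: norm_H2_def sum_nonneg)

lemma weak_laplacian_sq_integrable:
  assumes "v \<in> H2 \<Omega>" shows "sq_integrable (lebesgue_on \<Omega>) (weak_laplacian \<Omega> v)"
  unfolding weak_laplacian_def using assms by (intro sq_integrable_sum weak_derivative_works) auto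

lemma weak_laplacian_norm_le:
  assumes "v \<in> H2 \<Omega>" shows "N (weak_laplacian \<Omega> v) \<le> real DIM('a) * norm_H2 \<Omega> v"
proof -
  have "N (weak_laplacian \<Omega> v) \<le> (\<Sum>b\<in>Basis. N (weak_derivative \<Omega> [b, b] v))"
    unfolding weak_laplacian_def using assms by (intro l2norm_sum_le weak_derivative_works) auto
  also have "\<dots> \<le> (\<Sum>b\<in>(Basis::'a set). norm_H2 \<Omega> v)"
    by (intro sum_mono weak_derivative_norm_le_norm_H2) auto
  finally show ?thesis by simp
qed

lemma test_function_weak_laplacian_AE:
  assumes "\<phi> \<in> T" shows "AE x in lebesgue_on \<Omega>. weak_laplacian \<Omega> \<phi> x = laplacian \<phi> x"
proof -
  have "AE x in lebesgue_on \<Omega>. \<forall>b\<in>Basis. weak_derivative \<Omega> [b, b] \<phi> x = partials [b, b] \<phi> x"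
    using assms by (intro AE_finite_allI test_function_weak_derivative_AE) auto
  then show ?thesis by eventually_elim (simp add: weak_laplacian_def laplacian_def)
qed

lemma test_function_H2:
  assumes "\<phi> \<in> T" shows "\<phi> \<in> H2 \<Omega>"
  unfolding H2_def L2_eq using assms
  by (auto intro!: test_function_sq_integrable test_function_weak_derivative test_function_partials
      bexI[of _ "partials _ \<phi>"] simp: L2_eq)

lemma zero_test_function: "(\<lambda>x. 0) \<in> T"
  by (rule smooth_test_functionI[OF smooth.const, of _ "{}"]) auto

lemma test_function_H20:
  assumes "\<phi> \<in> T" shows "\<phi> \<in> H20 \<Omega>"
proof -
  \<comment> \<open>The chosen weak derivative of the zero function is only known to vanish almost
    everywhere, so even its norm needs an argument.\<close>
  have "N (weak_derivative \<Omega> bs (\<lambda>x. 0)) = 0" if "bs \<in> lists Basis" "length bs \<le> 2" for bs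
    using test_function_weak_derivative_AE[OF zero_test_function that]
      weak_derivative_works(1)[OF test_function_H2[OF zero_test_function] that]
    by (subst l2norm_eq_0_iff) auto
  then have "norm_H2 \<Omega> (\<lambda>x. 0) = 0" by (simp add: norm_H2_def norm_L2_eq)
  then show ?thesis
    using assms test_function_H2[OF assms] by (auto simp: H20_def intro!: exI[of _ "\<lambda>k. \<phi>"])
qed

lemma H20_H2: "v \<in> H20 \<Omega> \<Longrightarrow> v \<in> H2 \<Omega>"
  by (simp add: H20_def)

text \<open>\<open>weak_derivative\<close> is additive only almost everywhere. Here convergence of
  the norm of a difference is traded, once and for all, for convergence of each derivative
  separately.\<close>

lemma H20_approx:
  assumes "v \<in> H20 \<Omega>"
  obtains \<phi> where "\<And>k. \<phi> k \<in> T"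
    "\<And>bs. bs \<in> lists Basis \<Longrightarrow> length bs \<le> 2 \<Longrightarrow>
      (\<lambda>k. N (\<lambda>x. weak_derivative \<Omega> bs v x - partials bs (\<phi> k) x)) \<longlonglongrightarrow> 0"
proof -
  obtain \<phi> where \<phi>: "\<And>k. \<phi> k \<in> T" "(\<lambda>k. norm_H2 \<Omega> (\<lambda>x. v x - \<phi> k x)) \<longlonglongrightarrow> 0"
    using assms by (auto simp: H20_def)
  have "(\<lambda>k. N (\<lambda>x. weak_derivative \<Omega> bs v x - partials bs (\<phi> k) x)) \<longlonglongrightarrow> 0"
    if bs: "bs \<in> lists Basis" "length bs \<le> 2" for bs
  proof (rule Lim_null_comparison[OF _ \<phi>(2)], intro always_eventually allI)
    fix k
    note v = H20_H2[OF assms]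
    have vs: "sq_integrable (lebesgue_on \<Omega>) v" using v by (simp add: H2_def L2_eq)
    note p = test_function_partials[OF \<phi>(1)[of k] bs(1)]
    have sq: "sq_integrable (lebesgue_on \<Omega>) (\<lambda>x. weak_derivative \<Omega> bs v x - partials bs (\<phi> k) x)"
      by (intro sq_integrable_diff weak_derivative_works[OF v bs] test_function_sq_integrable p)
    have wd: "has_weak_derivative \<Omega> bs (\<lambda>x. v x - \<phi> k x) (\<lambda>x. weak_derivative \<Omega> bs v x - partials bs (\<phi> k) x)"
      by (intro has_weak_derivative_diff vs test_function_sq_integrable \<phi>(1) p bs
          weak_derivative_works[OF v] test_function_weak_derivative)
    have "N (\<lambda>x. weak_derivative \<Omega> bs v x - partials bs (\<phi> k) x) = N (weak_derivative \<Omega> bs (\<lambda>x. v x - \<phi> k x))"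
      using weak_derivative_AE_eq[OF sq wd] sq
      by (intro l2norm_cong_AE) (auto simp: sq_integrable_def)
    also have "\<dots> \<le> norm_H2 \<Omega> (\<lambda>x. v x - \<phi> k x)" by (rule weak_derivative_norm_le_norm_H2[OF bs])
    finally show "norm (N (\<lambda>x. weak_derivative \<Omega> bs v x - partials bs (\<phi> k) x)) \<le> norm_H2 \<Omega> (\<lambda>x. v x - \<phi> k x)"
      by simp
  qed
  with \<phi>(1) show ?thesis using that by blast
qed

text \<open>The a priori estimate for test functions passes to their limits, so each derivative of
  order at most 2 is controlled by the weak Laplacian.\<close>

lemma norm_H2_le_weak_laplacian:
  obtains C where "C > 0" "\<And>v. v \<in> H20 \<Omega> \<Longrightarrow> norm_H2 \<Omega> v \<le> C * N (weak_laplacian \<Omega> v)"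
proof -
  obtain C where C: "C > 0" "\<And>\<phi> bs. \<phi> \<in> T \<Longrightarrow> bs \<in> lists Basis \<Longrightarrow> length bs \<le> 2 \<Longrightarrow>
      N (partials bs \<phi>) \<le> C * N (laplacian \<phi>)" using partials_norm_le_laplacian by blast
  define m where "m = real (card {bs \<in> lists (Basis::'a set). length bs \<le> 2})"
  have le: "N (weak_derivative \<Omega> bs v) \<le> C * N (weak_laplacian \<Omega> v)"
    if v: "v \<in> H20 \<Omega>" and bs: "bs \<in> lists Basis" "length bs \<le> 2" for v bs
  proof -
    obtain \<phi> where \<phi>: "\<And>k. \<phi> k \<in> T"
      "\<And>bs. bs \<in> lists Basis \<Longrightarrow> length bs \<le> 2 \<Longrightarrow>
        (\<lambda>k. N (\<lambda>x. weak_derivative \<Omega> bs v x - partials bs (\<phi> k) x)) \<longlonglongrightarrow> 0"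
      using H20_approx[OF v] by blast
    note v2 = H20_H2[OF v]
    let ?d = "\<lambda>k bs. N (\<lambda>x. weak_derivative \<Omega> bs v x - partials bs (\<phi> k) x)"
    \<comment> \<open>The bracket collects the two approximation errors, one of the derivative
      itself and one of the Laplacian; both tend to 0.\<close>
    have "N (weak_derivative \<Omega> bs v) \<le> C * N (weak_laplacian \<Omega> v) + (?d k bs + C * (\<Sum>b\<in>Basis. ?d k [b, b]))" for k
    proof -
      have sp: "sq_integrable (lebesgue_on \<Omega>) (partials bs (\<phi> k))" if "bs \<in> lists Basis" for bs
        using that \<phi>(1) by (intro test_function_sq_integrable test_function_partials)
      have "N (weak_derivative \<Omega> bs v) \<le> N (partials bs (\<phi> k)) + ?d k bs"
        by (intro l2norm_le_diff weak_derivative_works v2 bs sp)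
      also have "N (partials bs (\<phi> k)) \<le> C * N (laplacian (\<phi> k))" using \<phi>(1) bs by (rule C(2))
      also have "N (laplacian (\<phi> k)) \<le> N (weak_laplacian \<Omega> v) + N (\<lambda>x. laplacian (\<phi> k) x - weak_laplacian \<Omega> v x)"
        by (intro l2norm_le_diff laplacian_sq_integrable weak_laplacian_sq_integrable v2 \<phi>)
      also have "N (\<lambda>x. laplacian (\<phi> k) x - weak_laplacian \<Omega> v x)
          = N (\<lambda>x. \<Sum>b\<in>Basis. weak_derivative \<Omega> [b, b] v x - partials [b, b] (\<phi> k) x)"
        by (subst l2norm_diff_commute) (simp add: laplacian_def weak_laplacian_def sum_subtractf)
      also have "\<dots> \<le> (\<Sum>b\<in>Basis. ?d k [b, b])"
        by (intro l2norm_sum_le sq_integrable_diff weak_derivative_works v2 sp) auto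
      finally show ?thesis using C(1) by (simp add: algebra_simps del: partials.simps)
    qed
    moreover have "(\<lambda>k. C * N (weak_laplacian \<Omega> v) + (?d k bs + C * (\<Sum>b\<in>Basis. ?d k [b, b])))
        \<longlonglongrightarrow> C * N (weak_laplacian \<Omega> v) + (0 + C * (\<Sum>b\<in>(Basis::'a set). 0))"
      using bs by (intro tendsto_intros \<phi>(2)) auto
    ultimately show ?thesis by (intro LIMSEQ_le_const) auto
  qed
  \<comment> \<open>The square root of the number of multi-indices comes from summing squares; the
    added 1 makes positivity of the constant evident.\<close>
  have "norm_H2 \<Omega> v \<le> (C * sqrt m + 1) * N (weak_laplacian \<Omega> v)" if v: "v \<in> H20 \<Omega>" for v
  proof -
    have "norm_H2 \<Omega> v \<le> sqrt (\<Sum>bs\<in>{bs \<in> lists (Basis::'a set). length bs \<le> 2}. (C * N (weak_laplacian \<Omega> v))\<^sup>2)"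
      unfolding norm_H2_def norm_L2_eq
      by (intro real_sqrt_le_mono sum_mono power_mono le v) auto
    also have "\<dots> = sqrt m * (C * N (weak_laplacian \<Omega> v))"
      using C(1) by (simp add: m_def real_sqrt_mult)
    finally show ?thesis by (simp add: algebra_simps) (smt (verit) l2norm_ge_0)
  qed
  moreover have "C * sqrt m + 1 > 0" using C(1) by (simp add: m_def add_nonneg_pos)
  ultimately show ?thesis using that by blast
qed

section \<open>The operator B and bounded functionals on H^2_0\<close>

lemma opB_le:
  assumes "sq_integrable (lebesgue_on \<Omega>) z" "v \<in> H20 \<Omega>"
  shows "\<bar>opB \<Omega> z v\<bar> \<le> N z * N (weak_laplacian \<Omega> v)"
  unfolding opB_def using Cauchy_Schwarz_l2[OF assms(1) weak_laplacian_sq_integrable[OF H20_H2[OF assms(2)]]]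
  by simp

lemma opB_diff:
  assumes "sq_integrable (lebesgue_on \<Omega>) z" "sq_integrable (lebesgue_on \<Omega>) w" "v \<in> H20 \<Omega>"
  shows "opB \<Omega> (\<lambda>x. z x - w x) v = opB \<Omega> z v - opB \<Omega> w v"
  using l2inner_diff[OF assms(1,2) weak_laplacian_sq_integrable[OF H20_H2[OF assms(3)]]]
  by (simp add: opB_def l2inner_def)

text \<open>A real supremum dominates its members only if they are bounded above, which the assumed
  \<open>M\<close> provides. Where the norm of \<open>v\<close> is 0 the quotient carries no
  information, and the assumption itself gives \<open>l v = 0\<close>.\<close>

lemma norm_Hm2_bound:
  assumes "\<And>v. v \<in> H20 \<Omega> \<Longrightarrow> \<bar>l v\<bar> \<le> M * norm_H2 \<Omega> v" "v \<in> H20 \<Omega>"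
  shows "\<bar>l v\<bar> \<le> norm_Hm2 \<Omega> l * norm_H2 \<Omega> v"
proof (cases "norm_H2 \<Omega> v = 0")
  case True
  then show ?thesis using assms(1)[OF assms(2)] by simp
next
  case False
  then have pos: "norm_H2 \<Omega> v > 0" using norm_H2_nonneg[of v] by simp
  have "\<bar>l v\<bar> / norm_H2 \<Omega> v \<le> norm_Hm2 \<Omega> l"
    unfolding norm_Hm2_def
  proof (rule cSUP_upper[OF assms(2)], rule bdd_aboveI2)
    fix w assume w: "w \<in> H20 \<Omega>"
    show "\<bar>l w\<bar> / norm_H2 \<Omega> w \<le> \<bar>M\<bar>"
    proof (cases "norm_H2 \<Omega> w = 0")
      case False
      then have "norm_H2 \<Omega> w > 0" using norm_H2_nonneg[of w] by simp
      moreover have "\<bar>l w\<bar> \<le> \<bar>M\<bar> * norm_H2 \<Omega> w"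
        using assms(1)[OF w] norm_H2_nonneg[of w] by (smt (verit) mult_right_mono)
      ultimately show ?thesis by (simp add: field_simps)
    qed simp
  qed
  then show ?thesis using pos by (simp add: field_simps)
qed

end

section \<open>Mollifiers and convolution\<close>

lemma radial_frechet_derivative:
  assumes "\<And>t. (p has_real_derivative p' t) (at t)"
  shows "frechet_derivative (\<lambda>x. p ((x - a) \<bullet> (x - a))) (at x) b = p' ((x - a) \<bullet> (x - a)) * (2 * ((x - a) \<bullet> b))"
  by (rule fun_cong[OF frechet_derivative_at[OF radial_has_derivative[OF assms], symmetric]])

text \<open>In the variable s = |x - a|^2 the radial Laplacian has no term singular at the centre,
  so kernels and potentials can be handled through their profiles in \<open>s\<close>.\<close>

lemma laplacian_radial:
  fixes a x :: "'a::euclidean_space"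
  assumes p: "\<And>t. (P has_real_derivative p t) (at t)" "\<And>t. (p has_real_derivative p' t) (at t)"
  shows "laplacian (\<lambda>x. P ((x - a) \<bullet> (x - a))) x
    = 4 * ((x - a) \<bullet> (x - a)) * p' ((x - a) \<bullet> (x - a)) + 2 * real DIM('a) * p ((x - a) \<bullet> (x - a))"
proof -
  let ?s = "(x - a) \<bullet> (x - a)"
  have "partials [b, b] (\<lambda>x. P ((x - a) \<bullet> (x - a))) x = 4 * p' ?s * (((x - a) \<bullet> b) * ((x - a) \<bullet> b)) + 2 * p ?s"
    if b: "b \<in> Basis" for b
  proof -
    have "((\<lambda>x. p ((x - a) \<bullet> (x - a)) * (2 * ((x - a) \<bullet> b))) has_derivative
        (\<lambda>h. p ?s * (2 * (h \<bullet> b)) + p' ?s * (2 * ((x - a) \<bullet> h)) * (2 * ((x - a) \<bullet> b)))) (at x)"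
      by (intro has_derivative_mult radial_has_derivative p) (auto intro!: derivative_eq_intros)
    from fun_cong[OF frechet_derivative_at[OF this, symmetric], of b] show ?thesis
      using b by (simp add: radial_frechet_derivative[OF p(1)])
  qed
  then have "laplacian (\<lambda>x. P ((x - a) \<bullet> (x - a))) x
      = (\<Sum>b\<in>Basis. 4 * p' ?s * (((x - a) \<bullet> b) * ((x - a) \<bullet> b)) + 2 * p ?s)"
    unfolding laplacian_def by (intro sum.cong) auto
  also have "\<dots> = 4 * p' ?s * (\<Sum>b\<in>Basis. ((x - a) \<bullet> b) * ((x - a) \<bullet> b)) + 2 * real DIM('a) * p ?s"
    by (simp add: sum.distrib sum_distrib_left)
  also have "(\<Sum>b\<in>Basis. ((x - a) \<bullet> b) * ((x - a) \<bullet> b)) = ?s"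
    by (rule euclidean_inner[symmetric])
  finally show ?thesis by (simp add: mult_ac)
qed

text \<open>The functions \<open>H\<close> below are the Laplacians of regularised Newton potentials \<open>\<Phi>\<^sub>\<epsilon>\<close> that coincide
  outside the ball of radius \<open>2 \<epsilon>\<close> up to a constant; in terms of \<open>s = |x|\<^sup>2\<close> the potential is
  given by \<open>d\<Phi>\<^sub>\<epsilon>/ds = s powr (-n/2) * S (s/\<epsilon>\<^sup>2)\<close> with a smooth step \<open>S\<close>.  Hence the difference
  of two of them is the Laplacian of a test function.\<close>

lemma newton_potential_difference:
  fixes S e :: "real \<Rightarrow> real" and \<epsilon> \<delta> n :: real
  assumes S: "S \<in> smooth1" "\<And>t. (S has_real_derivative e t) (at t)"
    "\<And>t. t \<le> 1 \<Longrightarrow> S t = 0" "\<And>t. t \<ge> 2 \<Longrightarrow> S t = S 2" "\<And>t. t \<le> 1 \<or> t \<ge> 2 \<Longrightarrow> e t = 0"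
    and pos: "\<epsilon> > 0" "\<delta> > 0"
  defines "H \<equiv> \<lambda>\<epsilon> s. 4 / \<epsilon>\<^sup>2 * (s powr (1 - n / 2) * e (s / \<epsilon>\<^sup>2))"
  shows "\<exists>P p p'. P \<in> smooth1 \<and> (\<forall>t. (P has_real_derivative p t) (at t)) \<and> (\<forall>t. (p has_real_derivative p' t) (at t)) \<and>
    (\<forall>s\<ge>2 * max (\<epsilon>\<^sup>2) (\<delta>\<^sup>2). P s = 0) \<and> (\<forall>s\<ge>0. 4 * s * p' s + 2 * n * p s = H \<epsilon> s - H \<delta> s)"
proof -
  \<comment> \<open>Both steps are 0 for small \<open>s\<close> and equal \<open>S 2\<close> for
    large \<open>s\<close>, so their difference lives in a shell away from the origin.\<close>
  define D where "D s = S (1 / \<epsilon>\<^sup>2 * s + 0) - S (1 / \<delta>\<^sup>2 * s + 0)" for s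
  \<comment> \<open>The derivative with respect to \<open>s\<close> of the difference of the two
    potentials.\<close>
  define p where "p s = s powr (- n / 2) * D s" for s
  have e2: "\<epsilon>\<^sup>2 > 0" "\<delta>\<^sup>2 > 0" using pos by auto
  have D: "D \<in> smooth1" unfolding D_def by (intro smooth1_diff smooth1.affine S)
  have D0: "D s = 0" if "s \<le> min (\<epsilon>\<^sup>2) (\<delta>\<^sup>2)" for s
    using that e2 by (simp add: D_def S(3) divide_le_eq)
  have D1: "D s = 0" if "s \<ge> 2 * max (\<epsilon>\<^sup>2) (\<delta>\<^sup>2)" for s
    using that e2 S(4)[of "s / \<epsilon>\<^sup>2"] S(4)[of "s / \<delta>\<^sup>2"] by (simp add: D_def le_divide_eq)
  have c: "min (\<epsilon>\<^sup>2) (\<delta>\<^sup>2) > 0" using e2 by simp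
  have p: "p \<in> smooth1"
    unfolding p_def using D0 by (intro smooth1.powr[OF D c]) auto
  have p0: "p s = 0" if "s \<le> min (\<epsilon>\<^sup>2) (\<delta>\<^sup>2) \<or> s \<ge> 2 * max (\<epsilon>\<^sup>2) (\<delta>\<^sup>2)" for s
    using that D0 D1 by (auto simp: p_def)
  obtain p' where p': "\<And>t. (p has_real_derivative p' t) (at t)"
    using smooth1_has_derivative[OF p] by blast
  \<comment> \<open>The constant of integration is fixed at the outer radius, so that the potential
    difference has bounded support.\<close>
  obtain P where P: "P \<in> smooth1" "P (2 * max (\<epsilon>\<^sup>2) (\<delta>\<^sup>2)) = 0" "\<And>t. (P has_real_derivative p t) (at t)"
    using smooth1_antiderivative_exists[OF p] by blast
  have "P s = 0" if "s \<ge> 2 * max (\<epsilon>\<^sup>2) (\<delta>\<^sup>2)" for s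
    using zero_deriv_constant_on[OF P(3), of "{2 * max (\<epsilon>\<^sup>2) (\<delta>\<^sup>2)..}" s "2 * max (\<epsilon>\<^sup>2) (\<delta>\<^sup>2)"] that p0 P(2) by auto
  \<comment> \<open>The factor s^(-n/2) solves 4 s p' + 2 n p = 0 for s > 0. Hence only the
    derivative of \<open>D\<close> survives, multiplied by 4 s^(1 - n/2).\<close>
  moreover have "4 * s * p' s + 2 * n * p s = H \<epsilon> s - H \<delta> s" if "s \<ge> 0" for s
  proof (cases "s = 0")
    case True
    then show ?thesis using p0[of 0] e2 by (simp add: H_def S(5))
  next
    case False
    with that have s: "s > 0" by simp
    have "(D has_real_derivative (e (s / \<epsilon>\<^sup>2) / \<epsilon>\<^sup>2 - e (s / \<delta>\<^sup>2) / \<delta>\<^sup>2)) (at s)"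
    proof -
      have "((\<lambda>s. S (1 / r * s + 0)) has_real_derivative e (s / r) / r) (at s)" if "r > 0" for r
        by (rule DERIV_cong[OF DERIV_chain2[OF S(2)]]) (use that in \<open>auto intro!: derivative_eq_intros\<close>)
      then show ?thesis unfolding D_def using e2 by (intro DERIV_diff) auto
    qed
    then have "(p has_real_derivative
        ((- n / 2) * s powr (- n / 2 - 1) * D s + (e (s / \<epsilon>\<^sup>2) / \<epsilon>\<^sup>2 - e (s / \<delta>\<^sup>2) / \<delta>\<^sup>2) * s powr (- n / 2))) (at s)"
      unfolding p_def using s by (auto intro!: derivative_eq_intros)
    then have "p' s = (- n / 2) * s powr (- n / 2 - 1) * D s + (e (s / \<epsilon>\<^sup>2) / \<epsilon>\<^sup>2 - e (s / \<delta>\<^sup>2) / \<delta>\<^sup>2) * s powr (- n / 2)"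
      using DERIV_unique[OF p'] by blast
    then have "s * p' s = (- n / 2) * ((s * s powr (- n / 2 - 1)) * D s)
        + (e (s / \<epsilon>\<^sup>2) / \<epsilon>\<^sup>2 - e (s / \<delta>\<^sup>2) / \<delta>\<^sup>2) * (s * s powr (- n / 2))"
      by (simp only: distrib_left mult.assoc mult.left_commute[of s])
    moreover have "s * s powr (- n / 2 - 1) = s powr (- n / 2)" "s * s powr (- n / 2) = s powr (1 - n / 2)"
      using powr_add[of s 1 "- n / 2 - 1"] powr_add[of s 1 "- n / 2"] s by simp_all
    ultimately have "s * p' s = (- n / 2) * p s + (e (s / \<epsilon>\<^sup>2) / \<epsilon>\<^sup>2 - e (s / \<delta>\<^sup>2) / \<delta>\<^sup>2) * s powr (1 - n / 2)"
      by (simp only: p_def)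
    then show ?thesis by (simp add: H_def algebra_simps)
  qed
  ultimately show ?thesis using P p' by blast
qed

lemma test_function_integrable_lborel:
  assumes "\<phi> \<in> test_functions UNIV" shows "integrable lborel \<phi>"
proof -
  obtain M where M: "\<And>x. \<bar>\<phi> x\<bar> \<le> M" using test_function_bounded[OF assms] by blast
  have K: "compact (closure {x. \<phi> x \<noteq> 0})" using assms by (simp add: test_functions_def)
  show ?thesis
  proof (rule integrableI_bounded_set[where A="closure {x. \<phi> x \<noteq> 0}" and B=M])
    show "emeasure lborel (closure {x. \<phi> x \<noteq> 0}) < \<infinity>"
      using K by (intro emeasure_bounded_finite compact_imp_bounded)
    show "AE x in lborel. x \<notin> closure {x. \<phi> x \<noteq> 0} \<longrightarrow> \<phi> x = 0"
      using closure_subset[of "{x. \<phi> x \<noteq> 0}"] by (intro AE_I2) auto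
    show "\<phi> \<in> borel_measurable lborel" using test_function_borel_measurable[OF assms] by simp
  qed (use M in auto)
qed

lemma integral_partial_eq_0:
  fixes \<phi> :: "'a::euclidean_space \<Rightarrow> real"
  assumes "\<phi> \<in> test_functions UNIV" "b \<in> Basis"
  shows "(\<integral>x. partials [b] \<phi> x \<partial>lborel) = 0"
proof -
  have d: "partials [b] \<phi> \<in> test_functions UNIV" using assms by (intro test_function_partials) auto
  obtain M M' where M: "\<And>x. \<bar>\<phi> x\<bar> \<le> M" "\<And>x. \<bar>partials [b] \<phi> x\<bar> \<le> M'"
    using test_function_bounded[OF assms(1)] test_function_bounded[OF d] by metis
  have "bounded (closure {x. \<phi> x \<noteq> 0})" using assms by (auto simp: test_functions_def compact_imp_bounded)
  then obtain R where R: "\<And>x. x \<in> closure {x. \<phi> x \<noteq> 0} \<Longrightarrow> norm x \<le> R" using bounded_pos by blast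
  show ?thesis
  proof (rule integral_directional_derivative_eq_0[where F=\<phi> and b=b and M="max M M'" and R=R])
    show "((\<lambda>s. \<phi> (x + s *\<^sub>R b)) has_real_derivative partials [b] \<phi> (x + s *\<^sub>R b)) (at s)" for x s
      using has_real_derivative_along_line[OF test_function_differentiable[OF assms(1)]] by simp
    show "\<bar>partials [b] \<phi> x\<bar> \<le> max M M'" "\<bar>\<phi> x\<bar> \<le> max M M'" for x using M[of x] by linarith+
    show "norm x \<le> R" if "\<phi> x \<noteq> 0" for x using R that closure_subset[of "{x. \<phi> x \<noteq> 0}"] by auto
  qed (use assms d in \<open>auto intro: test_function_continuous_on test_function_borel_measurable simp del: partials.simps\<close>)
qed

text \<open>Needed to see that kernels differing by the Laplacian of a test function have the same
  mass.\<close>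

lemma integral_laplacian_eq_0:
  fixes \<phi> :: "'a::euclidean_space \<Rightarrow> real"
  assumes "\<phi> \<in> test_functions UNIV"
  shows "(\<integral>x. laplacian \<phi> x \<partial>lborel) = 0"
proof -
  have "(\<integral>x. laplacian \<phi> x \<partial>lborel) = (\<Sum>b\<in>Basis. \<integral>x. partials [b, b] \<phi> x \<partial>lborel)"
    unfolding laplacian_def using assms
    by (intro Bochner_Integration.integral_sum test_function_integrable_lborel test_function_partials) auto
  also have "\<dots> = (\<Sum>b\<in>(Basis::'a set). 0)"
  proof (intro sum.cong refl)
    fix b :: 'a assume b: "b \<in> Basis"
    have "partials [b, b] \<phi> = partials [b] (partials [b] \<phi>)" by simp
    then show "(\<integral>x. partials [b, b] \<phi> x \<partial>lborel) = 0"
      using integral_partial_eq_0[OF test_function_partials[OF assms], of "[b]" b] b by simp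
  qed
  finally show ?thesis by simp
qed

lemma integral_pos_if_continuous:
  fixes f :: "'a::euclidean_space \<Rightarrow> real"
  assumes "integrable lborel f" "continuous_on UNIV f" "\<And>x. f x \<ge> 0" "f x > 0"
  shows "(\<integral>x. f x \<partial>lborel) > 0"
proof -
  have "(\<integral>x. f x \<partial>lborel) \<noteq> 0"
  proof
    assume "(\<integral>x. f x \<partial>lborel) = 0"
    then have "AE x in lborel. f x = 0"
      using integral_nonneg_eq_0_iff_AE[OF assms(1)] assms(3) by simp
    then have "AE x in lebesgue. f x = 0" by (rule AE_completion)
    then have "negligible {x. f x \<noteq> 0}"
      by (simp add: negligible_iff_null_sets eventually_ae_filter null_sets_completion_subset)
        (metis (no_types, lifting) null_sets_completion_subset)
    moreover have "open {x. f x \<noteq> 0}"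
      using assms(2) by (intro open_Collect_neq) auto
    moreover have "x \<in> {x. f x \<noteq> 0}" using assms(4) by simp
    ultimately show False using open_not_negligible[of "{x. f x \<noteq> 0}"] by blast
  qed
  moreover have "(\<integral>x. f x \<partial>lborel) \<ge> 0" using assms(3) by simp
  ultimately show ?thesis by simp
qed

text \<open>Everything that Weyl's lemma uses about the kernels, with their radial profile hidden.
  The last clause is the decisive one: two kernels with the same centre differ by the Laplacian of a
  smooth function supported in the larger ball. The clause on \<open>laplacian\<close> lets
  derivatives in the centre be read as derivatives in the integration variable.\<close>

definition mollifier_family :: "(real \<Rightarrow> 'a::euclidean_space \<Rightarrow> real) \<Rightarrow> bool" where
  "mollifier_family k \<longleftrightarrow> (\<forall>\<epsilon>>0. k \<epsilon> \<in> test_functions UNIV \<and> (\<forall>z. 0 \<le> k \<epsilon> z) \<and>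
     (\<forall>z. k \<epsilon> z \<noteq> 0 \<longrightarrow> norm z \<le> 2 * \<epsilon>) \<and> (\<integral>z. k \<epsilon> z \<partial>lborel) = 1 \<and> (\<forall>z. k \<epsilon> (- z) = k \<epsilon> z) \<and>
     (\<forall>x. (\<lambda>y. k \<epsilon> (y - x)) \<in> smooth \<and> (\<forall>y. laplacian (\<lambda>y. k \<epsilon> (y - x)) y = laplacian (k \<epsilon>) (x - y))) \<and>
     (\<forall>\<delta>>0. \<forall>x. \<exists>\<psi>\<in>smooth. (\<forall>y. \<psi> y \<noteq> 0 \<longrightarrow> y \<in> cball x (2 * max \<epsilon> \<delta>)) \<and>
        (\<forall>y. laplacian \<psi> y = k \<epsilon> (y - x) - k \<delta> (y - x))))"

text \<open>The sharp radius sqrt 2 * r is relaxed to 2 * r, to keep square roots out of the support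
  conditions.\<close>

lemma norm_le_of_inner_le:
  assumes "x \<bullet> x \<le> 2 * r\<^sup>2" "r > 0" shows "norm x \<le> 2 * r"
proof (rule power2_le_imp_le)
  have "x \<bullet> x \<le> 4 * r\<^sup>2" using assms(1) zero_le_power2[of r] by linarith
  then show "(norm x)\<^sup>2 \<le> (2 * r)\<^sup>2" by (simp add: power2_norm_eq_inner power_mult_distrib)
qed (use assms in simp)

text \<open>The kernels are Laplacians of the regularised Newton potentials, scaled by one common
  constant. A kernel alone is not the Laplacian of a compactly supported function, since its mass is
  positive, but a difference of two kernels is.\<close>

lemma mollifier_family_exists: "\<exists>k :: real \<Rightarrow> 'a::euclidean_space \<Rightarrow> real. mollifier_family k"
proof -
  obtain S e where S: "S \<in> smooth1" "e \<in> smooth1" "\<And>t. (S has_real_derivative e t) (at t)"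
    "\<And>t. t \<le> 1 \<Longrightarrow> S t = 0" "\<And>t. t \<ge> 2 \<Longrightarrow> S t = S 2" "\<And>t. 0 \<le> e t"
    "\<And>t. t \<le> 1 \<or> t \<ge> 2 \<Longrightarrow> e t = 0" "\<And>t. 1 < t \<Longrightarrow> t < 2 \<Longrightarrow> e t > 0"
    by (rule smooth_step_exists) blast
  define n where "n = real DIM('a)"
  \<comment> \<open>For s > 0 this is 4 s^(1 - n/2) times the derivative of S(s/\<epsilon>^2), the
    right-hand side left over in \<open>newton_potential_difference\<close>.\<close>
  define H where "H \<epsilon> s = 4 / \<epsilon>\<^sup>2 * (s powr (1 - n / 2) * e (s / \<epsilon>\<^sup>2))" for \<epsilon> s
  have H: "H \<epsilon> \<in> smooth1" if "\<epsilon> > 0" for \<epsilon>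
  proof -
    have e2: "\<epsilon>\<^sup>2 > 0" using that by simp
    have "(\<lambda>s. s powr (1 - n / 2) * e (1 / \<epsilon>\<^sup>2 * s + 0)) \<in> smooth1"
      using e2 S(7) by (intro smooth1.powr[OF smooth1.affine[OF S(2)] e2]) (auto simp: divide_le_eq)
    from smooth1.mult[OF smooth1.const[of "4 / \<epsilon>\<^sup>2"] this] show ?thesis
      unfolding H_def by simp
  qed
  have Hpos: "H \<epsilon> s \<ge> 0" for \<epsilon> s using S(6) by (simp add: H_def)
  have Hsupp: "s \<le> 2 * \<epsilon>\<^sup>2" if "H \<epsilon> s \<noteq> 0" "\<epsilon> > 0" for \<epsilon> s
    using that S(7)[of "s / \<epsilon>\<^sup>2"] by (cases "s \<ge> 2 * \<epsilon>\<^sup>2") (auto simp: H_def le_divide_eq)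
  define \<eta> where "\<eta> \<epsilon> z = H \<epsilon> (z \<bullet> z)" for \<epsilon> and z :: 'a
  have \<eta>_shift: "(\<lambda>y. \<eta> \<epsilon> (y - x)) \<in> smooth" if "\<epsilon> > 0" for \<epsilon> x
    unfolding \<eta>_def by (rule smooth.radial[OF H[OF that]])
  have \<eta>_smooth: "\<eta> \<epsilon> \<in> smooth" if "\<epsilon> > 0" for \<epsilon> using \<eta>_shift[OF that, of 0] by simp
  have \<eta>_supp: "norm z \<le> 2 * \<epsilon>" if "\<eta> \<epsilon> z \<noteq> 0" "\<epsilon> > 0" for \<epsilon> z
    using Hsupp that by (intro norm_le_of_inner_le) (auto simp: \<eta>_def)
  have \<eta>_test: "\<eta> \<epsilon> \<in> test_functions UNIV" if "\<epsilon> > 0" for \<epsilon>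
    using \<eta>_supp that by (intro smooth_test_functionI[OF \<eta>_smooth, of _ "cball 0 (2 * \<epsilon>)"]) auto
  \<comment> \<open>The factor \<open>c\<close> is carried along because the kernels are normalised
    only afterwards. Evenness of the profile exchanges x - y and y - x.\<close>
  have \<eta>_lap: "laplacian (\<lambda>y. c * \<eta> \<epsilon> (y - x)) y = laplacian (\<lambda>y. c * \<eta> \<epsilon> y) (x - y)" if "\<epsilon> > 0" for \<epsilon> x y c
  proof -
    have "(\<lambda>t. c * H \<epsilon> t) \<in> smooth1" using H[OF that] by (intro smooth1.mult smooth1.const)
    then obtain p where p: "p \<in> smooth1" "\<And>t. ((\<lambda>t. c * H \<epsilon> t) has_real_derivative p t) (at t)"
      using smooth1_has_derivative by blast
    then obtain p' where p': "\<And>t. (p has_real_derivative p' t) (at t)"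
      using smooth1_has_derivative by blast
    have "(y - x) \<bullet> (y - x) = (x - y) \<bullet> (x - y)" by (simp add: algebra_simps inner_commute)
    then show ?thesis
      using laplacian_radial[OF p(2) p', of x y] laplacian_radial[OF p(2) p', of 0 "x - y"] by (simp add: \<eta>_def)
  qed
  have pot: "\<exists>\<psi>\<in>smooth. (\<forall>y. \<psi> y \<noteq> 0 \<longrightarrow> y \<in> cball x (2 * max \<epsilon> \<delta>)) \<and> (\<forall>y. laplacian \<psi> y = c * \<eta> \<epsilon> (y - x) - c * \<eta> \<delta> (y - x))"
    if pos: "\<epsilon> > 0" "\<delta> > 0" for \<epsilon> \<delta> c and x :: 'a
  proof -
    obtain P p p' where P: "P \<in> smooth1" "\<And>t. (P has_real_derivative p t) (at t)" "\<And>t. (p has_real_derivative p' t) (at t)"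
      "\<And>s. s \<ge> 2 * max (\<epsilon>\<^sup>2) (\<delta>\<^sup>2) \<Longrightarrow> P s = 0" "\<And>s. s \<ge> 0 \<Longrightarrow> 4 * s * p' s + 2 * n * p s = H \<epsilon> s - H \<delta> s"
      using newton_potential_difference[OF S(1,3,4,5,7) pos, of n, folded H_def] by blast
    have cP: "((\<lambda>t. c * P t) has_real_derivative c * p t) (at t)" "((\<lambda>t. c * p t) has_real_derivative c * p' t) (at t)" for t
      using P(2,3) by (auto intro!: derivative_eq_intros)
    define \<psi> where "\<psi> y = c * P ((y - x) \<bullet> (y - x))" for y
    have "\<psi> \<in> smooth" unfolding \<psi>_def by (intro smooth.mult smooth.const smooth.radial P)
    moreover have "y \<in> cball x (2 * max \<epsilon> \<delta>)" if "\<psi> y \<noteq> 0" for y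
    proof -
      have m: "max (\<epsilon>\<^sup>2) (\<delta>\<^sup>2) = (max \<epsilon> \<delta>)\<^sup>2"
        using pos by (auto simp: max_def power2_le_iff_abs_le)
      have "(y - x) \<bullet> (y - x) \<le> 2 * max (\<epsilon>\<^sup>2) (\<delta>\<^sup>2)"
        using that P(4)[of "(y - x) \<bullet> (y - x)"] unfolding \<psi>_def by (metis linear mult_zero_right)
      then have "norm (y - x) \<le> 2 * max \<epsilon> \<delta>" unfolding m using pos by (intro norm_le_of_inner_le) auto
      then show ?thesis by (simp add: dist_norm norm_minus_commute)
    qed
    moreover have "laplacian \<psi> y = c * \<eta> \<epsilon> (y - x) - c * \<eta> \<delta> (y - x)" for y
    proof -
      let ?s = "(y - x) \<bullet> (y - x)"
      have "laplacian \<psi> y = c * (4 * ?s * p' ?s + 2 * n * p ?s)"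
        unfolding \<psi>_def using laplacian_radial[OF cP, of x y] by (simp add: n_def algebra_simps)
      also have "\<dots> = c * (H \<epsilon> ?s - H \<delta> ?s)" by (subst P(5)) auto
      finally show ?thesis by (simp add: \<eta>_def right_diff_distrib)
    qed
    ultimately show ?thesis by blast
  qed
  \<comment> \<open>The mass at radius 1; it is the mass at every radius, since the difference
    integrates to 0 as a Laplacian.\<close>
  define \<kappa> where "\<kappa> = (\<integral>z. \<eta> 1 z \<partial>lborel)"
  have \<kappa>_eq: "(\<integral>z. \<eta> \<epsilon> z \<partial>lborel) = \<kappa>" if \<epsilon>: "\<epsilon> > 0" for \<epsilon>
  proof -
    obtain \<psi> where \<psi>: "\<psi> \<in> smooth" "\<And>y. \<psi> y \<noteq> 0 \<Longrightarrow> y \<in> cball 0 (2 * max \<epsilon> 1)"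
      "\<And>y. laplacian \<psi> y = 1 * \<eta> \<epsilon> (y - 0) - 1 * \<eta> 1 (y - 0)"
      using pot[OF \<epsilon> zero_less_one, of 0 1] by blast
    have "\<psi> \<in> test_functions UNIV" using \<psi>(2) by (intro smooth_test_functionI[OF \<psi>(1), of "cball 0 (2 * max \<epsilon> 1)"]) auto
    from integral_laplacian_eq_0[OF this] show ?thesis
      using test_function_integrable_lborel[OF \<eta>_test] that by (simp add: \<psi>(3) \<kappa>_def)
  qed
  have "\<kappa> > 0"
  proof -
    obtain b :: 'a where b: "b \<in> Basis" using nonempty_Basis by blast
    \<comment> \<open>This point has squared norm 3/2, inside the shell 1 < s < 2 where
      \<open>e\<close> is positive.\<close>
    have "\<eta> 1 (sqrt (3/2) *\<^sub>R b) > 0" using b S(8)[of "3/2"] by (simp add: \<eta>_def H_def)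
    then show ?thesis
      unfolding \<kappa>_def using test_function_integrable_lborel[OF \<eta>_test] smooth_continuous_on[OF \<eta>_smooth] Hpos
      by (intro integral_pos_if_continuous[where x="sqrt (3/2) *\<^sub>R b"]) (simp_all, simp add: \<eta>_def)
  qed
  define k where "k \<epsilon> z = 1 / \<kappa> * \<eta> \<epsilon> z" for \<epsilon> z
  have "mollifier_family k"
    unfolding mollifier_family_def
  proof (intro allI impI conjI)
    fix \<epsilon> :: real assume \<epsilon>: "\<epsilon> > 0"
    have sm: "(\<lambda>y. k \<epsilon> (y - x)) \<in> smooth" for x
      unfolding k_def using \<eta>_shift[OF \<epsilon>] by (intro smooth.mult smooth.const)
    show "(\<lambda>y. k \<epsilon> (y - x)) \<in> smooth" for x by (rule sm)
    show supp: "norm z \<le> 2 * \<epsilon>" if "k \<epsilon> z \<noteq> 0" for z using that \<eta>_supp \<epsilon> by (auto simp: k_def)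
    show "k \<epsilon> \<in> test_functions UNIV"
      using sm[of 0] supp by (intro smooth_test_functionI[of _ "cball 0 (2 * \<epsilon>)"]) auto
    show "0 \<le> k \<epsilon> z" for z using Hpos \<open>\<kappa> > 0\<close> by (simp add: k_def \<eta>_def)
    show "(\<integral>z. k \<epsilon> z \<partial>lborel) = 1" using \<kappa>_eq[OF \<epsilon>] \<open>\<kappa> > 0\<close> by (simp add: k_def)
    show "k \<epsilon> (- z) = k \<epsilon> z" for z by (simp add: k_def \<eta>_def)
    show "laplacian (\<lambda>y. k \<epsilon> (y - x)) y = laplacian (k \<epsilon>) (x - y)" for x y
      using \<eta>_lap[OF \<epsilon>, of "1 / \<kappa>" x y] by (simp add: k_def[abs_def])
    show "\<exists>\<psi>\<in>smooth. (\<forall>y. \<psi> y \<noteq> 0 \<longrightarrow> y \<in> cball x (2 * max \<epsilon> \<delta>)) \<and> (\<forall>y. laplacian \<psi> y = k \<epsilon> (y - x) - k \<delta> (y - x))"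
      if "\<delta> > 0" for \<delta> x using pot[OF \<epsilon> that, of x "1 / \<kappa>"] by (simp only: k_def)
  qed
  then show ?thesis by blast
qed

section \<open>Convolution with test functions\<close>

definition convolution :: "('a::euclidean_space \<Rightarrow> real) \<Rightarrow> ('a \<Rightarrow> real) \<Rightarrow> 'a \<Rightarrow> real" where
  "convolution f k x = (\<integral>y. f y * k (x - y) \<partial>lborel)"

lemma frechet_derivative_test_function:
  fixes \<psi> :: "'a::euclidean_space \<Rightarrow> real"
  assumes "\<psi> \<in> test_functions \<Omega>"
  shows "frechet_derivative \<psi> (at z) d = (\<Sum>b\<in>Basis. (d \<bullet> b) * partials [b] \<psi> z)"
proof -
  have l: "linear (frechet_derivative \<psi> (at z))"
    using test_function_differentiable[OF assms] by (rule linear_frechet_derivative)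
  have "frechet_derivative \<psi> (at z) d = frechet_derivative \<psi> (at z) (\<Sum>b\<in>Basis. (d \<bullet> b) *\<^sub>R b)"
    by (simp add: euclidean_representation)
  also have "\<dots> = (\<Sum>b\<in>Basis. (d \<bullet> b) * partials [b] \<psi> z)"
    using l by (simp add: linear_sum linear_cmul)
  finally show ?thesis .
qed

lemma test_function_mean_value:
  fixes \<psi> :: "'a::euclidean_space \<Rightarrow> real"
  assumes "\<psi> \<in> test_functions \<Omega>"
  shows "\<exists>\<xi>. 0 < \<xi> \<and> \<xi> < 1 \<and> \<psi> (z + d) - \<psi> z = (\<Sum>b\<in>Basis. (d \<bullet> b) * partials [b] \<psi> (z + \<xi> *\<^sub>R d))"
proof -
  have "((\<lambda>s. \<psi> (z + s *\<^sub>R d)) has_real_derivative frechet_derivative \<psi> (at (z + s *\<^sub>R d)) d) (at s)" for s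
    by (intro has_real_derivative_along_line test_function_differentiable[OF assms])
  from MVT2[OF zero_less_one this] show ?thesis
    unfolding frechet_derivative_test_function[OF assms] by force
qed

lemma test_function_lipschitz:
  fixes \<psi> :: "'a::euclidean_space \<Rightarrow> real"
  assumes "\<psi> \<in> test_functions \<Omega>"
  obtains L where "L \<ge> 0" "\<And>z d. \<bar>\<psi> (z + d) - \<psi> z\<bar> \<le> L * norm d"
proof -
  have "\<exists>M. \<forall>b\<in>Basis. M b > 0 \<and> (\<forall>x. \<bar>partials [b] \<psi> x\<bar> \<le> M b)"
    using test_function_bounded[OF test_function_partials[OF assms]] by (intro bchoice) (metis lists.Cons lists.Nil)
  then obtain M where M: "\<And>b. b \<in> Basis \<Longrightarrow> M b > 0" "\<And>b x. b \<in> Basis \<Longrightarrow> \<bar>partials [b] \<psi> x\<bar> \<le> M b" by blast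
  define L where "L = (\<Sum>b\<in>Basis. M b)"
  have "\<bar>\<psi> (z + d) - \<psi> z\<bar> \<le> L * norm d" for z d
  proof -
    obtain \<xi> where "\<psi> (z + d) - \<psi> z = (\<Sum>b\<in>Basis. (d \<bullet> b) * partials [b] \<psi> (z + \<xi> *\<^sub>R d))"
      using test_function_mean_value[OF assms] by blast
    also have "\<bar>\<dots>\<bar> \<le> (\<Sum>b\<in>Basis. \<bar>d \<bullet> b\<bar> * \<bar>partials [b] \<psi> (z + \<xi> *\<^sub>R d)\<bar>)"
      by (rule order_trans[OF sum_abs]) (simp add: abs_mult del: partials.simps)
    also have "\<dots> \<le> (\<Sum>b\<in>Basis. norm d * M b)"
      using M by (intro sum_mono mult_mono Basis_le_norm) auto
    finally show ?thesis by (simp add: L_def sum_distrib_left mult.commute)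
  qed
  moreover have "L \<ge> 0" unfolding L_def using M(1) by (intro sum_nonneg) (auto intro: less_imp_le)
  ultimately show ?thesis using that by blast
qed

text \<open>The partial derivatives are Lipschitz, so the remainder is quadratic with a constant
  independent of \<open>z\<close>. This uniformity allows integrating it against an arbitrary
  integrable function.\<close>

lemma test_function_taylor:
  fixes \<psi> :: "'a::euclidean_space \<Rightarrow> real"
  assumes "\<psi> \<in> test_functions \<Omega>"
  obtains C where "C \<ge> 0"
    "\<And>z d. \<bar>\<psi> (z + d) - \<psi> z - (\<Sum>b\<in>Basis. (d \<bullet> b) * partials [b] \<psi> z)\<bar> \<le> C * norm d * norm d"
proof -
  have "\<exists>L. \<forall>b\<in>Basis. L b \<ge> 0 \<and> (\<forall>z d. \<bar>partials [b] \<psi> (z + d) - partials [b] \<psi> z\<bar> \<le> L b * norm d)"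
    using test_function_lipschitz[OF test_function_partials[OF assms]] by (intro bchoice) (metis lists.Cons lists.Nil)
  then obtain L where L: "\<And>b. b \<in> Basis \<Longrightarrow> L b \<ge> 0"
    "\<And>b z d. b \<in> Basis \<Longrightarrow> \<bar>partials [b] \<psi> (z + d) - partials [b] \<psi> z\<bar> \<le> L b * norm d" by blast
  define C where "C = (\<Sum>b\<in>Basis. L b)"
  have "\<bar>\<psi> (z + d) - \<psi> z - (\<Sum>b\<in>Basis. (d \<bullet> b) * partials [b] \<psi> z)\<bar> \<le> C * norm d * norm d" for z d
  proof -
    obtain \<xi> where \<xi>: "0 < \<xi>" "\<xi> < 1" "\<psi> (z + d) - \<psi> z = (\<Sum>b\<in>Basis. (d \<bullet> b) * partials [b] \<psi> (z + \<xi> *\<^sub>R d))"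
      using test_function_mean_value[OF assms] by blast
    have "\<psi> (z + d) - \<psi> z - (\<Sum>b\<in>Basis. (d \<bullet> b) * partials [b] \<psi> z)
        = (\<Sum>b\<in>Basis. (d \<bullet> b) * (partials [b] \<psi> (z + \<xi> *\<^sub>R d) - partials [b] \<psi> z))"
      unfolding \<xi>(3) by (simp add: sum_subtractf right_diff_distrib del: partials.simps)
    also have "\<bar>\<dots>\<bar> \<le> (\<Sum>b\<in>Basis. \<bar>d \<bullet> b\<bar> * \<bar>partials [b] \<psi> (z + \<xi> *\<^sub>R d) - partials [b] \<psi> z\<bar>)"
      by (rule order_trans[OF sum_abs]) (simp add: abs_mult del: partials.simps)
    also have "\<dots> \<le> (\<Sum>b\<in>Basis. norm d * (L b * norm d))"
    proof (intro sum_mono mult_mono Basis_le_norm)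
      fix b :: 'a assume b: "b \<in> Basis"
      have "\<bar>partials [b] \<psi> (z + \<xi> *\<^sub>R d) - partials [b] \<psi> z\<bar> \<le> L b * norm (\<xi> *\<^sub>R d)" by (rule L(2)[OF b])
      also have "\<dots> \<le> L b * norm d"
        using \<xi> L(1)[OF b] by (intro mult_left_mono) (auto simp: mult_left_le_one_le)
      finally show "\<bar>partials [b] \<psi> (z + \<xi> *\<^sub>R d) - partials [b] \<psi> z\<bar> \<le> L b * norm d" .
    qed auto
    finally show ?thesis by (simp add: C_def sum_distrib_left sum_distrib_right mult_ac)
  qed
  moreover have "C \<ge> 0" unfolding C_def using L(1) by (intro sum_nonneg)
  ultimately show ?thesis using that by blast
qed

lemma convolution_integrable:
  assumes "integrable lborel f" "k \<in> test_functions \<Omega>"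
  shows "integrable lborel (\<lambda>y. f y * k (x - y))"
proof -
  obtain M where M: "\<And>x. \<bar>k x\<bar> \<le> M" using test_function_bounded[OF assms(2)] by blast
  note [measurable] = test_function_borel_measurable[OF assms(2)] borel_measurable_integrable[OF assms(1)]
  have "norm (f y * k (x - y)) \<le> norm (M * f y)" for y
    using mult_right_mono[OF order_trans[OF M abs_ge_self], of "\<bar>f y\<bar>" "x - y"] by (simp add: abs_mult mult.commute)
  then show ?thesis
    by (intro Bochner_Integration.integrable_bound[OF integrable_mult_right[OF assms(1), of M]] AE_I2) auto
qed

text \<open>Integrating the uniform Taylor remainder of the kernel against |f| bounds the error by
  \<open>A * C\<close> times the square of the increment; all smoothness comes from the
  kernel.\<close>

lemma convolution_has_derivative:
  fixes f k :: "'a::euclidean_space \<Rightarrow> real"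
  assumes f: "integrable lborel f" and k: "k \<in> test_functions \<Omega>"
  shows "(convolution f k has_derivative (\<lambda>d. \<Sum>b\<in>Basis. (d \<bullet> b) * convolution f (partials [b] k) x)) (at x)"
proof -
  note [simp del] = partials.simps
  obtain C where C: "C \<ge> 0"
    "\<And>z d. \<bar>k (z + d) - k z - (\<Sum>b\<in>Basis. (d \<bullet> b) * partials [b] k z)\<bar> \<le> C * norm d * norm d"
    using test_function_taylor[OF k] by blast
  have pk: "partials [b] k \<in> test_functions \<Omega>" if "b \<in> Basis" for b
    using that by (intro test_function_partials[OF k]) auto
  define A where "A = (\<integral>y. \<bar>f y\<bar> \<partial>lborel)"
  show ?thesis
  proof (rule has_derivativeI_sandwich[where e=1 and H="\<lambda>y. A * C * norm (y - x)"])
    show "bounded_linear (\<lambda>d. \<Sum>b\<in>Basis. (d \<bullet> b) * convolution f (partials [b] k) x)"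
      by (intro bounded_linear_sum bounded_linear_mult_const bounded_linear_inner_left)
    show "((\<lambda>y. A * C * norm (y - x)) \<longlongrightarrow> 0) (at x)"
      by (auto intro!: tendsto_eq_intros)
    fix w assume "w \<noteq> x"
    define d where "d = w - x"
    have d: "norm d > 0" using \<open>w \<noteq> x\<close> by (simp add: d_def)
    define r where "r y = k (x - y + d) - k (x - y) - (\<Sum>b\<in>Basis. (d \<bullet> b) * partials [b] k (x - y))" for y
    have w: "w - y = x - y + d" for y by (simp add: d_def)
    have i: "integrable lborel (\<lambda>y. f y * k (x - y + d))" "integrable lborel (\<lambda>y. f y * k (x - y))"
      "\<And>b. b \<in> Basis \<Longrightarrow> integrable lborel (\<lambda>y. f y * partials [b] k (x - y))"
      using convolution_integrable[OF f k, of w] convolution_integrable[OF f k, of x] convolution_integrable[OF f pk]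
      by (simp_all add: w)
    have "convolution f k w - convolution f k x - (\<Sum>b\<in>Basis. ((w - x) \<bullet> b) * convolution f (partials [b] k) x)
        = (\<integral>y. f y * k (x - y + d) - f y * k (x - y) - (\<Sum>b\<in>Basis. (d \<bullet> b) * (f y * partials [b] k (x - y))) \<partial>lborel)"
      unfolding convolution_def w d_def[symmetric] using i
      by (simp add: Bochner_Integration.integral_sum)
    also have "\<dots> = (\<integral>y. f y * r y \<partial>lborel)"
      by (intro Bochner_Integration.integral_cong refl) (simp add: r_def right_diff_distrib sum_distrib_left mult_ac)
    finally have eq: "convolution f k w - convolution f k x - (\<Sum>b\<in>Basis. ((w - x) \<bullet> b) * convolution f (partials [b] k) x)
        = (\<integral>y. f y * r y \<partial>lborel)" .
    have "\<bar>\<integral>y. f y * r y \<partial>lborel\<bar> \<le> (\<integral>y. \<bar>f y\<bar> * (C * norm d * norm d) \<partial>lborel)"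
    proof (rule order_trans[OF integral_abs_bound], rule integral_mono_AE')
      show "integrable lborel (\<lambda>y. \<bar>f y\<bar> * (C * norm d * norm d))" using f by auto
      show "AE y in lborel. \<bar>f y * r y\<bar> \<le> \<bar>f y\<bar> * (C * norm d * norm d)"
        unfolding r_def abs_mult by (intro AE_I2 mult_left_mono C(2)) auto
    qed (use C(1) in auto)
    also have "\<dots> = A * C * norm d * norm d" by (simp add: A_def)
    finally have "\<bar>\<integral>y. f y * r y \<partial>lborel\<bar> / norm d \<le> A * C * norm d" using d by (simp add: divide_le_eq)
    then show "norm (convolution f k w - convolution f k x - (\<Sum>b\<in>Basis. ((w - x) \<bullet> b) * convolution f (partials [b] k) x)) / norm (w - x)
        \<le> A * C * norm (w - x)" unfolding eq by (simp add: d_def)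
  qed simp
qed

lemma convolution_partials:
  fixes f k :: "'a::euclidean_space \<Rightarrow> real"
  assumes f: "integrable lborel f" and k: "k \<in> test_functions \<Omega>" and "bs \<in> lists Basis"
  shows "partials bs (convolution f k) = convolution f (partials bs k)"
  using assms(3)
proof (induction bs)
  case (Cons b bs)
  then have b: "b \<in> Basis" "bs \<in> lists Basis" by auto
  have p: "partials bs k \<in> test_functions \<Omega>" by (rule test_function_partials[OF k b(2)])
  show ?case
  proof
    fix x
    have "partials (b # bs) (convolution f k) x = frechet_derivative (convolution f (partials bs k)) (at x) b"
      using Cons b by simp
    also have "\<dots> = (\<Sum>c\<in>Basis. (b \<bullet> c) * convolution f (partials [c] (partials bs k)) x)"
      by (rule fun_cong[OF frechet_derivative_at[OF convolution_has_derivative[OF f p, of x], symmetric]])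
    also have "\<dots> = (\<Sum>c\<in>Basis. if c = b then convolution f (partials [b] (partials bs k)) x else 0)"
      using b by (intro sum.cong refl) (auto simp: inner_Basis)
    also have "\<dots> = convolution f (partials (b # bs) k) x" using b by simp
    finally show "partials (b # bs) (convolution f k) x = convolution f (partials (b # bs) k) x" .
  qed
qed simp

lemma convolution_partials_differentiable:
  assumes "integrable lborel f" "k \<in> test_functions \<Omega>" "bs \<in> lists Basis"
  shows "partials bs (convolution f k) differentiable (at x)"
  unfolding convolution_partials[OF assms]
  using convolution_has_derivative[OF assms(1) test_function_partials[OF assms(2,3)]]
  unfolding differentiable_def by blast

section \<open>Weakly harmonic functions\<close>

text \<open>The function of Weyl's lemma agrees near each point with a mollification whose radius
  depends on the point, so harmonicity has to be verified through local representatives.\<close>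

lemma harmonic_on_local:
  assumes "\<And>x. x \<in> S \<Longrightarrow> \<exists>U g. open U \<and> x \<in> U \<and> (\<forall>y\<in>U. h y = g y) \<and>
      (\<forall>bs\<in>lists Basis. partials bs g differentiable (at x)) \<and> laplacian g x = 0"
  shows "harmonic_on S h"
proof -
  have d: "partials bs h differentiable (at x)" if x: "x \<in> S" and bs: "bs \<in> lists Basis" for x bs
  proof -
    obtain U g where U: "open U" "x \<in> U" "\<forall>y\<in>U. h y = g y" "partials bs g differentiable (at x)"
      using assms[OF x] bs by blast
    obtain D where "(partials bs g has_derivative D) (at x)" using U(4) by (auto simp: differentiable_def)
    moreover have "partials bs g y = partials bs h y" if "y \<in> U" for y
      using partials_cong_open[OF U(1) _ that] U(3) by metis
    ultimately have "(partials bs h has_derivative D) (at x)"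
      using has_derivative_transform_within_open U(1,2) by blast
    then show ?thesis by (auto simp: differentiable_def)
  qed
  have "Ck_on 2 S h"
    unfolding Ck_on_def
    using d by (auto intro!: continuous_at_imp_continuous_on differentiable_imp_continuous_within)
  moreover have "(\<Sum>b\<in>Basis. partials [b, b] h x) = 0" if x: "x \<in> S" for x
  proof -
    obtain U g where U: "open U" "x \<in> U" "\<forall>y\<in>U. h y = g y" "laplacian g x = 0"
      using assms[OF x] by blast
    have "partials bs h x = partials bs g x" for bs
      using partials_cong_open[OF U(1) _ U(2)] U(3) by metis
    then show ?thesis using U(4) by (simp add: laplacian_def del: partials.simps)
  qed
  ultimately show ?thesis by (simp add: harmonic_on_def)
qed

text \<open>Fubini's theorem moves the kernel from \<open>f\<close> to \<phi>; the integrand is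
  dominated by a multiple of the product of |f| and |\<phi>|.\<close>

lemma convolution_adjoint:
  fixes f k \<phi> :: "'a::euclidean_space \<Rightarrow> real"
  assumes f: "integrable lborel f" and k: "k \<in> test_functions UNIV" and \<phi>: "\<phi> \<in> test_functions UNIV"
  shows "(\<integral>x. convolution f k x * \<phi> x \<partial>lborel) = (\<integral>y. f y * (\<integral>x. k (x - y) * \<phi> x \<partial>lborel) \<partial>lborel)"
proof -
  note [measurable] = test_function_borel_measurable[OF k] test_function_borel_measurable[OF \<phi>]
    borel_measurable_integrable[OF f]
  obtain M where M: "\<And>x. \<bar>k x\<bar> \<le> M" using test_function_bounded[OF k] by blast
  have i\<phi>: "integrable lborel \<phi>" by (rule test_function_integrable_lborel[OF \<phi>])
  have prod: "integrable (lborel \<Otimes>\<^sub>M lborel) (\<lambda>(x, y). \<phi> x * f y)"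
  proof (rule lborel_pair.Fubini_integrable)
    show "integrable lborel (\<lambda>x. LINT y|lborel. norm (case (x, y) of (x, y) \<Rightarrow> \<phi> x * f y))"
      using i\<phi> by (simp add: abs_mult)
    show "AE x in lborel. integrable lborel (\<lambda>y. case (x, y) of (x, y) \<Rightarrow> \<phi> x * f y)"
      using f by simp
  qed measurable
  have int: "integrable (lborel \<Otimes>\<^sub>M lborel) (\<lambda>(x, y). f y * k (x - y) * \<phi> x)"
  proof (rule Bochner_Integration.integrable_bound[OF integrable_mult_right[OF prod, of M]])
    have "norm (f y * k (x - y) * \<phi> x) \<le> norm (M * (\<phi> x * f y))" for x y
      using mult_right_mono[OF order_trans[OF M abs_ge_self], of "\<bar>f y\<bar> * \<bar>\<phi> x\<bar>" "x - y"]
      by (simp add: abs_mult mult_ac)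
    then show "AE z in lborel \<Otimes>\<^sub>M lborel. norm (case z of (x, y) \<Rightarrow> f y * k (x - y) * \<phi> x)
        \<le> norm (M * (case z of (x, y) \<Rightarrow> \<phi> x * f y))"
      by (intro AE_I2) (auto split: prod.split)
  qed measurable
  have "(\<integral>x. convolution f k x * \<phi> x \<partial>lborel) = (\<integral>x. (\<integral>y. f y * k (x - y) * \<phi> x \<partial>lborel) \<partial>lborel)"
    by (simp add: convolution_def)
  also have "\<dots> = (\<integral>y. (\<integral>x. f y * k (x - y) * \<phi> x \<partial>lborel) \<partial>lborel)"
    by (rule lborel_pair.Fubini_integral[OF int, symmetric])
  finally show ?thesis by (simp add: mult.assoc)
qed

lemma integral_lborel_shift:
  fixes k :: "'a::euclidean_space \<Rightarrow> real"
  assumes "k \<in> borel_measurable borel"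
  shows "(\<integral>x. k (x - y) \<partial>lborel) = (\<integral>x. k x \<partial>lborel)"
proof -
  have "(\<integral>x. k x \<partial>lborel) = (\<integral>x. k x \<partial>distr lborel borel ((+) (- y)))"
    by (simp add: lborel_distr_plus)
  also have "\<dots> = (\<integral>x. k (- y + x) \<partial>lborel)" using assms by (subst integral_distr) auto
  finally show ?thesis by simp
qed

lemma integrable_lborel_shift:
  fixes k :: "'a::euclidean_space \<Rightarrow> real"
  assumes "integrable lborel k"
  shows "integrable lborel (\<lambda>x. k (x - y))"
proof -
  have "integrable (distr lborel borel ((+) (- y))) k" using assms by (simp add: lborel_distr_plus)
  then have "integrable lborel (\<lambda>x. k (- y + x))"
    using assms by (subst (asm) integrable_distr_eq) auto
  then show ?thesis by simp
qed

text \<open>The kernel has mass 1 and radius at most 2 * \<epsilon>, and over this distance \<phi>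
  varies by at most \<open>L * (2 * \<epsilon>)\<close>.\<close>

lemma mollifier_approx:
  fixes k :: "real \<Rightarrow> 'a::euclidean_space \<Rightarrow> real"
  assumes k: "mollifier_family k" and \<phi>: "\<phi> \<in> test_functions UNIV" and "\<epsilon> > 0"
    and L: "\<And>z d. \<bar>\<phi> (z + d) - \<phi> z\<bar> \<le> L * norm d" "L \<ge> 0"
  shows "\<bar>(\<integral>x. k \<epsilon> (x - y) * \<phi> x \<partial>lborel) - \<phi> y\<bar> \<le> L * (2 * \<epsilon>)"
proof -
  have k\<epsilon>: "k \<epsilon> \<in> test_functions UNIV" "\<And>z. 0 \<le> k \<epsilon> z" "\<And>z. k \<epsilon> z \<noteq> 0 \<Longrightarrow> norm z \<le> 2 * \<epsilon>"
    "(\<integral>z. k \<epsilon> z \<partial>lborel) = 1"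
    using k \<open>\<epsilon> > 0\<close> unfolding mollifier_family_def by blast+
  note [measurable] = test_function_borel_measurable[OF k\<epsilon>(1)] test_function_borel_measurable[OF \<phi>]
  have ik: "integrable lborel (\<lambda>x. k \<epsilon> (x - y))"
    by (intro integrable_lborel_shift test_function_integrable_lborel k\<epsilon>)
  have one: "(\<integral>x. k \<epsilon> (x - y) \<partial>lborel) = 1"
    using k\<epsilon>(4) by (subst integral_lborel_shift) auto
  obtain M where M: "\<And>x. \<bar>\<phi> x\<bar> \<le> M" using test_function_bounded[OF \<phi>] by blast
  have ik\<phi>: "integrable lborel (\<lambda>x. k \<epsilon> (x - y) * \<phi> x)"
  proof (rule Bochner_Integration.integrable_bound[OF integrable_mult_right[OF ik, of M]])
    have "norm (k \<epsilon> (x - y) * \<phi> x) \<le> norm (M * k \<epsilon> (x - y))" for x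
      using mult_right_mono[OF order_trans[OF M abs_ge_self], of "\<bar>k \<epsilon> (x - y)\<bar>" x]
      by (simp add: abs_mult mult_ac)
    then show "AE x in lborel. norm (k \<epsilon> (x - y) * \<phi> x) \<le> norm (M * k \<epsilon> (x - y))" by (rule AE_I2)
  qed measurable
  have "(\<integral>x. k \<epsilon> (x - y) * \<phi> x \<partial>lborel) - \<phi> y = (\<integral>x. k \<epsilon> (x - y) * \<phi> x - \<phi> y * k \<epsilon> (x - y) \<partial>lborel)"
    using ik ik\<phi> one by simp
  also have "\<bar>\<dots>\<bar> \<le> (\<integral>x. L * (2 * \<epsilon>) * k \<epsilon> (x - y) \<partial>lborel)"
  proof (rule order_trans[OF integral_abs_bound], rule integral_mono_AE')
    show "integrable lborel (\<lambda>x. L * (2 * \<epsilon>) * k \<epsilon> (x - y))" using ik by simp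
    have "\<bar>k \<epsilon> (x - y) * \<phi> x - \<phi> y * k \<epsilon> (x - y)\<bar> \<le> L * (2 * \<epsilon>) * k \<epsilon> (x - y)" for x
    proof (cases "k \<epsilon> (x - y) = 0")
      case False
      have "\<bar>\<phi> x - \<phi> y\<bar> \<le> L * norm (x - y)" using L(1)[of y "x - y"] by simp
      also have "\<dots> \<le> L * (2 * \<epsilon>)" using L(2) k\<epsilon>(3)[OF False] by (rule mult_left_mono[rotated])
      finally have "\<bar>\<phi> x - \<phi> y\<bar> * k \<epsilon> (x - y) \<le> L * (2 * \<epsilon>) * k \<epsilon> (x - y)"
        using k\<epsilon>(2) by (rule mult_right_mono)
      moreover have "k \<epsilon> (x - y) * \<phi> x - \<phi> y * k \<epsilon> (x - y) = (\<phi> x - \<phi> y) * k \<epsilon> (x - y)"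
        by (simp add: algebra_simps)
      ultimately show ?thesis using k\<epsilon>(2) by (simp add: abs_mult)
    qed simp
    then show "AE x in lborel. \<bar>k \<epsilon> (x - y) * \<phi> x - \<phi> y * k \<epsilon> (x - y)\<bar> \<le> L * (2 * \<epsilon>) * k \<epsilon> (x - y)"
      by (rule AE_I2)
    show "AE x in lborel. 0 \<le> L * (2 * \<epsilon>) * k \<epsilon> (x - y)" using L(2) k\<epsilon>(2) \<open>\<epsilon> > 0\<close> by simp
  qed
  also have "\<dots> = L * (2 * \<epsilon>)" using one by simp
  finally show ?thesis .
qed

lemma test_functions_mono: "S \<subseteq> U \<Longrightarrow> test_functions S \<subseteq> test_functions U"
  by (auto simp: test_functions_def)

context bounded_open
begin

text \<open>Mollified values at x agree for all radii whose ball fits into the domain, which defines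
  \<open>h\<close> without a limit. Locally one radius suffices, so \<open>h\<close> is smooth, and
  its Laplacian falls on the kernel. That \<open>h\<close> equals \<open>f\<close> is tested weakly,
  by moving the mollifier onto test functions.\<close>

lemma Weyl_lemma:
  assumes f: "integrable (lebesgue_on \<Omega>) f"
    and weak: "\<And>\<phi>. \<phi> \<in> T \<Longrightarrow> (\<integral>x. f x * laplacian \<phi> x \<partial>lebesgue_on \<Omega>) = 0"
  shows "\<exists>h. harmonic_on \<Omega> h \<and> (AE x in lebesgue_on \<Omega>. h x = f x)"
proof -
  obtain k :: "real \<Rightarrow> 'a \<Rightarrow> real" where k: "mollifier_family k" using mollifier_family_exists by blast
  have k1: "k \<epsilon> \<in> test_functions UNIV" "\<And>z. k \<epsilon> z \<noteq> 0 \<Longrightarrow> norm z \<le> 2 * \<epsilon>" "\<And>z. k \<epsilon> (- z) = k \<epsilon> z"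
    "\<And>x. (\<lambda>y. k \<epsilon> (y - x)) \<in> smooth"
    "\<And>x y. laplacian (\<lambda>y. k \<epsilon> (y - x)) y = laplacian (k \<epsilon>) (x - y)"
    "\<And>\<delta> x. \<delta> > 0 \<Longrightarrow> \<exists>\<psi>\<in>smooth. (\<forall>y. \<psi> y \<noteq> 0 \<longrightarrow> y \<in> cball x (2 * max \<epsilon> \<delta>)) \<and>
        (\<forall>y. laplacian \<psi> y = k \<epsilon> (y - x) - k \<delta> (y - x))" if "\<epsilon> > 0" for \<epsilon>
    using k that unfolding mollifier_family_def by blast+
  obtain f' where f': "f' \<in> borel_measurable borel" "\<And>x. x \<notin> \<Omega> \<Longrightarrow> f' x = 0"
    "AE x in lebesgue_on \<Omega>. f x = f' x" "integrable lborel f'"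
    using borel_representative[OF borel_measurable_integrable[OF f]] f by metis
  note f'(1)[measurable]
  have weak': "(\<integral>x. f' x * laplacian \<phi> x \<partial>lborel) = 0" if \<phi>: "\<phi> \<in> T" for \<phi>
  proof -
    have lm: "laplacian \<phi> \<in> borel_measurable borel"
      unfolding laplacian_def[abs_def] using \<phi>
      by (intro borel_measurable_sum test_function_borel_measurable[OF test_function_partials]) auto
    note [measurable] = lm
    have "(\<integral>x. f' x * laplacian \<phi> x \<partial>lborel) = (\<integral>x. f' x * laplacian \<phi> x \<partial>lebesgue_on \<Omega>)"
      using f'(2) by (intro integral_lborel_eq[symmetric]) auto
    also have "\<dots> = (\<integral>x. f x * laplacian \<phi> x \<partial>lebesgue_on \<Omega>)"
      using f'(3) by (intro integral_cong_AE borel_measurable_times borel_measurable_integrable[OF f]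
          borel_imp_lebesgue_on[OF f'(1)] borel_imp_lebesgue_on[OF lm]) auto
    finally show ?thesis using weak[OF \<phi>] by simp
  qed
  \<comment> \<open>By evenness the kernel, as a function of the integration variable, is centred at
    \<open>x\<close>.\<close>
  have cf: "convolution f' (k \<epsilon>) x = (\<integral>y. f' y * k \<epsilon> (y - x) \<partial>lborel)" if "\<epsilon> > 0" for \<epsilon> x
    unfolding convolution_def using k1(3)[OF that, of "x - _"] by simp
  \<comment> \<open>The difference of the two kernels is the Laplacian of a test function supported
    in the larger ball, and \<open>f'\<close> annihilates it.\<close>
  have indep: "convolution f' (k \<epsilon>) x = convolution f' (k \<delta>) x"
    if pos: "\<epsilon> > 0" "\<delta> > 0" and "cball x (2 * \<epsilon>) \<subseteq> \<Omega>" "cball x (2 * \<delta>) \<subseteq> \<Omega>" for \<epsilon> \<delta> x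
  proof -
    obtain \<psi> where \<psi>: "\<psi> \<in> smooth" "\<And>y. \<psi> y \<noteq> 0 \<Longrightarrow> y \<in> cball x (2 * max \<epsilon> \<delta>)"
      "\<And>y. laplacian \<psi> y = k \<epsilon> (y - x) - k \<delta> (y - x)" using k1(6)[OF pos, of x] by blast
    have "cball x (2 * max \<epsilon> \<delta>) \<subseteq> \<Omega>" using that by (auto simp: max_def)
    then have "\<psi> \<in> T" using \<psi>(2) by (intro smooth_test_functionI[OF \<psi>(1) _ compact_cball]) auto
    from weak'[OF this] have "(\<integral>y. f' y * k \<epsilon> (y - x) - f' y * k \<delta> (y - x) \<partial>lborel) = 0"
      by (simp add: \<psi>(3) right_diff_distrib)
    moreover have "integrable lborel (\<lambda>y. f' y * k \<epsilon> (y - x))" if "\<epsilon> > 0" for \<epsilon>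
      using convolution_integrable[OF f'(4) k1(1)[OF that], of x] k1(3)[OF that, of "x - _"] by simp
    ultimately show ?thesis using that by (simp add: cf)
  qed
  \<comment> \<open>The kernel centred at \<open>x\<close> is itself a test function when its ball
    lies in the domain, so the Laplacian moved onto it is annihilated by \<open>f'\<close>.\<close>
  have lap0: "laplacian (convolution f' (k \<epsilon>)) x = 0" if "\<epsilon> > 0" "cball x (2 * \<epsilon>) \<subseteq> \<Omega>" for \<epsilon> x
  proof -
    have pk: "partials bs (k \<epsilon>) \<in> test_functions UNIV" if "bs \<in> lists Basis" for bs
      using test_function_partials[OF k1(1)[OF \<open>\<epsilon> > 0\<close>] that] .
    have "laplacian (convolution f' (k \<epsilon>)) x = (\<Sum>b\<in>Basis. convolution f' (partials [b, b] (k \<epsilon>)) x)"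
      unfolding laplacian_def
      by (intro sum.cong refl) (subst convolution_partials[OF f'(4) k1(1)[OF that(1)]], auto)
    also have "\<dots> = (\<integral>y. f' y * laplacian (k \<epsilon>) (x - y) \<partial>lborel)"
      unfolding convolution_def laplacian_def sum_distrib_left
      by (intro Bochner_Integration.integral_sum[symmetric] convolution_integrable[OF f'(4) pk]) auto
    also have "\<dots> = (\<integral>y. f' y * laplacian (\<lambda>y. k \<epsilon> (y - x)) y \<partial>lborel)"
      by (simp add: k1(5)[OF that(1)])
    also have "\<dots> = 0"
    proof (rule weak', rule smooth_test_functionI[OF k1(4)[OF that(1)] _ compact_cball that(2)])
      show "y \<in> cball x (2 * \<epsilon>)" if "k \<epsilon> (y - x) \<noteq> 0" for y
        using k1(2)[OF \<open>\<epsilon> > 0\<close> that] by (simp add: dist_norm norm_minus_commute)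
    qed
    finally show ?thesis .
  qed
  define r where "r x = (SOME r. r > 0 \<and> cball x (2 * r) \<subseteq> \<Omega>)" for x
  have r: "r x > 0 \<and> cball x (2 * r x) \<subseteq> \<Omega>" if "x \<in> \<Omega>" for x
  proof -
    obtain d where d: "d > 0" "cball x d \<subseteq> \<Omega>" using open_domain \<open>x \<in> \<Omega>\<close> open_contains_cball by blast
    then have "d / 2 > 0 \<and> cball x (2 * (d / 2)) \<subseteq> \<Omega>" by simp
    then show ?thesis unfolding r_def by (rule someI)
  qed
  define h where "h x = convolution f' (k (r x)) x" for x
  have h_eq: "h x = convolution f' (k \<epsilon>) x" if "\<epsilon> > 0" "cball x (2 * \<epsilon>) \<subseteq> \<Omega>" for \<epsilon> x
  proof -
    have "x \<in> \<Omega>" using that by auto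
    then show ?thesis unfolding h_def using r that by (intro indep) auto
  qed
  \<comment> \<open>Half the radius chosen at \<open>x\<close> is admissible on a whole
    neighbourhood of \<open>x\<close>, so \<open>h\<close> is one fixed convolution there.\<close>
  have sub: "cball y (2 * (r x / 2)) \<subseteq> \<Omega>" if "x \<in> \<Omega>" "y \<in> ball x (r x)" for x y
  proof -
    have "cball y (r x) \<subseteq> cball x (2 * r x)"
    proof
      fix z assume "z \<in> cball y (r x)"
      then show "z \<in> cball x (2 * r x)" using that(2) dist_triangle[of x z y] by simp
    qed
    then show ?thesis using r[OF that(1)] by simp blast
  qed
  have "harmonic_on \<Omega> h"
  proof (rule harmonic_on_local)
    fix x assume x: "x \<in> \<Omega>"
    let ?g = "convolution f' (k (r x / 2))"
    have "\<forall>y\<in>ball x (r x). h y = ?g y" using r[OF x] sub[OF x] by (intro ballI h_eq) auto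
    moreover have "\<forall>bs\<in>lists Basis. partials bs ?g differentiable (at x)"
      using r[OF x] by (intro ballI convolution_partials_differentiable[OF f'(4) k1(1)]) auto
    moreover have "laplacian ?g x = 0" using r[OF x] sub[OF x, of x] by (intro lap0) auto
    ultimately show "\<exists>U g. open U \<and> x \<in> U \<and> (\<forall>y\<in>U. h y = g y) \<and>
      (\<forall>bs\<in>lists Basis. partials bs g differentiable (at x)) \<and> laplacian g x = 0"
      using r[OF x] by (intro exI[of _ "ball x (r x)"] exI[of _ ?g]) auto
  qed
  moreover have "AE x in lebesgue_on \<Omega>. f' x - h x = 0"
  proof (rule AE_lebesgue_on_iff_boxes)
    fix a c assume ac: "cbox a c \<subseteq> \<Omega>"
    interpret box: bounded_open "box a c" by unfold_locales (auto simp: open_box bounded_box)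
    \<comment> \<open>Compactness of the closed box gives one radius that is admissible at all of
      its points.\<close>
    obtain \<epsilon>0 where \<epsilon>0: "\<epsilon>0 > 0" "\<And>x. x \<in> cbox a c \<Longrightarrow> cball x (2 * \<epsilon>0) \<subseteq> \<Omega>"
    proof -
      obtain d where d: "d > 0" "(\<Union>x\<in>cbox a c. cball x d) \<subseteq> \<Omega>"
        using compact_subset_open_imp_cball_epsilon_subset[OF compact_cbox open_domain ac] by blast
      then have "d / 2 > 0" "\<And>x. x \<in> cbox a c \<Longrightarrow> cball x (2 * (d / 2)) \<subseteq> \<Omega>" by auto
      then show ?thesis using that by blast
    qed
    \<comment> \<open>Continuity on the compact closed box yields the integrability of
      \<open>h\<close> demanded by the fundamental lemma.\<close>
    have cont: "continuous_on (cbox a c) h"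
    proof -
      have "continuous_on (cbox a c) (convolution f' (k \<epsilon>0))"
        using convolution_partials_differentiable[OF f'(4) k1(1)[OF \<epsilon>0(1)], of "[]"]
        by (intro continuous_at_imp_continuous_on ballI differentiable_imp_continuous_within) simp
      then show ?thesis
        using h_eq[OF \<epsilon>0(1)] \<epsilon>0(2) by (subst continuous_on_cong[OF refl]) auto
    qed
    have ih: "integrable (lebesgue_on (cbox a c)) h"
      using cont by (rule continuous_imp_integrable)
    have "AE x in lebesgue_on (box a c). f' x - h x = 0"
    proof (rule box.fundamental_lemma)
      have "integrable (lebesgue_on (box a c)) h"
      proof -
        have "integrable lebesgue (\<lambda>x. indicator (cbox a c) x *\<^sub>R h x)"
          using ih by (subst (asm) integrable_restrict_space) auto
        then have "integrable lebesgue (\<lambda>x. indicator (box a c) x *\<^sub>R (indicator (cbox a c) x *\<^sub>R h x))"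
          by (rule integrable_mult_indicator[rotated]) simp
        also have "(\<lambda>x. indicator (box a c) x *\<^sub>R (indicator (cbox a c) x *\<^sub>R h x)) = (\<lambda>x. indicator (box a c) x *\<^sub>R h x)"
          using box_subset_cbox[of a c] by (intro ext) (auto split: split_indicator)
        finally show ?thesis by (subst integrable_restrict_space) auto
      qed
      moreover have if': "integrable (lebesgue_on (box a c)) f'"
      proof -
        have "integrable lebesgue f'" using f'(4) by (simp add: integrable_completion)
        then have "integrable lebesgue (\<lambda>x. indicator (box a c) x *\<^sub>R f' x)"
          by (rule integrable_mult_indicator[rotated]) simp
        then show ?thesis by (subst integrable_restrict_space) auto
      qed
      ultimately show ihf: "integrable (lebesgue_on (box a c)) (\<lambda>x. f' x - h x)" by (rule Bochner_Integration.integrable_diff[rotated])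
      fix \<phi> assume \<phi>: "\<phi> \<in> test_functions (box a c)"
      have \<phi>U: "\<phi> \<in> test_functions UNIV" using \<phi> test_functions_mono[OF subset_UNIV] by blast
      note [measurable] = test_function_borel_measurable[OF \<phi>]
      have \<phi>0: "\<phi> x = 0" if "x \<notin> box a c" for x using \<phi> that by (rule test_function_eq_0)
      obtain L where L: "L \<ge> 0" "\<And>z d. \<bar>\<phi> (z + d) - \<phi> z\<bar> \<le> L * norm d"
        using test_function_lipschitz[OF \<phi>] by blast
      obtain M where M: "\<And>x. \<bar>\<phi> x\<bar> \<le> M" using test_function_bounded[OF \<phi>] by blast
      define A where "A = (\<integral>y. \<bar>f' y\<bar> \<partial>lborel)"
      define J where "J = (\<integral>x. (f' x - h x) * \<phi> x \<partial>lebesgue_on (box a c))"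
      \<comment> \<open>\<open>J\<close> does not depend on \<epsilon>, whereas on the box
        \<open>h\<close> is the convolution for every small \<epsilon>. Passing to the adjoint
        leaves the error of mollifying \<phi>, which is of order \<epsilon>.\<close>
      have J_le: "\<bar>J\<bar> \<le> A * (L * (2 * \<epsilon>))" if \<epsilon>: "0 < \<epsilon>" "\<epsilon> \<le> \<epsilon>0" for \<epsilon>
      proof -
        let ?g = "convolution f' (k \<epsilon>)"
        have hg: "h x = ?g x" if "x \<in> box a c" for x
        proof (rule h_eq[OF \<epsilon>(1)])
          have "cball x (2 * \<epsilon>) \<subseteq> cball x (2 * \<epsilon>0)" using \<epsilon> by (intro subset_cball) simp
          then show "cball x (2 * \<epsilon>) \<subseteq> \<Omega>" using \<epsilon>0(2)[of x] that box_subset_cbox[of a c] by blast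
        qed
        have "continuous_on UNIV ?g"
          using convolution_partials_differentiable[OF f'(4) k1(1)[OF \<epsilon>(1)], of "[]"]
          by (intro continuous_at_imp_continuous_on ballI differentiable_imp_continuous_within) simp
        then have gm [measurable]: "?g \<in> borel_measurable borel" by (rule borel_measurable_continuous_onI)
        have "J = (\<integral>x. (f' x - ?g x) * \<phi> x \<partial>lebesgue_on (box a c))"
          unfolding J_def by (intro Bochner_Integration.integral_cong refl) (simp add: hg)
        also have "\<dots> = (\<integral>x. (f' x - ?g x) * \<phi> x \<partial>lborel)"
          using \<phi>0 by (intro box.integral_lborel_eq) auto
        finally have J1: "J = (\<integral>x. (f' x - ?g x) * \<phi> x \<partial>lborel)" .
        have if\<phi>: "integrable lborel (\<lambda>x. f' x * \<phi> x)"
        proof (rule Bochner_Integration.integrable_bound[OF integrable_mult_right[OF f'(4), of M]])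
          have "norm (f' x * \<phi> x) \<le> norm (M * f' x)" for x
            using mult_right_mono[OF order_trans[OF M abs_ge_self], of "\<bar>f' x\<bar>" x]
            by (simp add: abs_mult mult_ac)
          then show "AE x in lborel. norm (f' x * \<phi> x) \<le> norm (M * f' x)" by (rule AE_I2)
        qed measurable
        have igp: "integrable lborel (\<lambda>x. ?g x * \<phi> x)"
        proof -
          have "compact (?g ` cbox a c)"
            using \<open>continuous_on UNIV ?g\<close> by (intro compact_continuous_image) (auto intro: continuous_on_subset)
          then obtain B where B: "\<And>x. x \<in> cbox a c \<Longrightarrow> \<bar>?g x\<bar> \<le> B"
            using compact_imp_bounded bounded_pos by (metis imageI real_norm_def)
          show ?thesis
          proof (rule Bochner_Integration.integrable_bound[OF integrable_mult_right[OF test_function_integrable_lborel[OF \<phi>U], of B]])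
            have "norm (?g x * \<phi> x) \<le> norm (B * \<phi> x)" for x
            proof (cases "x \<in> box a c")
              case True
              then have "\<bar>?g x\<bar> \<le> \<bar>B\<bar>" using B[of x] box_subset_cbox[of a c] by force
              then show ?thesis by (simp add: abs_mult mult_right_mono)
            qed (simp add: \<phi>0)
            then show "AE x in lborel. norm (?g x * \<phi> x) \<le> norm (B * \<phi> x)" by (rule AE_I2)
          qed measurable
        qed
        let ?m = "\<lambda>y. \<integral>x. k \<epsilon> (x - y) * \<phi> x \<partial>lborel"
        have m: "\<bar>?m y - \<phi> y\<bar> \<le> L * (2 * \<epsilon>)" for y
          by (rule mollifier_approx[OF k \<phi>U \<epsilon>(1) L(2,1)])
        note [measurable] = test_function_borel_measurable[OF k1(1)[OF \<epsilon>(1)]]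
        have mm [measurable]: "?m \<in> borel_measurable borel" by measurable
        have ifm: "integrable lborel (\<lambda>y. f' y * ?m y)"
        proof (rule Bochner_Integration.integrable_bound[OF integrable_mult_right[OF f'(4), of "M + L * (2 * \<epsilon>)"]])
          have "\<bar>?m y\<bar> \<le> M + L * (2 * \<epsilon>)" for y using m[of y] M[of y] by linarith
          then have "norm (f' y * ?m y) \<le> norm ((M + L * (2 * \<epsilon>)) * f' y)" for y
            using mult_right_mono[OF order_trans[OF _ abs_ge_self], of "\<bar>?m y\<bar>" "M + L * (2 * \<epsilon>)" "\<bar>f' y\<bar>"]
            by (simp add: abs_mult mult_ac)
          then show "AE y in lborel. norm (f' y * ?m y) \<le> norm ((M + L * (2 * \<epsilon>)) * f' y)" by (rule AE_I2)
        qed measurable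
        have "J = (\<integral>x. f' x * \<phi> x \<partial>lborel) - (\<integral>x. ?g x * \<phi> x \<partial>lborel)"
          unfolding J1 using if\<phi> igp by (simp add: left_diff_distrib)
        also have "\<dots> = (\<integral>y. f' y * \<phi> y \<partial>lborel) - (\<integral>y. f' y * ?m y \<partial>lborel)"
          by (simp add: convolution_adjoint[OF f'(4) k1(1)[OF \<epsilon>(1)] \<phi>U])
        also have "\<dots> = (\<integral>y. f' y * (\<phi> y - ?m y) \<partial>lborel)"
          using if\<phi> ifm by (simp add: right_diff_distrib)
        also have "\<bar>\<dots>\<bar> \<le> (\<integral>y. \<bar>f' y\<bar> * (L * (2 * \<epsilon>)) \<partial>lborel)"
        proof (rule order_trans[OF integral_abs_bound], rule integral_mono_AE')
          show "AE y in lborel. \<bar>f' y * (\<phi> y - ?m y)\<bar> \<le> \<bar>f' y\<bar> * (L * (2 * \<epsilon>))"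
            unfolding abs_mult using m by (intro AE_I2 mult_left_mono) (auto simp: abs_minus_commute)
        qed (use f'(4) L(1) \<epsilon> in auto)
        also have "\<dots> = A * (L * (2 * \<epsilon>))" by (simp add: A_def)
        finally show ?thesis .
      qed
      have "(\<lambda>n. A * (L * (2 * (\<epsilon>0 * inverse (real (Suc n)))))) \<longlonglongrightarrow> A * (L * (2 * (\<epsilon>0 * 0)))"
        by (intro tendsto_intros LIMSEQ_inverse_real_of_nat)
      moreover have "\<bar>J\<bar> \<le> A * (L * (2 * (\<epsilon>0 * inverse (real (Suc n)))))" for n
        using \<epsilon>0(1) by (intro J_le) (auto simp: mult_le_cancel_left1 inverse_le_1_iff)
      ultimately have "\<bar>J\<bar> \<le> A * (L * (2 * (\<epsilon>0 * 0)))" by (intro LIMSEQ_le_const) auto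
      then show "(\<integral>x. (f' x - h x) * \<phi> x \<partial>lebesgue_on (box a c)) = 0" by (simp add: J_def)
    qed
    then have "AE x in lebesgue. x \<in> box a c \<longrightarrow> f' x - h x = 0"
      by (subst (asm) AE_restrict_space_iff) auto
    then show "AE x in lborel. x \<in> box a c \<longrightarrow> f' x - h x = 0" by (simp only: AE_completion_iff)
  qed
  ultimately show ?thesis using f'(3) by (intro exI[of _ h]) (auto elim!: eventually_elim2)
qed

end

section \<open>Splitting off a harmonic part\<close>

lemma partials_lincomb:
  assumes "\<phi> \<in> test_functions \<Omega>" "\<psi> \<in> test_functions \<Omega>" "bs \<in> lists Basis"
  shows "partials bs (\<lambda>x. c * \<phi> x + d * \<psi> x) = (\<lambda>x. c * partials bs \<phi> x + d * partials bs \<psi> x)"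
  using assms(3)
proof (induction bs)
  case (Cons b bs)
  then have bs: "bs \<in> lists Basis" by simp
  have D: "(partials bs \<phi> has_derivative frechet_derivative (partials bs \<phi>) (at x)) (at x)"
    "(partials bs \<psi> has_derivative frechet_derivative (partials bs \<psi>) (at x)) (at x)" for x
    using test_function_partials_differentiable[OF assms(1) bs] test_function_partials_differentiable[OF assms(2) bs]
      frechet_derivative_works by blast+
  have D': "((\<lambda>x. c * partials bs \<phi> x + d * partials bs \<psi> x) has_derivative
     (\<lambda>h. c * frechet_derivative (partials bs \<phi>) (at x) h + d * frechet_derivative (partials bs \<psi>) (at x) h)) (at x)" for x
    by (intro has_derivative_add has_derivative_mult_right D)
  show ?case
    unfolding partials.simps Cons.IH
    by (rule ext, rule fun_cong[OF frechet_derivative_at[OF D', symmetric]])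
qed simp

lemma test_functions_lincomb:
  assumes "\<phi> \<in> test_functions \<Omega>" "\<psi> \<in> test_functions \<Omega>"
  shows "(\<lambda>x. c * \<phi> x + d * \<psi> x) \<in> test_functions \<Omega>"
proof -
  let ?f = "\<lambda>x. c * \<phi> x + d * \<psi> x"
  let ?K = "closure {x. \<phi> x \<noteq> 0} \<union> closure {x. \<psi> x \<noteq> 0}"
  have K: "compact ?K" "?K \<subseteq> \<Omega>" using assms by (auto simp: test_functions_def)
  have "?f x = 0" if "x \<notin> ?K" for x
  proof -
    have "\<phi> x = 0" "\<psi> x = 0"
      using that closure_subset[of "{x. \<phi> x \<noteq> 0}"] closure_subset[of "{x. \<psi> x \<noteq> 0}"] by auto
    then show ?thesis by simp
  qed
  then have s: "closure {x. ?f x \<noteq> 0} \<subseteq> ?K"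
    using K(1) by (intro closure_minimal) (auto simp: compact_imp_closed)
  have "partials bs ?f differentiable (at x)" if "bs \<in> lists Basis" for bs x
    unfolding partials_lincomb[OF assms that]
    using test_function_partials_differentiable[OF assms(1) that] test_function_partials_differentiable[OF assms(2) that]
    by (intro differentiable_add differentiable_mult differentiable_const)
  then have "Ck_on k UNIV ?f" for k
    unfolding Ck_on_def by (auto intro!: continuous_at_imp_continuous_on differentiable_imp_continuous_within)
  moreover have "compact (closure {x. ?f x \<noteq> 0})"
    using compact_Int_closed[OF K(1) closed_closure[of "{x. ?f x \<noteq> 0}"]] unfolding Int_absorb1[OF s] .
  ultimately show ?thesis using subset_trans[OF s K(2)] by (simp add: test_functions_def)
qed

lemma laplacian_lincomb:
  assumes "\<phi> \<in> test_functions \<Omega>" "\<psi> \<in> test_functions \<Omega>"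
  shows "laplacian (\<lambda>x. c * \<phi> x + d * \<psi> x) x = c * laplacian \<phi> x + d * laplacian \<psi> x"
  unfolding laplacian_def sum_distrib_left sum.distrib[symmetric]
  by (intro sum.cong refl) (subst partials_lincomb[OF assms], auto)

lemma sq_integrable_subset:
  assumes "sq_integrable (lebesgue_on S) f" "U \<subseteq> S" "S \<in> sets lebesgue" "U \<in> sets lebesgue"
  shows "sq_integrable (lebesgue_on U) f" "l2norm (lebesgue_on U) f \<le> l2norm (lebesgue_on S) f"
proof -
  have i: "integrable lebesgue (\<lambda>x. if x \<in> S then (f x)\<^sup>2 else 0)"
    using sq_integrable_square[OF assms(1)] assms(3) by (simp add: Lebesgue_Measure.integrable_restrict_UNIV)
  have "integrable lebesgue (\<lambda>x. indicator U x *\<^sub>R (if x \<in> S then (f x)\<^sup>2 else 0))"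
    using i assms(4) by (rule integrable_mult_indicator[rotated])
  also have "(\<lambda>x. indicator U x *\<^sub>R (if x \<in> S then (f x)\<^sup>2 else 0)) = (\<lambda>x. if x \<in> U then (f x)\<^sup>2 else 0)"
    using assms(2) by (intro ext) (auto split: split_indicator)
  finally have j: "integrable lebesgue (\<lambda>x. if x \<in> U then (f x)\<^sup>2 else 0)" .
  then have "integrable (lebesgue_on U) (\<lambda>x. (f x)\<^sup>2)"
    using assms(4) by (simp add: Lebesgue_Measure.integrable_restrict_UNIV)
  moreover have "f \<in> borel_measurable (lebesgue_on U)"
    using assms sq_integrable_measurable measurable_restrict_mono by blast
  ultimately show "sq_integrable (lebesgue_on U) f" by (simp add: sq_integrable_def)
  have "(\<integral>x. (if x \<in> U then (f x)\<^sup>2 else 0) \<partial>lebesgue) \<le> (\<integral>x. (if x \<in> S then (f x)\<^sup>2 else 0) \<partial>lebesgue)"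
    using i j assms(2) by (intro integral_mono) auto
  then show "l2norm (lebesgue_on U) f \<le> l2norm (lebesgue_on S) f"
    unfolding l2norm_def using assms by (simp add: Lebesgue_Measure.integral_restrict_UNIV)
qed

text \<open>A nonzero linear term would dominate for small t of the opposite sign. This converts
  minimality under perturbations into orthogonality.\<close>

lemma quadratic_nonneg_imp_zero:
  fixes b c :: real
  assumes "\<And>t. 0 \<le> 2 * t * b + t\<^sup>2 * c" "c \<ge> 0"
  shows "b = 0"
proof (rule ccontr)
  assume b: "b \<noteq> 0"
  have u: "c + 1 > 0" using assms(2) by simp
  \<comment> \<open>The divisor c + 1 avoids a separate case for c = 0; at t = - v the expression
    equals - (c + 2) * v^2.\<close>
  define v where "v = b / (c + 1)"
  have bv: "b = v * (c + 1)" using u by (simp add: v_def)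
  have "0 \<le> 2 * (- v) * b + (- v)\<^sup>2 * c" by (rule assms(1))
  also have "\<dots> = v\<^sup>2 * (- (c + 2))" unfolding bv by (simp add: algebra_simps power2_eq_square)
  also have "\<dots> < 0" using b u assms(2) by (intro mult_pos_neg) (auto simp: v_def)
  finally show False by simp
qed

text \<open>The tolerances \<open>e\<close> are prescribed because the projection needs a geometric
  rate, whereas the least squares functional is content with 1 / (k + 1).\<close>

lemma minimizing_sequence:
  fixes F :: "'b \<Rightarrow> real"
  assumes "A \<noteq> {}" "\<And>a. a \<in> A \<Longrightarrow> 0 \<le> F a" "\<And>k. e k > 0"
  obtains m x where "m \<ge> 0" "\<And>a. a \<in> A \<Longrightarrow> m \<le> F a" "\<And>k::nat. x k \<in> A" "\<And>k. F (x k) \<le> m + e k"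
proof -
  define m where "m = Inf (F ` A)"
  have bdd: "bdd_below (F ` A)" using assms(2) by (intro bdd_belowI2)
  have "\<exists>a\<in>A. F a \<le> m + e k" for k
  proof -
    have "Inf (F ` A) < m + e k" using assms(3) by (simp add: m_def)
    then show ?thesis using assms(1) bdd by (subst (asm) cInf_less_iff) (auto intro: less_imp_le)
  qed
  then obtain x where "\<And>k. x k \<in> A" "\<And>k. F (x k) \<le> m + e k" by metis
  moreover have "m \<ge> 0" unfolding m_def using assms(1,2) by (intro cINF_greatest)
  moreover have "m \<le> F a" if "a \<in> A" for a unfolding m_def using that bdd by (intro cINF_lower)
  ultimately show ?thesis using that by blast
qed

context bounded_open
begin

text \<open>Write w = \<rho> + g with \<rho> in the closure of the Laplacians of test functions and
  g orthogonal to them. Then g is weakly harmonic, and since \<rho> is a limit of Laplacians, the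
  assumed bound on w gives |\<rho>|^2 \<le> E |\<rho>|.\<close>

lemma harmonic_decomposition:
  assumes w: "sq_integrable (lebesgue_on \<Omega>) w" and "E \<ge> 0"
    and E: "\<And>\<phi>. \<phi> \<in> T \<Longrightarrow> \<bar>\<integral>x. w x * laplacian \<phi> x \<partial>lebesgue_on \<Omega>\<bar> \<le> E * N (laplacian \<phi>)"
  shows "\<exists>h. harmonic_on \<Omega> h \<and> sq_integrable (lebesgue_on \<Omega>) h \<and> N (\<lambda>x. w x - h x) \<le> E"
proof -
  note lsq = laplacian_sq_integrable
  define f where "f \<phi> x = w x - laplacian \<phi> x" for \<phi> x
  have fsq: "sq_integrable (lebesgue_on \<Omega>) (f \<phi>)" if "\<phi> \<in> T" for \<phi>
    unfolding f_def by (intro sq_integrable_diff w lsq that)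
  have "T \<noteq> {}" using zero_test_function by blast
  \<comment> \<open>With tolerance (1/4)^k / 4 the parallelogram identity gives squared distances of
    at most (1/4)^k, just the rate (1/2)^k that the Riesz-Fischer lemma asks for.\<close>
  then obtain m \<phi> where m: "m \<ge> 0" "\<And>\<psi>. \<psi> \<in> T \<Longrightarrow> m \<le> (N (f \<psi>))\<^sup>2"
    and \<phi>: "\<And>k. \<phi> k \<in> T" "\<And>k::nat. (N (f (\<phi> k)))\<^sup>2 \<le> m + (1/4)^k / 4"
    by (rule minimizing_sequence[of T "\<lambda>\<psi>. (N (f \<psi>))\<^sup>2" "\<lambda>k. (1/4)^k / 4"]) auto
  have fast: "N (\<lambda>x. f (\<phi> k) x - f (\<phi> j) x) \<le> (1/2)^k" if "k \<le> j" for k j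
  proof -
    let ?a = "\<lambda>x. 1/2 * \<phi> k x + 1/2 * \<phi> j x"
    have "m \<le> (N (f ?a))\<^sup>2" by (intro m test_functions_lincomb \<phi>)
    also have "f ?a = (\<lambda>x. (f (\<phi> k) x + f (\<phi> j) x) / 2)"
      unfolding f_def laplacian_lincomb[OF \<phi>(1) \<phi>(1)] by (simp add: field_simps)
    also have "(N \<dots>)\<^sup>2 = ((N (f (\<phi> k)))\<^sup>2 + (N (f (\<phi> j)))\<^sup>2) / 2 - (N (\<lambda>x. f (\<phi> k) x - f (\<phi> j) x))\<^sup>2 / 4"
      by (intro l2norm_parallelogram fsq \<phi>)
    also have "\<dots> \<le> (m + (1/4)^k / 4 + (m + (1/4)^j / 4)) / 2 - (N (\<lambda>x. f (\<phi> k) x - f (\<phi> j) x))\<^sup>2 / 4"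
      using \<phi>(2)[of k] \<phi>(2)[of j] by simp
    finally have "(N (\<lambda>x. f (\<phi> k) x - f (\<phi> j) x))\<^sup>2 \<le> ((1/4)^k + (1/4)^j) / 2" by (simp add: field_simps)
    also have "\<dots> \<le> (1/4::real)^k" using power_decreasing[OF that, of "1/4::real"] by simp
    also have "\<dots> = ((1/2)^k)\<^sup>2" by (simp add: power_mult_distrib[symmetric] power2_eq_square)
    finally show ?thesis by (rule power2_le_imp_le) simp
  qed
  obtain g where g: "sq_integrable (lebesgue_on \<Omega>) g" "\<And>k. N (\<lambda>x. f (\<phi> k) x - g x) \<le> (1/2)^k"
    using Riesz_Fischer_fast_Cauchy[OF fsq[OF \<phi>(1)] emeasure_domain fast] by blast
  have lim2: "(\<lambda>k. (1/2::real)^k) \<longlonglongrightarrow> 0" by (rule LIMSEQ_power_zero) simp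
  have Ng: "(N g)\<^sup>2 \<le> m"
  proof -
    have "N g \<le> sqrt (m + (1/4)^k / 4) + (1/2)^k" for k
    proof -
      have "N g \<le> N (f (\<phi> k)) + N (\<lambda>x. g x - f (\<phi> k) x)" by (intro l2norm_le_diff g fsq \<phi>)
      also have "N (\<lambda>x. g x - f (\<phi> k) x) \<le> (1/2)^k" using g(2)[of k] by (subst l2norm_diff_commute)
      also have "N (f (\<phi> k)) \<le> sqrt (m + (1/4)^k / 4)" by (rule real_le_rsqrt[OF \<phi>(2)])
      finally show ?thesis by simp
    qed
    moreover have "(\<lambda>k. sqrt (m + (1/4)^k / 4) + (1/2)^k) \<longlonglongrightarrow> sqrt (m + 0 / 4) + 0"
      by (intro tendsto_intros LIMSEQ_power_zero) auto
    ultimately have "N g \<le> sqrt (m + 0 / 4) + 0" by (intro LIMSEQ_le_const) auto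
    then have "(N g)\<^sup>2 \<le> (sqrt m)\<^sup>2" by (intro power_mono) auto
    then show ?thesis using m(1) by simp
  qed
  have gorth: "(\<integral>x. g x * laplacian \<psi> x \<partial>lebesgue_on \<Omega>) = 0" if \<psi>: "\<psi> \<in> T" for \<psi>
  proof -
    let ?b = "\<integral>x. g x * laplacian \<psi> x \<partial>lebesgue_on \<Omega>" and ?c = "(N (laplacian \<psi>))\<^sup>2"
    \<comment> \<open>The perturbed \<open>g\<close> is the limit of the competitors w - Laplacian
      of (\<phi> k - t \<psi>), so it cannot fall below the infimum.\<close>
    have ge: "m \<le> (N (\<lambda>x. g x + t * laplacian \<psi> x))\<^sup>2" for t
    proof -
      have "sqrt m \<le> N (\<lambda>x. g x + t * laplacian \<psi> x) + (1/2)^k" for k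
      proof -
        let ?a = "\<lambda>x. 1 * \<phi> k x + (- t) * \<psi> x"
        have "m \<le> (N (f ?a))\<^sup>2" by (intro m test_functions_lincomb \<phi> \<psi>)
        then have "sqrt m \<le> N (f ?a)" by (simp add: real_le_lsqrt m(1))
        also have "f ?a = (\<lambda>x. f (\<phi> k) x + t * laplacian \<psi> x)"
          unfolding f_def laplacian_lincomb[OF \<phi>(1) \<psi>] by (simp add: algebra_simps)
        also have "N \<dots> \<le> N (\<lambda>x. g x + t * laplacian \<psi> x)
            + N (\<lambda>x. (f (\<phi> k) x + t * laplacian \<psi> x) - (g x + t * laplacian \<psi> x))"
          by (intro l2norm_le_diff sq_integrable_add sq_integrable_cmult fsq \<phi> g lsq \<psi>)
        also have "(\<lambda>x. (f (\<phi> k) x + t * laplacian \<psi> x) - (g x + t * laplacian \<psi> x)) = (\<lambda>x. f (\<phi> k) x - g x)"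
          by simp
        finally show ?thesis using g(2)[of k] by linarith
      qed
      moreover have "(\<lambda>k. N (\<lambda>x. g x + t * laplacian \<psi> x) + (1/2)^k) \<longlonglongrightarrow> N (\<lambda>x. g x + t * laplacian \<psi> x) + 0"
        by (intro tendsto_intros LIMSEQ_power_zero) auto
      ultimately have "sqrt m \<le> N (\<lambda>x. g x + t * laplacian \<psi> x) + 0" by (intro LIMSEQ_le_const) auto
      then have "(sqrt m)\<^sup>2 \<le> (N (\<lambda>x. g x + t * laplacian \<psi> x))\<^sup>2" using m(1) by (intro power_mono) auto
      then show ?thesis using m(1) by simp
    qed
    show ?thesis
    proof (rule quadratic_nonneg_imp_zero)
      show "0 \<le> 2 * t * ?b + t\<^sup>2 * ?c" for t
        using ge[of t] Ng l2norm_square_add[OF g(1) lsq[OF \<psi>], of t] by linarith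
    qed simp
  qed
  obtain h where h: "harmonic_on \<Omega> h" "AE x in lebesgue_on \<Omega>. h x = g x"
    using Weyl_lemma[OF sq_integrable_integrable[OF g(1)] gorth] by blast
  \<comment> \<open>Equality with \<open>g\<close> almost everywhere does not by itself make
    \<open>h\<close> measurable in this formulation; continuity does.\<close>
  have "continuous_on \<Omega> h" using h(1) by (auto simp: harmonic_on_def Ck_on_def dest!: bspec[of _ _ "[]"])
  then have hm: "h \<in> borel_measurable (lebesgue_on \<Omega>)"
    by (rule continuous_imp_measurable_on_sets_lebesgue) simp
  have hsq: "sq_integrable (lebesgue_on \<Omega>) h"
    using h(2) by (intro sq_integrable_cong_AE[OF g(1) hm]) (auto elim: eventually_mono)
  define \<rho> where "\<rho> x = w x - g x" for x
  have \<rho>sq: "sq_integrable (lebesgue_on \<Omega>) \<rho>" unfolding \<rho>_def by (intro sq_integrable_diff w g)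
  have "N (\<lambda>x. w x - h x) = N \<rho>"
    unfolding \<rho>_def using h(2) by (intro l2norm_cong_AE sq_integrable_measurable sq_integrable_diff w hsq g) auto
  also have "N \<rho> \<le> E"
  proof -
    let ?I = "l2inner (lebesgue_on \<Omega>)"
    \<comment> \<open>One factor \<rho> is replaced by its approximation, the Laplacian of
      \<open>\<phi> k\<close>. Against that, \<rho> and \<open>w\<close> have the same inner product
      because \<open>g\<close> is orthogonal to it; each replacement costs a multiple of
      (1/2)^k.\<close>
    have "(N \<rho>)\<^sup>2 \<le> E * N \<rho> + (E + N \<rho>) * (1/2)^k" for k
    proof -
      let ?l = "laplacian (\<phi> k)"
      have d: "N (\<lambda>x. \<rho> x - ?l x) \<le> (1/2)^k"
      proof -
        have "(\<lambda>x. \<rho> x - ?l x) = (\<lambda>x. f (\<phi> k) x - g x)" by (simp add: \<rho>_def f_def algebra_simps)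
        then show ?thesis using g(2)[of k] by simp
      qed
      have Nl: "N ?l \<le> N \<rho> + (1/2)^k"
        using l2norm_le_diff[OF lsq[OF \<phi>(1)] \<rho>sq, of k] d l2norm_diff_commute[of _ ?l \<rho>] by simp
      have "(N \<rho>)\<^sup>2 = ?I \<rho> \<rho>" by (simp add: l2inner_self)
      also have "?I \<rho> \<rho> = ?I ?l \<rho> + ?I (\<lambda>x. \<rho> x - ?l x) \<rho>"
        using l2inner_diff[OF \<rho>sq lsq[OF \<phi>(1)] \<rho>sq, of k] by simp
      also have "?I ?l \<rho> = ?I w ?l - ?I g ?l"
        unfolding \<rho>_def using l2inner_diff[OF w g(1) lsq[OF \<phi>(1)], of k]
        by (simp add: l2inner_commute[of _ ?l])
      also have "?I g ?l = 0" using gorth[OF \<phi>(1)] by (simp add: l2inner_def)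
      also have "?I w ?l - 0 \<le> E * N ?l" using E[OF \<phi>(1), of k] by (simp add: l2inner_def)
      also have "E * N ?l \<le> E * (N \<rho> + (1/2)^k)" using Nl \<open>E \<ge> 0\<close> by (rule mult_left_mono)
      also have "?I (\<lambda>x. \<rho> x - ?l x) \<rho> \<le> N (\<lambda>x. \<rho> x - ?l x) * N \<rho>"
        using l2inner_le[OF sq_integrable_diff[OF \<rho>sq lsq[OF \<phi>(1)]] \<rho>sq, of k] by linarith
      also have "\<dots> \<le> (1/2)^k * N \<rho>" using d by (intro mult_right_mono) auto
      finally show ?thesis by (simp add: algebra_simps)
    qed
    moreover have "(\<lambda>k. E * N \<rho> + (E + N \<rho>) * (1/2)^k) \<longlonglongrightarrow> E * N \<rho> + (E + N \<rho>) * 0"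
      by (intro tendsto_intros lim2)
    ultimately have "(N \<rho>)\<^sup>2 \<le> E * N \<rho> + (E + N \<rho>) * 0" by (intro LIMSEQ_le_const) auto
    then have "N \<rho> * N \<rho> \<le> E * N \<rho>" by (simp add: power2_eq_square)
    then show ?thesis using \<open>E \<ge> 0\<close> by (cases "N \<rho> = 0") (auto simp: less_le)
  qed
  finally show ?thesis using h(1) hsq by blast
qed

end

section \<open>The regularised least squares problem\<close>

context bounded_open
begin

abbreviation "W v \<equiv> N (weak_laplacian \<Omega> v)"

text \<open>The bound on \<open>l\<close> makes the supremum finite, so the extended functional can
  be replaced by a real one. The supremum is kept only through its universal property, as the least
  nonnegative bound \<open>s\<close> of the squared quotients.\<close>

lemma objective_eq_ennreal:
  assumes Y: "Y \<subseteq> H20 \<Omega>" and z: "sq_integrable (lebesgue_on \<Omega>) z"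
    and l: "\<And>v. v \<in> H20 \<Omega> \<Longrightarrow> \<bar>l v\<bar> \<le> M * W v" and "M \<ge> 0"
  shows "\<exists>s\<ge>0. objective \<Omega> \<omega> Y \<epsilon> l q z = ennreal (s + (norm_L2 \<omega> (\<lambda>x. z x - q x))\<^sup>2 + \<epsilon>\<^sup>2 * (N z)\<^sup>2) \<and>
    (\<forall>v\<in>Y. \<not> zero_on \<Omega> v \<longrightarrow> ((opB \<Omega> z v - l v) / W v)\<^sup>2 \<le> s) \<and>
    (\<forall>c\<ge>0. (\<forall>v\<in>Y. \<not> zero_on \<Omega> v \<longrightarrow> ((opB \<Omega> z v - l v) / W v)\<^sup>2 \<le> c) \<longrightarrow> s \<le> c)"
proof -
  let ?A = "{v \<in> Y. \<not> zero_on \<Omega> v}" and ?a = "\<lambda>v. ((opB \<Omega> z v - l v) / W v)\<^sup>2"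
  define S where "S = (SUP v\<in>?A. ennreal (?a v))"
  have a: "?a v \<le> (N z + M)\<^sup>2" if "v \<in> Y" for v
  proof -
    have v: "v \<in> H20 \<Omega>" using that Y by blast
    have "\<bar>opB \<Omega> z v - l v\<bar> \<le> (N z + M) * W v"
      using opB_le[OF z v] l[OF v] by (simp add: distrib_right)
    then have "\<bar>(opB \<Omega> z v - l v) / W v\<bar> \<le> N z + M"
      using \<open>M \<ge> 0\<close> by (cases "W v = 0") (simp_all add: abs_divide divide_le_eq less_le)
    then have "\<bar>(opB \<Omega> z v - l v) / W v\<bar>\<^sup>2 \<le> (N z + M)\<^sup>2" by (intro power_mono) auto
    then show ?thesis by (simp only: power2_abs)
  qed
  have "S \<le> ennreal ((N z + M)\<^sup>2)"
    unfolding S_def by (rule SUP_least) (use a in \<open>auto intro!: ennreal_leI\<close>)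
  then have fin: "S < top" by (rule le_less_trans) simp
  define s where "s = enn2real S"
  have s: "ennreal s = S" "s \<ge> 0" using fin by (simp_all add: s_def)
  have "objective \<Omega> \<omega> Y \<epsilon> l q z = S + ennreal ((norm_L2 \<omega> (\<lambda>x. z x - q x))\<^sup>2) + ennreal (\<epsilon>\<^sup>2 * (N z)\<^sup>2)"
    by (simp add: objective_def S_def norm_L2_eq power_divide)
  also have "\<dots> = ennreal (s + (norm_L2 \<omega> (\<lambda>x. z x - q x))\<^sup>2 + \<epsilon>\<^sup>2 * (N z)\<^sup>2)"
    using s(2) by (simp add: s(1)[symmetric])
  finally have obj: "objective \<Omega> \<omega> Y \<epsilon> l q z = ennreal (s + (norm_L2 \<omega> (\<lambda>x. z x - q x))\<^sup>2 + \<epsilon>\<^sup>2 * (N z)\<^sup>2)" .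
  have up: "?a v \<le> s" if "v \<in> Y" "\<not> zero_on \<Omega> v" for v
  proof -
    have "ennreal (?a v) \<le> S" unfolding S_def using that by (intro SUP_upper) auto
    then have "ennreal (?a v) \<le> ennreal s" by (simp only: s(1))
    then show ?thesis using s(2) by (simp only: ennreal_le_iff)
  qed
  have least: "s \<le> c" if "c \<ge> 0" "\<forall>v\<in>Y. \<not> zero_on \<Omega> v \<longrightarrow> ?a v \<le> c" for c
  proof -
    have "S \<le> ennreal c"
      unfolding S_def by (rule SUP_least) (use that in \<open>auto intro!: ennreal_leI\<close>)
    then have "ennreal s \<le> ennreal c" by (simp only: s(1))
    then show ?thesis using that(1) by (simp only: ennreal_le_iff)
  qed
  show ?thesis using obj s(2) up least by blast
qed

lemma opB_midpoint:
  assumes "sq_integrable (lebesgue_on \<Omega>) z" "sq_integrable (lebesgue_on \<Omega>) w" "v \<in> H20 \<Omega>"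
  shows "opB \<Omega> (\<lambda>x. (z x + w x) / 2) v = (opB \<Omega> z v + opB \<Omega> w v) / 2"
proof -
  note wl = weak_laplacian_sq_integrable[OF H20_H2[OF assms(3)]]
  have "l2inner (lebesgue_on \<Omega>) (\<lambda>x. 1/2 * (z x + w x)) (weak_laplacian \<Omega> v)
      = 1/2 * (l2inner (lebesgue_on \<Omega>) z (weak_laplacian \<Omega> v) + l2inner (lebesgue_on \<Omega>) w (weak_laplacian \<Omega> v))"
    unfolding l2inner_cmult l2inner_add[OF assms(1,2) wl] ..
  then show ?thesis by (simp add: opB_def l2inner_def field_simps)
qed

text \<open>Strict convexity of the functional makes minimising sequences Cauchy.\<close>

lemma regularized_solution_minimizes:
  assumes Xl: "linear_subspace X" and Xs: "\<forall>z\<in>X. sq_integrable (lebesgue_on \<Omega>) z" and Xf: "finite_dimensional \<Omega> X"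
    and Y: "Y \<subseteq> H20 \<Omega>" and "M \<ge> 0" and lM: "\<forall>v\<in>H20 \<Omega>. \<bar>l v\<bar> \<le> M * W v"
    and \<omega>: "\<omega> \<subseteq> \<Omega>" "\<omega> \<in> sets lebesgue" and q: "sq_integrable (lebesgue_on \<omega>) q" and "\<epsilon> > 0"
  defines "U \<equiv> regularized_solution \<Omega> \<omega> X Y \<epsilon> l q"
  shows "U \<in> X" "\<And>z. z \<in> X \<Longrightarrow> objective \<Omega> \<omega> Y \<epsilon> l q U \<le> objective \<Omega> \<omega> Y \<epsilon> l q z"
proof -
  note X = Xl Xs[rule_format] Xf and l = lM[rule_format]
  let ?A = "{v \<in> Y. \<not> zero_on \<Omega> v}" and ?N\<omega> = "l2norm (lebesgue_on \<omega>)"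
  define a where "a z v = (opB \<Omega> z v - l v) / W v" for z v
  define r where "r z = (?N\<omega> (\<lambda>x. z x - q x))\<^sup>2 + \<epsilon>\<^sup>2 * (N z)\<^sup>2" for z
  have "\<exists>s. 0 \<le> s \<and> objective \<Omega> \<omega> Y \<epsilon> l q z = ennreal (s + r z) \<and> (\<forall>v\<in>?A. (a z v)\<^sup>2 \<le> s) \<and>
      (\<forall>c\<ge>0. (\<forall>v\<in>?A. (a z v)\<^sup>2 \<le> c) \<longrightarrow> s \<le> c)" if "z \<in> X" for z
  proof -
    have A: "(\<forall>v\<in>Y. \<not> zero_on \<Omega> v \<longrightarrow> Q v) \<longleftrightarrow> (\<forall>v\<in>?A. Q v)" for Q by blast
    show ?thesis
      using objective_eq_ennreal[OF Y X(2)[OF that] l \<open>M \<ge> 0\<close>, of \<omega> \<epsilon> q]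
      unfolding A a_def[symmetric] r_def norm_L2_eq add.assoc .
  qed
  then have "\<forall>z\<in>X. \<exists>s. 0 \<le> s \<and> objective \<Omega> \<omega> Y \<epsilon> l q z = ennreal (s + r z) \<and> (\<forall>v\<in>?A. (a z v)\<^sup>2 \<le> s) \<and>
      (\<forall>c\<ge>0. (\<forall>v\<in>?A. (a z v)\<^sup>2 \<le> c) \<longrightarrow> s \<le> c)" by (rule ballI)
  \<comment> \<open>\<open>s z\<close> is the supremum term of the functional as a real number;
    \<open>r z\<close> holds the two remaining squares.\<close>
  from bchoice[OF this] obtain s where s_all: "\<forall>z\<in>X. 0 \<le> s z \<and> objective \<Omega> \<omega> Y \<epsilon> l q z = ennreal (s z + r z) \<and>
      (\<forall>v\<in>?A. (a z v)\<^sup>2 \<le> s z) \<and> (\<forall>c\<ge>0. (\<forall>v\<in>?A. (a z v)\<^sup>2 \<le> c) \<longrightarrow> s z \<le> c)" ..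
  have s: "\<And>z. z \<in> X \<Longrightarrow> 0 \<le> s z"
    "\<And>z. z \<in> X \<Longrightarrow> objective \<Omega> \<omega> Y \<epsilon> l q z = ennreal (s z + r z)"
    "\<And>z v. z \<in> X \<Longrightarrow> v \<in> ?A \<Longrightarrow> (a z v)\<^sup>2 \<le> s z"
    "\<And>z c. z \<in> X \<Longrightarrow> c \<ge> 0 \<Longrightarrow> (\<And>v. v \<in> ?A \<Longrightarrow> (a z v)\<^sup>2 \<le> c) \<Longrightarrow> s z \<le> c"
    using s_all by simp_all
  define F where "F z = s z + r z" for z
  have r0: "r z \<ge> 0" for z by (simp add: r_def)
  have F0: "F z \<ge> 0" if "z \<in> X" for z using s(1)[OF that] r0[of z] by (simp add: F_def)
  have X\<omega>: "sq_integrable (lebesgue_on \<omega>) z" "?N\<omega> z \<le> N z" if "sq_integrable (lebesgue_on \<Omega>) z" for z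
    using sq_integrable_subset[OF that \<omega>(1) domain_sets(2) \<omega>(2)] by auto
  \<comment> \<open>Convexity of the square handles the supremum and the data term. The gain on the
    right comes from the parallelogram identity for the regularisation term, so it needs a positive
    \<epsilon>.\<close>
  have mid: "F (\<lambda>x. (z x + w x) / 2) \<le> (F z + F w) / 2 - \<epsilon>\<^sup>2 / 4 * (N (\<lambda>x. z x - w x))\<^sup>2"
    and midX: "(\<lambda>x. (z x + w x) / 2) \<in> X" if zw: "z \<in> X" "w \<in> X" for z w
  proof -
    let ?c = "\<lambda>x. (z x + w x) / 2"
    have "(\<lambda>x. 1/2 * (z x + w x)) \<in> X"
      using zw by (intro linear_subspace_cmult[OF X(1)] linear_subspace_add[OF X(1)])
    then show cX: "?c \<in> X" by simp
    have "s ?c \<le> (s z + s w) / 2"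
    proof (rule s(4)[OF cX])
      show "0 \<le> (s z + s w) / 2" using s(1) zw by simp
      fix v assume v: "v \<in> ?A"
      then have "v \<in> H20 \<Omega>" using Y by auto
      then have av: "a ?c v = (a z v + a w v) / 2"
        using opB_midpoint[OF X(2)[OF zw(1)] X(2)[OF zw(2)]] by (simp add: a_def add_divide_distrib diff_divide_distrib)
      have "(a ?c v)\<^sup>2 = ((a z v)\<^sup>2 + (a w v)\<^sup>2) / 2 - ((a z v - a w v) / 2)\<^sup>2"
        unfolding av by (simp add: power2_eq_square field_simps)
      also have "\<dots> \<le> ((a z v)\<^sup>2 + (a w v)\<^sup>2) / 2"
        using zero_le_power2[of "(a z v - a w v) / 2"] by linarith
      also have "\<dots> \<le> (s z + s w) / 2" using s(3)[OF zw(1) v] s(3)[OF zw(2) v] by simp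
      finally show "(a ?c v)\<^sup>2 \<le> (s z + s w) / 2" .
    qed
    moreover have "(?N\<omega> (\<lambda>x. ?c x - q x))\<^sup>2 \<le> ((?N\<omega> (\<lambda>x. z x - q x))\<^sup>2 + (?N\<omega> (\<lambda>x. w x - q x))\<^sup>2) / 2"
    proof -
      have eq: "(\<lambda>x. ?c x - q x) = (\<lambda>x. ((z x - q x) + (w x - q x)) / 2)" by (simp add: field_simps)
      show ?thesis
        unfolding eq l2norm_parallelogram[OF sq_integrable_diff[OF X\<omega>(1)[OF X(2)[OF zw(1)]] q]
            sq_integrable_diff[OF X\<omega>(1)[OF X(2)[OF zw(2)]] q]]
        by (simp only: diff_le_eq le_add_same_cancel1) simp
    qed
    moreover have "\<epsilon>\<^sup>2 * (N ?c)\<^sup>2 = (\<epsilon>\<^sup>2 * (N z)\<^sup>2 + \<epsilon>\<^sup>2 * (N w)\<^sup>2) / 2 - \<epsilon>\<^sup>2 / 4 * (N (\<lambda>x. z x - w x))\<^sup>2"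
      unfolding l2norm_parallelogram[OF X(2)[OF zw(1)] X(2)[OF zw(2)]] by (simp add: field_simps)
    ultimately show "F ?c \<le> (F z + F w) / 2 - \<epsilon>\<^sup>2 / 4 * (N (\<lambda>x. z x - w x))\<^sup>2"
      unfolding F_def r_def by argo
  qed
  have "X \<noteq> {}" using X(1) by (auto simp: linear_subspace_def)
  then obtain m zk where m: "m \<ge> 0" "\<And>z. z \<in> X \<Longrightarrow> m \<le> F z"
    and zk: "\<And>k. zk k \<in> X" "\<And>k::nat. F (zk k) \<le> m + inverse (real (Suc k))"
    by (rule minimizing_sequence[of X F "\<lambda>k. inverse (real (Suc k))"]) (use F0 in auto)
  have cauchy: "\<exists>n. \<forall>k\<ge>n. \<forall>j\<ge>n. N (\<lambda>x. zk k x - zk j x) < e" if "e > 0" for e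
  proof -
    have "\<epsilon>\<^sup>2 / 4 * e\<^sup>2 > 0" using that \<open>\<epsilon> > 0\<close> by simp
    then obtain n where n: "inverse (real (Suc n)) < \<epsilon>\<^sup>2 / 4 * e\<^sup>2" using reals_Archimedean by blast
    have "N (\<lambda>x. zk k x - zk j x) < e" if "k \<ge> n" "j \<ge> n" for k j
    proof -
      have i: "inverse (real (Suc k)) \<le> inverse (real (Suc n))" "inverse (real (Suc j)) \<le> inverse (real (Suc n))"
        using that by (auto intro!: le_imp_inverse_le)
      have "\<epsilon>\<^sup>2 / 4 * (N (\<lambda>x. zk k x - zk j x))\<^sup>2 \<le> inverse (real (Suc n))"
      proof -
        \<comment> \<open>The scalar core: the midpoint value is at least the infimum, so the gain
          \<open>d\<close> is at most the mean of the two tolerances.\<close>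
        have "d \<le> n'" if "a \<le> (x + y) / 2 - d" "m \<le> a" "x \<le> m + i" "y \<le> m + i'" "i \<le> n'" "i' \<le> n'"
          for a x y d i i' n' :: real using that by (simp add: field_simps)
        from this[OF mid[OF zk(1) zk(1)] m(2)[OF midX[OF zk(1) zk(1)]] zk(2) zk(2) i] show ?thesis .
      qed
      also have "\<dots> < \<epsilon>\<^sup>2 / 4 * e\<^sup>2" by (rule n)
      finally have "(N (\<lambda>x. zk k x - zk j x))\<^sup>2 < e\<^sup>2"
        by (rule mult_left_less_imp_less) simp
      then show ?thesis by (rule power2_less_imp_less) (use \<open>e > 0\<close> in simp)
    qed
    then show ?thesis by blast
  qed
  obtain B where B: "finite B" "B \<subseteq> X" "\<And>f. f \<in> X \<Longrightarrow> \<exists>c. AE x in lebesgue_on \<Omega>. f x = (\<Sum>b\<in>B. c b * b x)"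
    using X(3) unfolding finite_dimensional_def by blast
  obtain z where z: "z \<in> X" "(\<lambda>k. N (\<lambda>x. zk k x - z x)) \<longlonglongrightarrow> 0"
    using finite_dim_complete[OF X(1,2) B zk(1) cauchy] by blast
  \<comment> \<open>Lower semicontinuity of the supremum: for each fixed \<open>v\<close> the bound
    passes to the limit, and the least-bound property then recombines all \<open>v\<close>.\<close>
  have Fz: "F z \<le> m"
  proof -
    have lim_m: "(\<lambda>k. m + inverse (real (Suc k))) \<longlonglongrightarrow> m + 0"
      by (intro tendsto_intros LIMSEQ_inverse_real_of_nat)
    have "(\<lambda>k. N (zk k) - N z) \<longlonglongrightarrow> 0"
    proof (rule Lim_null_comparison[OF _ z(2)], intro always_eventually allI)
      fix k
      show "norm (N (zk k) - N z) \<le> N (\<lambda>x. zk k x - z x)"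
        using l2norm_le_diff[OF X(2)[OF zk(1)] X(2)[OF z(1)], of k]
          l2norm_le_diff[OF X(2)[OF z(1)] X(2)[OF zk(1)], of k] l2norm_diff_commute[of _ z "zk k"] by simp
    qed
    then have limN: "(\<lambda>k. N (zk k)) \<longlonglongrightarrow> N z" by (simp add: LIM_zero_iff)
    have "(\<lambda>k. ?N\<omega> (\<lambda>x. zk k x - q x) - ?N\<omega> (\<lambda>x. z x - q x)) \<longlonglongrightarrow> 0"
    proof (rule Lim_null_comparison[OF _ z(2)], intro always_eventually allI)
      fix k
      note w = X\<omega>[OF X(2)[OF zk(1)[of k]]] X\<omega>[OF X(2)[OF z(1)]]
      have "?N\<omega> (\<lambda>x. zk k x - z x) \<le> N (\<lambda>x. zk k x - z x)"
        by (intro X\<omega> sq_integrable_diff X(2) zk z)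
      then show "norm (?N\<omega> (\<lambda>x. zk k x - q x) - ?N\<omega> (\<lambda>x. z x - q x)) \<le> N (\<lambda>x. zk k x - z x)"
        using l2norm_triangle_via[OF w(1,3) q] l2norm_triangle_via[OF w(3,1) q] l2norm_diff_commute[of _ z "zk k"]
        by simp
    qed
    then have lim\<omega>: "(\<lambda>k. ?N\<omega> (\<lambda>x. zk k x - q x)) \<longlonglongrightarrow> ?N\<omega> (\<lambda>x. z x - q x)" by (simp add: LIM_zero_iff)
    have limr: "(\<lambda>k. r (zk k)) \<longlonglongrightarrow> r z" unfolding r_def by (intro tendsto_intros limN lim\<omega>)
    have lima: "(\<lambda>k. a (zk k) v) \<longlonglongrightarrow> a z v" if "v \<in> ?A" for v
    proof -
      have v: "v \<in> H20 \<Omega>" using that Y by auto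
      have "(\<lambda>k. a (zk k) v - a z v) \<longlonglongrightarrow> 0"
      proof (rule Lim_null_comparison[OF _ z(2)], intro always_eventually allI)
        fix k
        have "a (zk k) v - a z v = opB \<Omega> (\<lambda>x. zk k x - z x) v / W v"
          using opB_diff[OF X(2)[OF zk(1)] X(2)[OF z(1)] v, of k] by (simp add: a_def diff_divide_distrib)
        moreover have "\<bar>opB \<Omega> (\<lambda>x. zk k x - z x) v\<bar> \<le> N (\<lambda>x. zk k x - z x) * W v"
          by (intro opB_le sq_integrable_diff X(2) zk z v)
        ultimately show "norm (a (zk k) v - a z v) \<le> N (\<lambda>x. zk k x - z x)"
          by (cases "W v = 0") (simp_all add: abs_divide divide_le_eq less_le)
      qed
      then show ?thesis by (simp add: LIM_zero_iff)
    qed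
    have "r z \<le> m + 0"
    proof (rule LIMSEQ_le[OF limr lim_m], intro exI allI impI)
      show "r (zk k) \<le> m + inverse (real (Suc k))" for k
        using zk(2)[of k] s(1)[OF zk(1), of k] by (simp add: F_def)
    qed
    moreover have "(a z v)\<^sup>2 \<le> m - r z" if v: "v \<in> ?A" for v
    proof -
      have lim_ar: "(\<lambda>k. (a (zk k) v)\<^sup>2 + r (zk k)) \<longlonglongrightarrow> (a z v)\<^sup>2 + r z"
        by (intro tendsto_intros lima[OF v] limr)
      have "(a z v)\<^sup>2 + r z \<le> m + 0"
      proof (rule LIMSEQ_le[OF lim_ar lim_m], intro exI allI impI)
        show "(a (zk k) v)\<^sup>2 + r (zk k) \<le> m + inverse (real (Suc k))" for k
          using zk(2)[of k] s(3)[OF zk(1) v, of k] by (simp add: F_def)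
      qed
      then show ?thesis by simp
    qed
    ultimately have "s z \<le> m - r z" by (intro s(4)[OF z(1)]) simp_all
    then show ?thesis by (simp add: F_def)
  qed
  have obj: "objective \<Omega> \<omega> Y \<epsilon> l q z \<le> objective \<Omega> \<omega> Y \<epsilon> l q w" if "w \<in> X" for w
    unfolding s(2)[OF z(1)] s(2)[OF that] F_def[symmetric]
    using Fz m(2)[OF that] by (intro ennreal_leI) simp
  have "is_arg_min (objective \<Omega> \<omega> Y \<epsilon> l q) (\<lambda>w. w \<in> X) z"
    using z(1) obj by (auto simp: is_arg_min_def not_less)
  \<comment> \<open>\<open>U\<close> is whichever minimiser the choice operator returns; existence
    of one minimiser transfers the property to it.\<close>
  then have "is_arg_min (objective \<Omega> \<omega> Y \<epsilon> l q) (\<lambda>w. w \<in> X) U"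
    unfolding U_def regularized_solution_def arg_min_on_def arg_min_def
    by (rule someI[where P="is_arg_min (objective \<Omega> \<omega> Y \<epsilon> l q) (\<lambda>w. w \<in> X)"])
  then show "U \<in> X" "\<And>z. z \<in> X \<Longrightarrow> objective \<Omega> \<omega> Y \<epsilon> l q U \<le> objective \<Omega> \<omega> Y \<epsilon> l q z"
    by (auto simp: is_arg_min_def not_less)
qed

text \<open>If the residual of \<open>z\<close> is at most \<open>D\<close> on the discrete test
  space, every inf-sup quotient is at most D / |Bz|, whence |Bz| \<le> D / \<rho>. The case Bz = 0
  is outside the infimum and is settled directly.\<close>

lemma inf_sup_bound:
  assumes "ennreal \<rho> \<le> inf_sup_constant \<Omega> I X Y" "\<rho> > 0" "\<delta> \<in> I" "z \<in> X \<delta>"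
    and z: "sq_integrable (lebesgue_on \<Omega>) z"
    and D: "D \<ge> 0" "\<And>v. v \<in> Y \<delta> \<Longrightarrow> \<not> zero_on \<Omega> v \<Longrightarrow> \<bar>opB \<Omega> z v\<bar> \<le> D * W v"
    and v: "v \<in> H20 \<Omega>"
  shows "\<bar>opB \<Omega> z v\<bar> \<le> D / \<rho> * norm_H2 \<Omega> v"
proof (cases "\<exists>v\<in>H20 \<Omega>. opB \<Omega> z v \<noteq> 0")
  case False
  then show ?thesis using v D(1) \<open>\<rho> > 0\<close> norm_H2_nonneg[of v] by auto
next
  case True
  let ?n = "norm_Hm2 \<Omega> (opB \<Omega> z)"
  have bd: "\<bar>opB \<Omega> z v\<bar> \<le> ?n * norm_H2 \<Omega> v" if "v \<in> H20 \<Omega>" for v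
  proof (rule norm_Hm2_bound[OF _ that])
    fix v assume v: "v \<in> H20 \<Omega>"
    have "\<bar>opB \<Omega> z v\<bar> \<le> N z * W v" by (rule opB_le[OF z v])
    also have "\<dots> \<le> N z * (real DIM('a) * norm_H2 \<Omega> v)"
      by (intro mult_left_mono weak_laplacian_norm_le H20_H2 v) simp
    finally show "\<bar>opB \<Omega> z v\<bar> \<le> (N z * real DIM('a)) * norm_H2 \<Omega> v" by (simp add: mult.assoc)
  qed
  obtain v0 where v0: "v0 \<in> H20 \<Omega>" "opB \<Omega> z v0 \<noteq> 0" using True by blast
  then have "0 < ?n * norm_H2 \<Omega> v0" using bd[OF v0(1)] by linarith
  \<comment> \<open>Strict positivity of the dual norm protects the quotient from the convention x /
    0 = 0.\<close>
  then have n: "?n > 0" using norm_H2_nonneg[of v0] by (simp add: zero_less_mult_iff)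
  have "ennreal \<rho> \<le> (SUP v\<in>{v \<in> Y \<delta>. \<not> zero_on \<Omega> v}. ennreal (\<bar>opB \<Omega> z v\<bar> / (?n * W v)))"
  proof (rule order_trans[OF assms(1)])
    show "inf_sup_constant \<Omega> I X Y \<le> (SUP v\<in>{v \<in> Y \<delta>. \<not> zero_on \<Omega> v}. ennreal (\<bar>opB \<Omega> z v\<bar> / (?n * W v)))"
      unfolding inf_sup_constant_def norm_L2_eq
      by (rule order_trans[OF INF_lower[OF \<open>\<delta> \<in> I\<close>] INF_lower]) (use True \<open>z \<in> X \<delta>\<close> in simp)
  qed
  also have "\<dots> \<le> ennreal (D / ?n)"
  proof (rule SUP_least, rule ennreal_leI)
    fix v assume v: "v \<in> {v \<in> Y \<delta>. \<not> zero_on \<Omega> v}"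
    show "\<bar>opB \<Omega> z v\<bar> / (?n * W v) \<le> D / ?n"
    proof (cases "W v = 0")
      case False
      then have "W v > 0" by (simp add: less_le)
      then show ?thesis using D(2)[of v] v n by (simp add: field_simps)
    qed (use D n in simp)
  qed
  finally have "\<rho> \<le> D / ?n" using D(1) n by (simp add: ennreal_le_iff)
  then have "?n \<le> D / \<rho>" using n \<open>\<rho> > 0\<close> by (simp add: field_simps)
  then show ?thesis using bd[OF v] norm_H2_nonneg[of v] by (meson mult_right_mono order_trans)
qed

end

text \<open>Removes the slack that remains from a nearly best approximation in the trial
  space.\<close>

lemma le_mult_if_le_mult_add_eps:
  fixes K E x :: real
  assumes "K \<ge> 0" "\<And>\<tau>. \<tau> > 0 \<Longrightarrow> x \<le> K * (E + \<tau>)"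
  shows "x \<le> K * E"
proof (rule field_le_epsilon)
  fix e :: real assume e: "e > 0"
  \<comment> \<open>The divisor K + 1 covers K = 0 as well.\<close>
  have "x \<le> K * (E + e / (K + 1))" using assms(1) e by (intro assms(2)) simp
  also have "\<dots> \<le> K * E + e"
    using assms(1) e by (simp add: distrib_left field_simps)
  finally show "x \<le> K * E + e" .
qed

lemma rpow_nonneg: "0 \<le> rpow x a"
  by (simp add: rpow_def)

lemma rpow_mono: "0 \<le> x \<Longrightarrow> x \<le> y \<Longrightarrow> 0 \<le> a \<Longrightarrow> rpow x a \<le> rpow y a"
  by (simp add: rpow_def powr_mono2)

lemma rpow_mult: "0 \<le> x \<Longrightarrow> 0 \<le> y \<Longrightarrow> rpow (x * y) a = rpow x a * rpow y a"
  by (simp add: rpow_def powr_mult)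

lemma rpow_mult_rpow:
  assumes "0 \<le> x" "0 < a" "a \<le> 1" shows "rpow x a * rpow x (1 - a) = x"
proof (cases "x = 0")
  case True
  then show ?thesis using assms by (simp add: rpow_def)
next
  case False
  then show ?thesis using assms by (auto simp: rpow_def powr_add[symmetric])
qed

context bounded_open
begin

text \<open>At a nearly best approximation \<open>z\<close> each of the three terms of the
  functional is at most D^2, hence each term at the minimiser is at most (2 D)^2. The residuals of z
  and U differ by at most 3 D on the discrete test functions, and the inf-sup condition extends this
  to all of H^2_0.\<close>

lemma regularized_error_bounds:
  assumes Xl: "linear_subspace X" and Xs: "\<forall>z\<in>X. sq_integrable (lebesgue_on \<Omega>) z" and Xf: "finite_dimensional \<Omega> X"
    and Y: "Y \<subseteq> H20 \<Omega>" and l: "l \<in> Hm2 \<Omega>"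
    and \<omega>: "\<omega> \<subseteq> \<Omega>" "\<omega> \<in> sets lebesgue" and q: "sq_integrable (lebesgue_on \<omega>) q"
    and u: "sq_integrable (lebesgue_on \<Omega>) u"
    and "C > 0" and normC: "\<forall>v\<in>H20 \<Omega>. norm_H2 \<Omega> v \<le> C * W v"
    and "\<rho> > 0" and inf_sup: "\<forall>z\<in>X. \<forall>D\<ge>0.
      (\<forall>v\<in>Y. \<not> zero_on \<Omega> v \<longrightarrow> \<bar>opB \<Omega> z v\<bar> \<le> D * W v) \<longrightarrow>
      (\<forall>v\<in>H20 \<Omega>. \<bar>opB \<Omega> z v\<bar> \<le> D / \<rho> * norm_H2 \<Omega> v)"
    and \<epsilon>: "0 < \<epsilon>" "\<epsilon> \<le> \<epsilon>0" and "c2 > 0"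
    and E: "E = E_data \<Omega> \<omega> l q u + E_appr \<Omega> X u"
    and le: "\<epsilon> * N u \<le> c2 * E"
  defines "U \<equiv> regularized_solution \<Omega> \<omega> X Y \<epsilon> l q" and "K1 \<equiv> 1 + C + \<epsilon>0 + c2"
  shows "E \<ge> 0" "sq_integrable (lebesgue_on \<Omega>) U"
    "\<And>v. v \<in> H20 \<Omega> \<Longrightarrow> \<bar>opB \<Omega> (\<lambda>x. u x - U x) v\<bar> \<le> (1 + 3 * K1 * C / \<rho>) * E * W v"
    "l2norm (lebesgue_on \<omega>) (\<lambda>x. u x - U x) \<le> (1 + 2 * K1) * E" "\<epsilon> * N U \<le> 2 * K1 * E"
proof -
  note X = Xl Xs[rule_format] Xf and C = \<open>C > 0\<close> normC[rule_format]
  have infsup: "\<rho> > 0" "\<And>z D v. z \<in> X \<Longrightarrow> D \<ge> 0 \<Longrightarrow>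
      (\<And>v. v \<in> Y \<Longrightarrow> \<not> zero_on \<Omega> v \<Longrightarrow> \<bar>opB \<Omega> z v\<bar> \<le> D * W v) \<Longrightarrow> v \<in> H20 \<Omega> \<Longrightarrow>
      \<bar>opB \<Omega> z v\<bar> \<le> D / \<rho> * norm_H2 \<Omega> v"
    using \<open>\<rho> > 0\<close> inf_sup by blast+
  let ?N\<omega> = "l2norm (lebesgue_on \<omega>)"
  let ?eD = "E_data \<Omega> \<omega> l q u" and ?eA = "E_appr \<Omega> X u"
  have K1: "K1 \<ge> 1" "K1 \<ge> 0" using C \<epsilon> \<open>c2 > 0\<close> by (auto simp: K1_def)
  have X\<omega>: "sq_integrable (lebesgue_on \<omega>) z" "?N\<omega> z \<le> N z" if "sq_integrable (lebesgue_on \<Omega>) z" for z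
    using sq_integrable_subset[OF that \<omega>(1) domain_sets(2) \<omega>(2)] by auto
  obtain M where M: "\<And>v. v \<in> H20 \<Omega> \<Longrightarrow> \<bar>l v\<bar> \<le> M * norm_H2 \<Omega> v" using l unfolding Hm2_def by blast
  have l_le: "\<bar>l v\<bar> \<le> (\<bar>M\<bar> * C) * W v" if v: "v \<in> H20 \<Omega>" for v
  proof -
    have "\<bar>l v\<bar> \<le> \<bar>M\<bar> * norm_H2 \<Omega> v"
      using M[OF v] mult_right_mono[OF abs_ge_self norm_H2_nonneg, of M v] by linarith
    also have "\<dots> \<le> \<bar>M\<bar> * (C * W v)" by (intro mult_left_mono C v) simp
    finally show ?thesis by (simp add: mult.assoc)
  qed
  have "\<bar>M\<bar> * C \<ge> 0" using C by simp
  have "\<forall>v\<in>H20 \<Omega>. \<bar>l v\<bar> \<le> (\<bar>M\<bar> * C) * W v" using l_le by blast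
  note min = regularized_solution_minimizes[OF Xl Xs Xf Y \<open>\<bar>M\<bar> * C \<ge> 0\<close> this \<omega> q \<epsilon>(1), folded U_def]
  note UX = min(1)
  show Usq: "sq_integrable (lebesgue_on \<Omega>) U" using X(2)[OF UX] .
  have eD: "?eD \<ge> 0" "norm_Hm2 \<Omega> (\<lambda>v. opB \<Omega> u v - l v) \<le> ?eD" "?N\<omega> (\<lambda>x. u x - q x) \<le> ?eD"
    unfolding E_data_def norm_L2_eq by (auto intro: real_le_rsqrt)
  have X0: "X \<noteq> {}" using X(1) by (auto simp: linear_subspace_def)
  have eA: "?eA \<ge> 0" unfolding E_appr_def norm_L2_eq using X0 by (intro cINF_greatest) auto
  show E0: "E \<ge> 0" using eD eA by (simp add: E)
  have res_u: "\<bar>opB \<Omega> u v - l v\<bar> \<le> C * ?eD * W v" if v: "v \<in> H20 \<Omega>" for v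
  proof -
    have "\<bar>opB \<Omega> u v - l v\<bar> \<le> norm_Hm2 \<Omega> (\<lambda>v. opB \<Omega> u v - l v) * norm_H2 \<Omega> v"
    proof (rule norm_Hm2_bound[OF _ v])
      fix v assume v: "v \<in> H20 \<Omega>"
      have "\<bar>opB \<Omega> u v\<bar> \<le> N u * W v" by (rule opB_le[OF u v])
      also have "\<dots> \<le> N u * (real DIM('a) * norm_H2 \<Omega> v)"
        by (intro mult_left_mono weak_laplacian_norm_le H20_H2 v) simp
      finally show "\<bar>opB \<Omega> u v - l v\<bar> \<le> (N u * real DIM('a) + M) * norm_H2 \<Omega> v"
        using M[OF v] by (simp add: algebra_simps)
    qed
    also have "\<dots> \<le> ?eD * (C * W v)" using eD C(2)[OF v] norm_H2_nonneg by (intro mult_mono) auto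
    finally show ?thesis by (simp add: mult_ac)
  qed
  \<comment> \<open>All estimates are first proved with E + \<tau> in place of E.\<close>
  have step: "(\<forall>v\<in>H20 \<Omega>. \<bar>opB \<Omega> (\<lambda>x. u x - U x) v\<bar> \<le> (1 + 3 * K1 * C / \<rho>) * (E + \<tau>) * W v) \<and>
      ?N\<omega> (\<lambda>x. U x - q x) \<le> 2 * K1 * (E + \<tau>) \<and> \<epsilon> * N U \<le> 2 * K1 * (E + \<tau>)" if \<tau>: "\<tau> > 0" for \<tau>
  proof -
    have E\<tau>: "E + \<tau> \<ge> 0" using E0 \<tau> by simp
    define D where "D = K1 * (E + \<tau>)"
    have D0: "D \<ge> 0" using K1 E\<tau> by (simp add: D_def)
    have "\<exists>z\<in>X. N (\<lambda>x. u x - z x) < ?eA + \<tau>"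
    proof -
      have "bdd_below ((\<lambda>z. N (\<lambda>x. u x - z x)) ` X)" by (rule bdd_belowI2[of _ 0]) simp
      moreover have "(INF z\<in>X. N (\<lambda>x. u x - z x)) < ?eA + \<tau>" using \<tau> by (simp add: E_appr_def norm_L2_eq)
      ultimately show ?thesis using X0 by (subst (asm) cINF_less_iff) auto
    qed
    then obtain z where zX: "z \<in> X" and z: "N (\<lambda>x. u x - z x) \<le> ?eA + \<tau>" by (auto intro: less_imp_le)
    note zsq = X(2)[OF zX]
    have z': "N (\<lambda>x. z x - u x) \<le> ?eA + \<tau>" using z by (subst l2norm_diff_commute)
    have zE: "?eA + \<tau> \<le> E + \<tau>" using eD(1) by (simp add: E)
    have p: "C * (E + \<tau>) \<ge> 0" "\<epsilon>0 * (E + \<tau>) \<ge> 0" "c2 * (E + \<tau>) \<ge> 0" using C \<epsilon> \<open>c2 > 0\<close> E\<tau> by auto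
    \<comment> \<open>The origin of \<open>K1\<close>: 1 for the approximation error,
      \<open>C\<close> for the data residual measured against Laplacians, \<open>\<epsilon>0\<close>
      for the regularisation of z - u, and \<open>c2\<close> for that of u.\<close>
    have Dexp: "D = (E + \<tau>) + C * (E + \<tau>) + \<epsilon>0 * (E + \<tau>) + c2 * (E + \<tau>)" by (simp add: D_def K1_def algebra_simps)
    have res_z: "\<bar>opB \<Omega> z v - l v\<bar> \<le> D * W v" if v: "v \<in> H20 \<Omega>" for v
    proof -
      have "opB \<Omega> z v - l v = opB \<Omega> (\<lambda>x. z x - u x) v + (opB \<Omega> u v - l v)"
        using opB_diff[OF zsq u v] by simp
      also have "\<bar>\<dots>\<bar> \<le> N (\<lambda>x. z x - u x) * W v + C * ?eD * W v"
        using opB_le[OF sq_integrable_diff[OF zsq u] v] res_u[OF v] by linarith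
      also have "\<dots> = (N (\<lambda>x. z x - u x) + C * ?eD) * W v" by (simp add: distrib_right)
      also have "\<dots> \<le> D * W v"
      proof (rule mult_right_mono)
        have "C * ?eD \<le> C * (E + \<tau>)" using eA \<tau> C(1) by (intro mult_left_mono) (auto simp: E)
        then show "N (\<lambda>x. z x - u x) + C * ?eD \<le> D" unfolding Dexp using z' zE p by linarith
      qed simp
      finally show ?thesis .
    qed
    have \<omega>z: "?N\<omega> (\<lambda>x. z x - q x) \<le> D"
    proof -
      have "?N\<omega> (\<lambda>x. z x - q x) \<le> ?N\<omega> (\<lambda>x. z x - u x) + ?N\<omega> (\<lambda>x. u x - q x)"
        by (intro l2norm_triangle_via X\<omega> zsq u q)
      also have "\<dots> \<le> (?eA + \<tau>) + ?eD" using X\<omega>(2)[OF sq_integrable_diff[OF zsq u]] z' eD(3) by linarith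
      also have "\<dots> \<le> D" unfolding Dexp using p by (simp add: E)
      finally show ?thesis .
    qed
    have \<epsilon>z: "\<epsilon> * N z \<le> D"
    proof -
      have "N z \<le> N u + N (\<lambda>x. z x - u x)" by (rule l2norm_le_diff[OF zsq u])
      then have "\<epsilon> * N z \<le> \<epsilon> * N u + \<epsilon> * N (\<lambda>x. z x - u x)" using \<epsilon>(1) by (simp flip: distrib_left)
      also have "\<epsilon> * N (\<lambda>x. z x - u x) \<le> \<epsilon>0 * (E + \<tau>)" using \<epsilon> z' zE by (intro mult_mono) auto
      also have "\<epsilon> * N u \<le> c2 * (E + \<tau>)"
        using le \<tau> \<open>c2 > 0\<close> mult_left_mono[of E "E + \<tau>" c2] by linarith
      finally show ?thesis unfolding Dexp using p E\<tau> by linarith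
    qed
    obtain sz where sz: "sz \<ge> 0"
      "objective \<Omega> \<omega> Y \<epsilon> l q z = ennreal (sz + (norm_L2 \<omega> (\<lambda>x. z x - q x))\<^sup>2 + \<epsilon>\<^sup>2 * (N z)\<^sup>2)"
      "\<And>c. c \<ge> 0 \<Longrightarrow> (\<forall>v\<in>Y. \<not> zero_on \<Omega> v \<longrightarrow> ((opB \<Omega> z v - l v) / W v)\<^sup>2 \<le> c) \<Longrightarrow> sz \<le> c"
      using objective_eq_ennreal[OF Y zsq l_le \<open>\<bar>M\<bar> * C \<ge> 0\<close>, of \<omega> \<epsilon> q] by auto
    obtain sU where sU: "sU \<ge> 0"
      "objective \<Omega> \<omega> Y \<epsilon> l q U = ennreal (sU + (norm_L2 \<omega> (\<lambda>x. U x - q x))\<^sup>2 + \<epsilon>\<^sup>2 * (N U)\<^sup>2)"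
      "\<And>v. v \<in> Y \<Longrightarrow> \<not> zero_on \<Omega> v \<Longrightarrow> ((opB \<Omega> U v - l v) / W v)\<^sup>2 \<le> sU"
      using objective_eq_ennreal[OF Y Usq l_le \<open>\<bar>M\<bar> * C \<ge> 0\<close>, of \<omega> \<epsilon> q] by auto
    \<comment> \<open>The three terms at \<open>z\<close> sum to at most 3 D^2, rounded up to a
      perfect square.\<close>
    have four: "(2 * D)\<^sup>2 = 4 * D\<^sup>2" by (simp add: power_mult_distrib)
    have "sz \<le> D\<^sup>2"
    proof (rule sz(3), simp, intro ballI impI)
      fix v assume "v \<in> Y"
      then have "\<bar>(opB \<Omega> z v - l v) / W v\<bar> \<le> D"
        using res_z[of v] Y D0 by (cases "W v = 0") (auto simp: abs_divide divide_le_eq less_le)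
      then have "\<bar>(opB \<Omega> z v - l v) / W v\<bar>\<^sup>2 \<le> D\<^sup>2" by (intro power_mono) auto
      then show "((opB \<Omega> z v - l v) / W v)\<^sup>2 \<le> D\<^sup>2" by (simp only: power2_abs)
    qed
    moreover have "(norm_L2 \<omega> (\<lambda>x. z x - q x))\<^sup>2 \<le> D\<^sup>2" using \<omega>z by (intro power_mono) (auto simp: norm_L2_eq)
    moreover have "\<epsilon>\<^sup>2 * (N z)\<^sup>2 \<le> D\<^sup>2"
      unfolding power_mult_distrib[symmetric] using \<epsilon>z \<epsilon>(1) by (intro power_mono) auto
    moreover have "sU + (norm_L2 \<omega> (\<lambda>x. U x - q x))\<^sup>2 + \<epsilon>\<^sup>2 * (N U)\<^sup>2
        \<le> sz + (norm_L2 \<omega> (\<lambda>x. z x - q x))\<^sup>2 + \<epsilon>\<^sup>2 * (N z)\<^sup>2"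
      using min(2)[OF zX] sz(1) unfolding sz(2) sU(2) by (subst (asm) ennreal_le_iff) auto
    ultimately have tot: "sU + (?N\<omega> (\<lambda>x. U x - q x))\<^sup>2 + (\<epsilon> * N U)\<^sup>2 \<le> (2 * D)\<^sup>2"
      using zero_le_power2[of D] four unfolding power_mult_distrib[of \<epsilon>] norm_L2_eq by linarith
    have "sU \<le> (2 * D)\<^sup>2" "(?N\<omega> (\<lambda>x. U x - q x))\<^sup>2 \<le> (2 * D)\<^sup>2" "(\<epsilon> * N U)\<^sup>2 \<le> (2 * D)\<^sup>2"
      using tot sU(1) zero_le_power2[of "?N\<omega> (\<lambda>x. U x - q x)"] zero_le_power2[of "\<epsilon> * N U"] by linarith+
    then have sU': "sU \<le> (2 * D)\<^sup>2" and U1: "?N\<omega> (\<lambda>x. U x - q x) \<le> 2 * D" and U2: "\<epsilon> * N U \<le> 2 * D"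
      using D0 by (auto intro: power2_le_imp_le)
    have res_U: "\<bar>opB \<Omega> U v - l v\<bar> \<le> 2 * D * W v" if v: "v \<in> Y" "\<not> zero_on \<Omega> v" for v
    proof -
      have vH: "v \<in> H20 \<Omega>" using v Y by auto
      show ?thesis
      proof (cases "W v = 0")
        \<comment> \<open>The quotient in the functional is 0 by convention here and says nothing,
          but both functionals vanish at such \<open>v\<close>.\<close>
        case True
        then show ?thesis using opB_le[OF Usq vH] l_le[OF vH] by simp
      next
        case False
        have "\<bar>(opB \<Omega> U v - l v) / W v\<bar>\<^sup>2 \<le> (2 * D)\<^sup>2"
          unfolding power2_abs using sU(3)[OF v] sU' by linarith
        then have "\<bar>(opB \<Omega> U v - l v) / W v\<bar> \<le> 2 * D" by (rule power2_le_imp_le) (use D0 in simp)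
        moreover have "W v > 0" using False by (simp add: less_le)
        ultimately show ?thesis by (simp add: abs_divide pos_divide_le_eq)
      qed
    qed
    have "\<bar>opB \<Omega> (\<lambda>x. u x - U x) v\<bar> \<le> (1 + 3 * K1 * C / \<rho>) * (E + \<tau>) * W v" if v: "v \<in> H20 \<Omega>" for v
    proof -
      \<comment> \<open>3 D is the sum of D for the residual at \<open>z\<close> and 2 D for the one
        at \<open>U\<close>; the functional \<open>l\<close> cancels in the difference.\<close>
      have "\<bar>opB \<Omega> (\<lambda>x. z x - U x) v\<bar> \<le> 3 * D / \<rho> * norm_H2 \<Omega> v"
      proof (rule infsup(2)[OF linear_subspace_diff[OF X(1) zX UX] _ _ v])
        fix v assume vY: "v \<in> Y" "\<not> zero_on \<Omega> v"
        then have vH: "v \<in> H20 \<Omega>" using Y by auto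
        show "\<bar>opB \<Omega> (\<lambda>x. z x - U x) v\<bar> \<le> 3 * D * W v"
          using res_z[OF vH] res_U[OF vY] opB_diff[OF zsq Usq vH] by (simp add: algebra_simps)
      qed (use D0 in simp)
      \<comment> \<open>The norm equivalence returns from the H^2 norm, to which the dual norm
        belongs, to the norm of the Laplacian.\<close>
      also have "\<dots> \<le> 3 * D / \<rho> * (C * W v)" using C(2)[OF v] D0 infsup(1) by (intro mult_left_mono) auto
      finally have 1: "\<bar>opB \<Omega> (\<lambda>x. z x - U x) v\<bar> \<le> 3 * K1 * C / \<rho> * (E + \<tau>) * W v"
        by (simp add: D_def mult_ac)
      have "N (\<lambda>x. u x - z x) * W v \<le> (E + \<tau>) * W v" using z zE by (intro mult_right_mono) auto
      then have 2: "\<bar>opB \<Omega> (\<lambda>x. u x - z x) v\<bar> \<le> (E + \<tau>) * W v"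
        using opB_le[OF sq_integrable_diff[OF u zsq] v] by linarith
      have "opB \<Omega> (\<lambda>x. u x - U x) v = opB \<Omega> (\<lambda>x. u x - z x) v + opB \<Omega> (\<lambda>x. z x - U x) v"
        using opB_diff[OF u zsq v] opB_diff[OF zsq Usq v] opB_diff[OF u Usq v] by simp
      then have "\<bar>opB \<Omega> (\<lambda>x. u x - U x) v\<bar> \<le> (E + \<tau>) * W v + 3 * K1 * C / \<rho> * (E + \<tau>) * W v"
        using 1 2 by linarith
      then show ?thesis by (simp add: distrib_right mult.assoc)
    qed
    with U1 U2 show ?thesis by (simp add: D_def mult.assoc)
  qed
  show "\<bar>opB \<Omega> (\<lambda>x. u x - U x) v\<bar> \<le> (1 + 3 * K1 * C / \<rho>) * E * W v" if v: "v \<in> H20 \<Omega>" for v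
  proof -
    have "\<bar>opB \<Omega> (\<lambda>x. u x - U x) v\<bar> \<le> ((1 + 3 * K1 * C / \<rho>) * W v) * E"
    proof (rule le_mult_if_le_mult_add_eps)
      show "0 \<le> (1 + 3 * K1 * C / \<rho>) * W v" using K1 C infsup by simp
      show "\<bar>opB \<Omega> (\<lambda>x. u x - U x) v\<bar> \<le> ((1 + 3 * K1 * C / \<rho>) * W v) * (E + \<tau>)" if "\<tau> > 0" for \<tau>
        using step[OF that] v by (simp add: mult_ac)
    qed
    then show ?thesis by (simp add: mult_ac)
  qed
  have K1': "0 \<le> 2 * K1" using K1 by simp
  show "\<epsilon> * N U \<le> 2 * K1 * E"
    by (rule le_mult_if_le_mult_add_eps[OF K1']) (use step in blast)
  have "?N\<omega> (\<lambda>x. U x - q x) \<le> 2 * K1 * E"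
    by (rule le_mult_if_le_mult_add_eps[OF K1']) (use step in blast)
  moreover have "?N\<omega> (\<lambda>x. u x - U x) \<le> ?N\<omega> (\<lambda>x. u x - q x) + ?N\<omega> (\<lambda>x. q x - U x)"
    by (intro l2norm_triangle_via X\<omega> u q Usq)
  moreover have "?N\<omega> (\<lambda>x. q x - U x) = ?N\<omega> (\<lambda>x. U x - q x)" by (rule l2norm_diff_commute)
  ultimately show "?N\<omega> (\<lambda>x. u x - U x) \<le> (1 + 2 * K1) * E"
    using eD(3) eA by (simp add: E algebra_simps)
qed

end

section \<open>The conditional stability estimate on G\<close>

theorem corollary3p2:
  fixes \<omega> G \<Omega> :: "(real ^ 'n) set"
    and \<alpha> \<epsilon>0 c1 c2 :: real
    and I :: "'i set"
    and X Y :: "'i \<Rightarrow> (real ^ 'n \<Rightarrow> real) set"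
  assumes "bounded_domain \<omega>" and "bounded_domain G" and "bounded_domain \<Omega>"
    and "\<omega> \<subseteq> G" and "compactly_contained G \<Omega>"
    and "0 < \<alpha>" and "\<alpha> \<le> 1"
    and "\<exists>C0. \<forall>w\<in>L2 \<Omega>. harmonic_on \<Omega> w \<longrightarrow>
           norm_L2 G w \<le> C0 * rpow (norm_L2 \<omega> w) \<alpha> * rpow (norm_L2 \<Omega> w) (1 - \<alpha>)"
    and "\<And>\<delta>. \<delta> \<in> I \<Longrightarrow> X \<delta> \<subseteq> L2 \<Omega> \<and> linear_subspace (X \<delta>) \<and> finite_dimensional \<Omega> (X \<delta>)"
    and "\<And>\<delta>. \<delta> \<in> I \<Longrightarrow> Y \<delta> \<subseteq> H20 \<Omega> \<and> linear_subspace (Y \<delta>) \<and>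
           (finite_dimensional \<Omega> (Y \<delta>) \<or> closed_in_H20 \<Omega> (Y \<delta>))"
    and "inf_sup_constant \<Omega> I X Y > 0"
    and "\<epsilon>0 > 0" and "c1 > 0" and "c2 > 0"
  shows "\<exists>K. \<forall>\<delta>\<in>I. \<forall>l\<in>Hm2 \<Omega>. \<forall>q\<in>L2 \<omega>. \<forall>u\<in>L2 \<Omega>. \<forall>\<epsilon>\<in>{0<..\<epsilon>0}.
           c1 * (E_data \<Omega> \<omega> l q u + E_appr \<Omega> (X \<delta>) u) \<le> \<epsilon> * norm_L2 \<Omega> u \<and>
           \<epsilon> * norm_L2 \<Omega> u \<le> c2 * (E_data \<Omega> \<omega> l q u + E_appr \<Omega> (X \<delta>) u) \<longrightarrow>
           norm_L2 G (\<lambda>x. u x - regularized_solution \<Omega> \<omega> (X \<delta>) (Y \<delta>) \<epsilon> l q x)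
             \<le> K * rpow (E_data \<Omega> \<omega> l q u + E_appr \<Omega> (X \<delta>) u) \<alpha>
                 * rpow (max (E_data \<Omega> \<omega> l q u + E_appr \<Omega> (X \<delta>) u) (norm_L2 \<Omega> u)) (1 - \<alpha>)"
proof -
  interpret bounded_open \<Omega> using assms(3) by unfold_locales (auto simp: bounded_domain_def)
  have G: "G \<subseteq> \<Omega>" "G \<in> sets lebesgue"
    using assms(2,5) closure_subset[of G] by (auto simp: bounded_domain_def compactly_contained_def)
  have \<omega>: "\<omega> \<subseteq> \<Omega>" "\<omega> \<in> sets lebesgue" using assms(1,4) G by (auto simp: bounded_domain_def)
  obtain C where C: "C > 0" "\<And>v. v \<in> H20 \<Omega> \<Longrightarrow> norm_H2 \<Omega> v \<le> C * W v"
    using norm_H2_le_weak_laplacian by blast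
  obtain C0 where C0: "\<And>w. w \<in> L2 \<Omega> \<Longrightarrow> harmonic_on \<Omega> w \<Longrightarrow>
      norm_L2 G w \<le> C0 * rpow (norm_L2 \<omega> w) \<alpha> * rpow (norm_L2 \<Omega> w) (1 - \<alpha>)" using assms(8) by blast
  \<comment> \<open>The inf-sup constant may be infinite, for instance over an empty index set; the
    minimum with 1 gives a positive real lower bound.\<close>
  define \<rho> where "\<rho> = enn2real (min 1 (inf_sup_constant \<Omega> I X Y))"
  have "ennreal \<rho> = min 1 (inf_sup_constant \<Omega> I X Y)"
    unfolding \<rho>_def by (intro ennreal_enn2real) (simp add: min_less_iff_disj)
  then have \<rho>: "ennreal \<rho> \<le> inf_sup_constant \<Omega> I X Y" "\<rho> > 0"
    using assms(11) by (simp, metis ennreal_less_zero_iff min_less_iff_conj zero_less_one)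
  \<comment> \<open>\<open>K1\<close> and \<open>K2\<close> come from the error bounds, and
    \<open>K2 * E\<close> also bounds the distance from w to its harmonic part. \<open>K3\<close>
    and \<open>K4\<close> bound that harmonic part on \<omega> and on \<Omega>.\<close>
  define K1 where "K1 = 1 + C + \<epsilon>0 + c2"
  define K2 where "K2 = 1 + 3 * K1 * C / \<rho>"
  define K3 where "K3 = 1 + 2 * K1 + K2"
  define K4 where "K4 = 1 + 2 * K1 / c1 + K2"
  \<comment> \<open>The first summand is the stability estimate for the harmonic part, the second
    accounts for the rest of w. The absolute value is taken because the sign of \<open>C0\<close> is
    not known.\<close>
  define K where "K = \<bar>C0\<bar> * rpow K3 \<alpha> * rpow K4 (1 - \<alpha>) + K2"
  have pos: "K1 > 0" "K2 > 0" "K3 > 0" "K4 > 0"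
  proof -
    show K1: "K1 > 0" using C assms(12,14) by (simp add: K1_def)
    show K2: "K2 > 0" using K1 C \<rho> by (simp add: K2_def add_pos_nonneg)
    show "K3 > 0" "K4 > 0" using K1 K2 assms(13) by (auto simp: K3_def K4_def intro!: add_pos_pos)
  qed
  show ?thesis
  proof (intro exI[of _ K] ballI impI)
    fix \<delta> l q u \<epsilon>
    assume \<delta>: "\<delta> \<in> I" and l: "l \<in> Hm2 \<Omega>" and q: "q \<in> L2 \<omega>" and u: "u \<in> L2 \<Omega>" and \<epsilon>: "\<epsilon> \<in> {0<..\<epsilon>0}"
      and bal: "c1 * (E_data \<Omega> \<omega> l q u + E_appr \<Omega> (X \<delta>) u) \<le> \<epsilon> * norm_L2 \<Omega> u \<and>
           \<epsilon> * norm_L2 \<Omega> u \<le> c2 * (E_data \<Omega> \<omega> l q u + E_appr \<Omega> (X \<delta>) u)"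
    define E where "E = E_data \<Omega> \<omega> l q u + E_appr \<Omega> (X \<delta>) u"
    define U where "U = regularized_solution \<Omega> \<omega> (X \<delta>) (Y \<delta>) \<epsilon> l q"
    define w where "w x = u x - U x" for x
    let ?N\<omega> = "l2norm (lebesgue_on \<omega>)" and ?NG = "l2norm (lebesgue_on G)"
    have usq: "sq_integrable (lebesgue_on \<Omega>) u" using u by (simp add: L2_eq)
    have Xd: "linear_subspace (X \<delta>)" "\<forall>z\<in>X \<delta>. sq_integrable (lebesgue_on \<Omega>) z" "finite_dimensional \<Omega> (X \<delta>)"
      "Y \<delta> \<subseteq> H20 \<Omega>"
      using assms(9,10)[OF \<delta>] by (auto simp: L2_eq[symmetric])
    have bal': "c1 * E \<le> \<epsilon> * N u" "\<epsilon> * N u \<le> c2 * E" using bal by (auto simp: E_def norm_L2_eq)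
    have infsup: "\<forall>z\<in>X \<delta>. \<forall>D\<ge>0. (\<forall>v\<in>Y \<delta>. \<not> zero_on \<Omega> v \<longrightarrow> \<bar>opB \<Omega> z v\<bar> \<le> D * W v) \<longrightarrow>
        (\<forall>v\<in>H20 \<Omega>. \<bar>opB \<Omega> z v\<bar> \<le> D / \<rho> * norm_H2 \<Omega> v)"
      using inf_sup_bound[OF \<rho> \<delta>] Xd(2) by blast
    have normC: "\<forall>v\<in>H20 \<Omega>. norm_H2 \<Omega> v \<le> C * W v" using C(2) by blast
    have qsq: "sq_integrable (lebesgue_on \<omega>) q" using q by (simp add: L2_eq)
    have \<epsilon>': "0 < \<epsilon>" "\<epsilon> \<le> \<epsilon>0" using \<epsilon> by auto
    note bounds = regularized_error_bounds[OF Xd l \<omega> qsq usq C(1) normC \<rho>(2) infsup \<epsilon>' assms(14) E_def bal'(2),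
        folded U_def K1_def K2_def, folded w_def]
    note E0 = bounds(1)
    have wsq: "sq_integrable (lebesgue_on \<Omega>) w" unfolding w_def by (intro sq_integrable_diff usq bounds)
    \<comment> \<open>The residual bound on H^2_0 is specialised to test functions, whose weak and
      classical Laplacians agree almost everywhere.\<close>
    have "\<bar>\<integral>x. w x * laplacian \<phi> x \<partial>lebesgue_on \<Omega>\<bar> \<le> (K2 * E) * N (laplacian \<phi>)" if \<phi>: "\<phi> \<in> T" for \<phi>
    proof -
      note ae = test_function_weak_laplacian_AE[OF \<phi>]
      note wl = weak_laplacian_sq_integrable[OF test_function_H2[OF \<phi>]] and ll = laplacian_sq_integrable[OF \<phi>]
      have "opB \<Omega> w \<phi> = - l2inner (lebesgue_on \<Omega>) (weak_laplacian \<Omega> \<phi>) w"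
        by (simp add: opB_def l2inner_def mult.commute)
      also have "\<dots> = - l2inner (lebesgue_on \<Omega>) (laplacian \<phi>) w"
        by (simp add: l2inner_cong_AE[OF wl ll wsq ae])
      finally have "\<bar>\<integral>x. w x * laplacian \<phi> x \<partial>lebesgue_on \<Omega>\<bar> = \<bar>opB \<Omega> w \<phi>\<bar>"
        by (simp add: l2inner_def mult.commute)
      also have "\<dots> \<le> K2 * E * W \<phi>" unfolding K2_def by (rule bounds(3)[OF test_function_H20[OF \<phi>]])
      also have "W \<phi> = N (laplacian \<phi>)"
        by (rule l2norm_cong_AE[OF sq_integrable_measurable[OF wl] sq_integrable_measurable[OF ll] ae])
      finally show ?thesis .
    qed
    moreover have "0 \<le> K2 * E" using pos E0 by simp
    ultimately obtain h where h: "harmonic_on \<Omega> h" "sq_integrable (lebesgue_on \<Omega>) h" "N (\<lambda>x. w x - h x) \<le> K2 * E"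
      using harmonic_decomposition[OF wsq] by blast
    have whsq: "sq_integrable (lebesgue_on \<Omega>) (\<lambda>x. w x - h x)" by (intro sq_integrable_diff wsq h)
    note sub\<omega> = sq_integrable_subset[OF _ \<omega>(1) domain_sets(2) \<omega>(2)]
      and subG = sq_integrable_subset[OF _ G(1) domain_sets(2) G(2)]
    define mx where "mx = max E (N u)"
    have mx: "E \<le> mx" "N u \<le> mx" "0 \<le> mx" using E0 by (auto simp: mx_def)
    have h\<omega>: "?N\<omega> h \<le> K3 * E"
    proof -
      have "?N\<omega> h \<le> ?N\<omega> w + ?N\<omega> (\<lambda>x. h x - w x)" by (intro l2norm_le_diff sub\<omega> h wsq)
      also have "?N\<omega> (\<lambda>x. h x - w x) = ?N\<omega> (\<lambda>x. w x - h x)" by (rule l2norm_diff_commute)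
      also have "\<dots> \<le> K2 * E" using sub\<omega>(2)[OF whsq] h(3) by linarith
      also have "?N\<omega> w \<le> (1 + 2 * K1) * E" using bounds(4) .
      finally show ?thesis by (simp add: K3_def algebra_simps)
    qed
    have hN: "N h \<le> K4 * mx"
    proof -
      \<comment> \<open>Here the lower balance condition acts: \<open>E\<close> is at most
        \<epsilon> |u| / c1, so dividing by \<epsilon> bounds |U| by a multiple of |u|.\<close>
      have "\<epsilon> * N U \<le> 2 * K1 / c1 * (c1 * E)" using bounds(5) assms(13) by simp
      also have "\<dots> \<le> 2 * K1 / c1 * (\<epsilon> * N u)" using bal'(1) pos assms(13) by (intro mult_left_mono) auto
      finally have "\<epsilon> * N U \<le> \<epsilon> * (2 * K1 / c1 * N u)" by (simp add: mult_ac)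
      then have NU: "N U \<le> 2 * K1 / c1 * N u" using \<epsilon>'(1) by (simp only: mult_le_cancel_left_pos)
      have "N h \<le> N w + N (\<lambda>x. h x - w x)" by (intro l2norm_le_diff h wsq)
      also have "N (\<lambda>x. h x - w x) = N (\<lambda>x. w x - h x)" by (rule l2norm_diff_commute)
      also have "N w \<le> N u + N U" unfolding w_def by (intro l2norm_triangle_diff usq bounds)
      finally have "N h \<le> N u + 2 * K1 / c1 * N u + K2 * E" using NU h(3) by linarith
      also have "\<dots> \<le> mx + 2 * K1 / c1 * mx + K2 * mx"
        using mx pos assms(13) by (intro add_mono mult_left_mono) auto
      finally show ?thesis by (simp add: K4_def algebra_simps)
    qed
    have "?NG h \<le> C0 * rpow (?N\<omega> h) \<alpha> * rpow (N h) (1 - \<alpha>)"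
      using C0[of h] h(1,2) by (simp add: L2_eq norm_L2_eq)
    also have "\<dots> \<le> \<bar>C0\<bar> * rpow (?N\<omega> h) \<alpha> * rpow (N h) (1 - \<alpha>)"
      by (intro mult_right_mono rpow_nonneg) auto
    also have "\<dots> \<le> \<bar>C0\<bar> * rpow (K3 * E) \<alpha> * rpow (K4 * mx) (1 - \<alpha>)"
      using h\<omega> hN assms(6,7) by (intro mult_mono rpow_mono mult_nonneg_nonneg rpow_nonneg) auto
    also have "\<dots> = (\<bar>C0\<bar> * rpow K3 \<alpha> * rpow K4 (1 - \<alpha>)) * (rpow E \<alpha> * rpow mx (1 - \<alpha>))"
      using pos E0 mx(3) by (simp add: rpow_mult mult_ac)
    finally have hG: "?NG h \<le> (\<bar>C0\<bar> * rpow K3 \<alpha> * rpow K4 (1 - \<alpha>)) * (rpow E \<alpha> * rpow mx (1 - \<alpha>))" .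
    \<comment> \<open>The non-harmonic part is of order \<open>E\<close> only; splitting E =
      E^\<alpha> E^(1-\<alpha>) and enlarging the second factor brings it to the shape of the
      claim.\<close>
    have "E = rpow E \<alpha> * rpow E (1 - \<alpha>)" using rpow_mult_rpow[OF E0 assms(6,7)] by simp
    also have "\<dots> \<le> rpow E \<alpha> * rpow mx (1 - \<alpha>)"
      using E0 mx assms(7) by (intro mult_left_mono rpow_mono rpow_nonneg) auto
    finally have "K2 * E \<le> K2 * (rpow E \<alpha> * rpow mx (1 - \<alpha>))" using pos by (intro mult_left_mono) auto
    moreover have "?NG w \<le> ?NG h + ?NG (\<lambda>x. w x - h x)" by (intro l2norm_le_diff subG h wsq)
    moreover have "?NG (\<lambda>x. w x - h x) \<le> K2 * E" using subG(2)[OF whsq] h(3) by linarith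
    ultimately have "?NG w \<le> K * (rpow E \<alpha> * rpow mx (1 - \<alpha>))"
      using hG unfolding K_def distrib_right by linarith
    then show "norm_L2 G (\<lambda>x. u x - regularized_solution \<Omega> \<omega> (X \<delta>) (Y \<delta>) \<epsilon> l q x)
             \<le> K * rpow (E_data \<Omega> \<omega> l q u + E_appr \<Omega> (X \<delta>) u) \<alpha>
                 * rpow (max (E_data \<Omega> \<omega> l q u + E_appr \<Omega> (X \<delta>) u) (norm_L2 \<Omega> u)) (1 - \<alpha>)"
      by (simp add: norm_L2_eq E_def mx_def w_def[abs_def] U_def mult.assoc)
  qed
qed

end
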